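(* Let $n\geq 3$, let $\|\cdot\|$ be any unitary similarity invariant norm on the real vector space $H_n^0$ of $n\times n$ self-adjoint traceless complex matrices, and let $\mathcal{K}$ be the isometry group of $\|\cdot\|$. Then one of the following holds: (i) $\mathcal{K}=PSU(n)\rtimes\langle \mathbb{Z}_2,\sigma\rangle$; (ii) $\mathcal{K}=O(n^2-1,\mathbb{R})$.
   Context: $H_n^0$ is the real vector space (of dimension $n^2-1$) of $n\times n$ complex self-adjoint matrices with trace $0$. A norm on $H_n^0$ is unitary similarity invariant if $\|UAU^{-1}\|=\|A\|$ for all $A\in H_n^0$ and all unitary $U\in U(n)$. The isometry group of a norm on $H_n^0$ is the group of all real-linear bijections $L:H_n^0\to H_n^0$ with $\|L(A)\|=\|A\|$ for all $A$; it is a subgroup of $GL(H_n^0)\cong GL(n^2-1,\mathbb{R})$. All groups below are regarded as subgroups of $GL(H_n^0)$: - $PSU(n)$ is the group of maps $A\mapsto UAU^{-1}$ with $U\in SU(n)$ (equivalently $U\in U(n)$). - $\mathbb{Z}_2=\{A\mapsto A,\ A\mapsto -A\}$. - $\sigma$ is the map $\sigma(A)=-A^{T}$ (negative transpose), and $\langle \mathbb{Z}_2,\sigma\rangle$ is the subgroup generated by $\mathbb{Z}_2$ and $\sigma$. - $O(n^2-1,\mathbb{R})$ is the group of all real-linear maps on $H_n^0$ preserving the inner product $\langle A,B\rangle=\operatorname{Tr}(AB)$. In (i), $\rtimes$ denotes the internal semidirect product inside $GL(H_n^0)$, with $PSU(n)$ the normal factor. *)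

theory Defs
  imports "HOL-Analysis.Analysis" "HOL-Algebra.Bij" "HOL-Algebra.Generated_Groups"
begin

definition conj_transpose :: "complex^'n^'n \<Rightarrow> complex^'n^'n" where
  "conj_transpose A = map_matrix cnj (transpose A)"

definition unitary_matrix :: "complex^'n^'n \<Rightarrow> bool" where
  "unitary_matrix U \<longleftrightarrow> conj_transpose U ** U = mat 1 \<and> U ** conj_transpose U = mat 1"

definition herm0 :: "(complex^'n^'n) set" where
  "herm0 = {A. conj_transpose A = A \<and> trace A = 0}"

definition real_linear_on :: "'a::real_vector set \<Rightarrow> ('a \<Rightarrow> 'b::real_vector) \<Rightarrow> bool" where
  "real_linear_on S f \<longleftrightarrow>
     (\<forall>x\<in>S. \<forall>y\<in>S. f (x + y) = f x + f y) \<and> (\<forall>c. \<forall>x\<in>S. f (c *\<^sub>R x) = c *\<^sub>R f x)"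

definition norm_on :: "'a::real_vector set \<Rightarrow> ('a \<Rightarrow> real) \<Rightarrow> bool" where
  "norm_on S N \<longleftrightarrow>
     (\<forall>x\<in>S. 0 \<le> N x) \<and>
     (\<forall>x\<in>S. N x = 0 \<longleftrightarrow> x = 0) \<and>
     (\<forall>c. \<forall>x\<in>S. N (c *\<^sub>R x) = \<bar>c\<bar> * N x) \<and>
     (\<forall>x\<in>S. \<forall>y\<in>S. N (x + y) \<le> N x + N y)"

definition unitary_similarity_invariant :: "(complex^'n^'n \<Rightarrow> real) \<Rightarrow> bool" where
  "unitary_similarity_invariant N \<longleftrightarrow>
     (\<forall>A\<in>herm0. \<forall>U. unitary_matrix U \<longrightarrow> N (U ** A ** matrix_inv U) = N A)"

text \<open>
  Maps of \<^term>\<open>herm0\<close> to itself are represented by extensional functions (undefined outside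
  of \<^term>\<open>herm0\<close>), as in \<^const>\<open>BijGroup\<close>, so that equality of the functions is equality of
  the maps. All groups of maps below are carrier sets inside \<^term>\<open>GL_herm0\<close>, whose
  multiplication is composition.
\<close>

definition GL_herm0 :: "(complex^'n^'n \<Rightarrow> complex^'n^'n) monoid" where
  "GL_herm0 = BijGroup herm0 \<lparr>carrier := {f \<in> Bij herm0. real_linear_on herm0 f}\<rparr>"

definition isometry_group ::
    "(complex^'n^'n \<Rightarrow> real) \<Rightarrow> (complex^'n^'n \<Rightarrow> complex^'n^'n) set" where
  "isometry_group N = {f \<in> carrier GL_herm0. \<forall>A\<in>herm0. N (f A) = N A}"

definition PSU :: "(complex^'n^'n \<Rightarrow> complex^'n^'n) set" where
  "PSU = {(\<lambda>A\<in>herm0. U ** A ** matrix_inv U) | U. unitary_matrix U \<and> det U = 1}"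

definition Z2 :: "(complex^'n^'n \<Rightarrow> complex^'n^'n) set" where
  "Z2 = {\<lambda>A\<in>herm0. A, \<lambda>A\<in>herm0. - A}"

definition neg_transpose :: "complex^'n^'n \<Rightarrow> complex^'n^'n" where
  "neg_transpose = (\<lambda>A\<in>herm0. - transpose A)"

definition orthogonal_herm0 :: "(complex^'n^'n \<Rightarrow> complex^'n^'n) set" where
  "orthogonal_herm0 = {f \<in> extensional herm0 \<inter> (herm0 \<rightarrow> herm0).
     real_linear_on herm0 f \<and> (\<forall>A\<in>herm0. \<forall>B\<in>herm0. trace (f A ** f B) = trace (A ** B))}"

definition internal_semidirect_product ::
    "('a, 'b) monoid_scheme \<Rightarrow> 'a set \<Rightarrow> 'a set \<Rightarrow> 'a set \<Rightarrow> bool" where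
  "internal_semidirect_product G K N H \<longleftrightarrow>
     subgroup K G \<and> N \<lhd> (G\<lparr>carrier := K\<rparr>) \<and> subgroup H (G\<lparr>carrier := K\<rparr>) \<and>
     N <#>\<^bsub>G\<^esub> H = K \<and> N \<inter> H = {\<one>\<^bsub>G\<^esub>}"


lemma herm0_closed:
  fixes A B :: "complex^'n^'n"
  assumes "A \<in> herm0"
  shows "B \<in> herm0 \<Longrightarrow> A + B \<in> herm0" "c *\<^sub>R A \<in> herm0" "- A \<in> herm0" "transpose A \<in> herm0"
proof -
  have A: "\<And>i j. cnj (A $ j $ i) = A $ i $ j" "(\<Sum>i\<in>UNIV. A $ i $ i) = 0"
    using assms by (auto simp: herm0_def conj_transpose_def trace_def vec_eq_iff transpose_def)
  show "A + B \<in> herm0" if "B \<in> herm0"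
    using that A
    by (auto simp: herm0_def conj_transpose_def trace_def vec_eq_iff transpose_def sum.distrib)
  show "c *\<^sub>R A \<in> herm0" "- A \<in> herm0" "transpose A \<in> herm0"
    using A by (auto simp: herm0_def conj_transpose_def trace_def vec_eq_iff transpose_def
        sum_negf scaleR_sum_right[symmetric])
qed

lemma subgroup_GL_herm0:
  "subgroup {f \<in> Bij herm0. real_linear_on herm0 f} (BijGroup (herm0 :: (complex^'n^'n) set))"
proof -
  let ?H = "herm0 :: (complex^'n^'n) set"
  interpret group "BijGroup ?H" by (rule group_BijGroup)
  show ?thesis
  proof (rule subgroupI)
    show "{f \<in> Bij ?H. real_linear_on ?H f} \<subseteq> carrier (BijGroup ?H)"
      by (auto simp: BijGroup_def)
    have "(\<lambda>A\<in>?H. A) \<in> {f \<in> Bij ?H. real_linear_on ?H f}"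
      by (auto simp: id_Bij real_linear_on_def herm0_closed)
    then show "{f \<in> Bij ?H. real_linear_on ?H f} \<noteq> {}" by blast
  next
    fix f assume "f \<in> {f \<in> Bij ?H. real_linear_on ?H f}"
    then have f: "f \<in> Bij ?H" "real_linear_on ?H f" by auto
    have b: "bij_betw f ?H ?H" using f by (simp add: Bij_def)
    let ?g = "inv_into ?H f"
    have m: "?g x \<in> ?H" "f (?g x) = x" if "x \<in> ?H" for x
      using that b by (auto simp: bij_betw_def inv_into_into f_inv_into_f)
    have i: "?g (f x) = x" if "x \<in> ?H" for x
      using that b by (auto simp: bij_betw_def)
    have "?g (x + y) = ?g x + ?g y" if "x \<in> ?H" "y \<in> ?H" for x y
      using i[of "?g x + ?g y"] m that f(2) by (simp add: real_linear_on_def herm0_closed)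
    moreover have "?g (c *\<^sub>R x) = c *\<^sub>R ?g x" if "x \<in> ?H" for x c
      using i[of "c *\<^sub>R ?g x"] m that f(2) by (simp add: real_linear_on_def herm0_closed)
    ultimately have "real_linear_on ?H (\<lambda>x\<in>?H. ?g x)"
      by (simp add: real_linear_on_def herm0_closed)
    then show "inv\<^bsub>BijGroup ?H\<^esub> f \<in> {f \<in> Bij ?H. real_linear_on ?H f}"
      using f by (simp add: inv_BijGroup restrict_inv_into_Bij)
  next
    fix f g assume fg: "f \<in> {f \<in> Bij ?H. real_linear_on ?H f}" "g \<in> {f \<in> Bij ?H. real_linear_on ?H f}"
    then have "compose ?H f g \<in> Bij ?H" by (simp add: compose_Bij)
    with fg show "f \<otimes>\<^bsub>BijGroup ?H\<^esub> g \<in> {f \<in> Bij ?H. real_linear_on ?H f}"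
      using Bij_imp_funcset[of g ?H]
      by (auto simp: BijGroup_def real_linear_on_def compose_eq herm0_closed Pi_iff)
  qed
qed

lemma group_GL_herm0: "group (GL_herm0 :: (complex^'n^'n \<Rightarrow> complex^'n^'n) monoid)"
  unfolding GL_herm0_def
  by (rule group.subgroup_imp_group[OF group_BijGroup subgroup_GL_herm0])

lemma matrix_inv_unitary:
  assumes "unitary_matrix U"
  shows "matrix_inv U = conj_transpose U"
proof -
  let ?V = "conj_transpose U"
  have c: "U ** ?V = mat 1" "?V ** U = mat 1" using assms by (auto simp: unitary_matrix_def)
  then have "U ** matrix_inv U = mat 1"
    unfolding matrix_inv_def by (metis (mono_tags, lifting) someI_ex)
  then have "?V ** (U ** matrix_inv U) = ?V" by simp
  then show ?thesis by (simp add: matrix_mul_assoc c)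
qed

lemma conj_transpose_mult: "conj_transpose (A ** B) = conj_transpose B ** conj_transpose A"
  by (simp add: conj_transpose_def matrix_matrix_mult_def transpose_def vec_eq_iff mult.commute)

lemma conj_transpose_conj_transpose [simp]: "conj_transpose (conj_transpose A) = A"
  by (simp add: conj_transpose_def transpose_def vec_eq_iff)

lemma herm0_conj:
  assumes "unitary_matrix U" "A \<in> herm0"
  shows "U ** A ** matrix_inv U \<in> herm0"
proof -
  have "trace (U ** A ** conj_transpose U) = trace (conj_transpose U ** (U ** A))"
    by (rule trace_mul_sym)
  also have "\<dots> = trace A"
    using assms by (simp add: matrix_mul_assoc unitary_matrix_def)
  finally show ?thesis
    using assms by (simp add: herm0_def matrix_inv_unitary conj_transpose_mult matrix_mul_assoc)
qed

lemma PSU_subset_GL_herm0: "PSU \<subseteq> carrier GL_herm0"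
proof
  fix f :: "complex^'n^'n \<Rightarrow> complex^'n^'n" assume "f \<in> PSU"
  then obtain U :: "complex^'n^'n"
    where f: "f = (\<lambda>A\<in>herm0. U ** A ** matrix_inv U)"
      and U: "unitary_matrix U"
    by (auto simp: PSU_def)
  let ?V = "conj_transpose U"
  have V: "unitary_matrix ?V" using U by (simp add: unitary_matrix_def)
  have c: "U ** ?V = mat 1" "?V ** U = mat 1" using U by (auto simp: unitary_matrix_def)
  have 1: "?V ** (U ** A ** ?V) ** U = A" for A
  proof -
    have "?V ** (U ** A ** ?V) ** U = (?V ** U) ** A ** (?V ** U)" by (simp add: matrix_mul_assoc)
    then show ?thesis by (simp add: c)
  qed
  have 2: "U ** (?V ** A ** U) ** ?V = A" for A
  proof -
    have "U ** (?V ** A ** U) ** ?V = (U ** ?V) ** A ** (U ** ?V)" by (simp add: matrix_mul_assoc)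
    then show ?thesis by (simp add: c)
  qed
  have "bij_betw (\<lambda>A. U ** A ** ?V) herm0 herm0"
    by (rule bij_betw_byWitness[where f' = "\<lambda>A. ?V ** A ** U"])
      (use 1 2 herm0_conj[OF U] herm0_conj[OF V] in
        \<open>auto simp: matrix_inv_unitary[OF U] matrix_inv_unitary[OF V]\<close>)
  then have "f \<in> Bij herm0"
    by (simp add: f Bij_def matrix_inv_unitary[OF U] cong: bij_betw_cong)
  moreover have "real_linear_on herm0 f"
    by (simp add: f real_linear_on_def herm0_closed vec_eq_iff matrix_matrix_mult_def
        sum.distrib distrib_left distrib_right scaleR_sum_right[symmetric])
  ultimately show "f \<in> carrier GL_herm0" by (simp add: GL_herm0_def)
qed

lemma transpose_minus: "transpose (- A) = - transpose (A :: complex^'n^'n)"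
  by (simp add: transpose_def vec_eq_iff)

lemma transpose_add: "transpose (A + B) = transpose A + transpose (B :: complex^'n^'n)"
  by (simp add: transpose_def vec_eq_iff)

lemma transpose_scaleR_complex: "transpose (c *\<^sub>R A) = c *\<^sub>R transpose (A :: complex^'n^'n)"
  by (simp add: transpose_def vec_eq_iff)

lemma generators_subset_GL_herm0: "Z2 \<union> {neg_transpose} \<subseteq> carrier GL_herm0"
proof -
  have "bij_betw (\<lambda>A::complex^'n^'n. - A) herm0 herm0"
    by (rule bij_betw_byWitness[where f' = uminus]) (auto simp: herm0_closed)
  moreover have "bij_betw (\<lambda>A::complex^'n^'n. - transpose A) herm0 herm0"
    by (rule bij_betw_byWitness[where f' = "\<lambda>A. - transpose A"])
      (auto simp: herm0_closed transpose_minus)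
  moreover have "bij_betw (\<lambda>A::complex^'n^'n. A) herm0 herm0"
    by (simp add: bij_betw_def)
  ultimately show ?thesis
    by (auto simp: Z2_def neg_transpose_def GL_herm0_def Bij_def real_linear_on_def herm0_closed
        transpose_add transpose_scaleR_complex cong: bij_betw_cong)
qed

end

theory Submission
  imports Defs
begin

text \<open>
  The unit ball of the norm has an isometry-invariant quadratic form of second moments; since it is
  invariant under unitary similarity it is a multiple of \<open>Tr(AB)\<close>, so every isometry is orthogonal.

  Suppose that some isometry \<open>g\<close> maps two commuting matrices, without loss of generality diagonal, to
  non-commuting ones. For a suitable rank one projection \<open>P\<close>, conjugating the rotation
  \<open>A \<mapsto> A + t i[P, A] + O(t\<^sup>2)\<close> by \<open>g\<close> and projecting to the diagonal gives a nonzero skew map \<open>Y\<close> on the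
  sum-zero vectors. As the projection to the diagonal does not increase the norm,
  \<open>M(x + t Y x) \<le> M(x) + O(t\<^sup>2)\<close> for the restriction \<open>M\<close> of the norm to diagonal matrices. The \<open>Y\<close> with
  this property form a space invariant under permutations; the exterior square of the sum-zero vectors
  is irreducible, so the space contains all infinitesimal rotations, \<open>M\<close> is constant on spheres, and the
  norm is a multiple of the Frobenius norm.

  Otherwise every isometry preserves commutativity. Up to a unitary similarity it maps diagonal
  matrices to diagonal matrices and permutes the roots up to sign, hence it acts on the diagonal by a
  signed permutation. Once it fixes the diagonal, its action on each off-diagonal entry is a rotation
  or reflection, and suitable commuting \<open>3 \<times> 3\<close> matrices make these compatible, so that the isometry is
  a conjugation by a diagonal unitary, possibly composed with the transposition.
\<close>

subsection \<open>Complex matrices\<close>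

text \<open>The first-order inequality takes the place of Lie theory. Projection to the diagonal is
  not multiplicative, so \<open>Y\<close> is not known to generate isometries of \<open>M\<close>;
  what survives is a one-sided estimate with quadratic error. This suffices: composing two such
  steps costs only another second-order term, so the admissible \<open>Y\<close> form a vector
  space, and along a circle the estimate can be applied from both ends of an increment, which forces
  derivative zero. Rank one projections are enough as generators because a nonzero self-adjoint
  matrix has a nonzero quadratic form at some unit vector, and for them the one-parameter group of
  unitaries is explicit.

  The assumption on the size matters in two places. For \<open>n = 2\<close>, commuting traceless
  self-adjoint matrices are proportional, so preserving commutativity carries no information; a
  third index supplies the commuting pairs that link different off-diagonal entries. Also, for
  \<open>n = 2\<close> the negative transpose is itself a unitary conjugation, so the two factors of
  the semidirect product would meet nontrivially.\<close>

definition smat :: "complex \<Rightarrow> complex^'n^'n \<Rightarrow> complex^'n^'n" where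
  "smat c A = (\<chi> i j. c * A$i$j)"

definition outer :: "complex^'n \<Rightarrow> complex^'n^'n" where
  "outer v = (\<chi> i j. v$i * cnj (v$j))"

text \<open>With \<open>conj_transpose\<close> in place of \<open>matrix_inv\<close> the expression
  is polynomial in the entries and their conjugates, hence continuous on all matrices, and
  \<open>Ad_Ad\<close> and \<open>linear_Ad\<close> need no hypothesis. The two versions agree for
  unitary \<open>U\<close>.\<close>

definition Ad :: "complex^'n^'n \<Rightarrow> complex^'n^'n \<Rightarrow> complex^'n^'n" where
  "Ad U A = U ** A ** conj_transpose U"

definition dg :: "real^'n \<Rightarrow> complex^'n^'n" where
  "dg x = (\<chi> i j. if i = j then complex_of_real (x$i) else 0)"

definition dpart :: "complex^'n^'n \<Rightarrow> real^'n" where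
  "dpart A = (\<chi> i. Re (A$i$i))"

text \<open>The factor \<open>\<i>\<close> keeps the commutator of self-adjoint matrices
  self-adjoint; this is the derivative at \<open>t = 0\<close> of the conjugation of
  \<open>B\<close> by \<open>exp (\<i> t A)\<close>.\<close>

definition br :: "complex^'n^'n \<Rightarrow> complex^'n^'n \<Rightarrow> complex^'n^'n" where
  "br A B = smat \<i> (A ** B - B ** A)"

definition sum0 :: "(real^'n) set" where
  "sum0 = {x. (\<Sum>i\<in>UNIV. x$i) = 0}"

lemma smat_nth [simp]: "smat c A $ i $ j = c * A$i$j"
  by (simp add: smat_def)

lemma dg_nth: "dg x $ i $ j = (if i = j then complex_of_real (x$i) else 0)"
  by (simp add: dg_def)

lemma dpart_nth [simp]: "dpart A $ i = Re (A$i$i)"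
  by (simp add: dpart_def)

lemma conj_transpose_nth [simp]: "conj_transpose A $ i $ j = cnj (A$j$i)"
  by (simp add: conj_transpose_def transpose_def)

lemma smat_mult [simp]: "smat c A ** B = smat c (A ** B)" "A ** smat c B = smat c (A ** B)"
  by (simp_all add: vec_eq_iff matrix_matrix_mult_def sum_distrib_left mult_ac)

lemma smat_smat [simp]: "smat c (smat d A) = smat (c * d) A"
  by (simp add: vec_eq_iff)

lemma smat_1 [simp]: "smat 1 A = A" and smat_0 [simp]: "smat 0 A = 0" "smat c 0 = 0"
  by (simp_all add: vec_eq_iff)

lemma smat_add_right: "smat c (A + B) = smat c A + smat c B"
  and smat_add_left: "smat (c + d) A = smat c A + smat d A"
  and smat_diff_right: "smat c (A - B) = smat c A - smat c B"
  and smat_diff_left: "smat (c - d) A = smat c A - smat d A"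
  and smat_minus_left: "smat (- c) A = - smat c A"
  by (simp_all add: vec_eq_iff algebra_simps)

lemma smat_of_real: "smat (of_real t) A = t *\<^sub>R A"
  by (simp add: vec_eq_iff complex_eq_iff)

lemma matrix_add_rdistrib_c: "(A + B) ** C = A ** C + B ** (C :: complex^'n^'n)"
  by (simp add: vec_eq_iff matrix_matrix_mult_def sum.distrib algebra_simps)

lemma matrix_mult_diff_left: "(A - B) ** C = A ** C - B ** (C :: complex^'n^'n)"
  by (simp add: vec_eq_iff matrix_matrix_mult_def sum_subtractf algebra_simps)

lemma matrix_mult_diff_right: "C ** (A - B) = C ** A - C ** (B :: complex^'n^'n)"
  by (simp add: vec_eq_iff matrix_matrix_mult_def sum_subtractf algebra_simps)

lemma matrix_mult_minus_left: "(- A) ** C = - (A ** (C :: complex^'n^'n))"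
  by (simp add: vec_eq_iff matrix_matrix_mult_def sum_negf)

lemma matrix_mult_minus_right: "C ** (- A) = - (C ** (A :: complex^'n^'n))"
  by (simp add: vec_eq_iff matrix_matrix_mult_def sum_negf)

lemma matrix_mult_scaleR_left: "(t *\<^sub>R A) ** C = t *\<^sub>R (A ** (C :: complex^'n^'n))"
  by (simp add: vec_eq_iff matrix_matrix_mult_def scaleR_sum_right)

lemma matrix_mult_scaleR_right: "C ** (t *\<^sub>R A) = t *\<^sub>R (C ** (A :: complex^'n^'n))"
  by (simp add: vec_eq_iff matrix_matrix_mult_def scaleR_sum_right)

lemmas matrix_mult_distribs =
  matrix_add_ldistrib matrix_add_rdistrib_c matrix_mult_diff_left matrix_mult_diff_right
  matrix_mult_minus_left matrix_mult_minus_right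

lemma conj_transpose_add: "conj_transpose (A + B) = conj_transpose A + conj_transpose B"
  and conj_transpose_diff: "conj_transpose (A - B) = conj_transpose A - conj_transpose B"
  and conj_transpose_smat: "conj_transpose (smat c A) = smat (cnj c) (conj_transpose A)"
  and conj_transpose_mat_1 [simp]: "conj_transpose (mat 1) = mat 1"
  by (auto simp: vec_eq_iff mat_def)

lemma linear_mult_left: "linear (\<lambda>A::complex^'n^'n. C ** A)"
  by (rule linearI) (simp_all add: matrix_add_ldistrib matrix_mult_scaleR_right)

lemma linear_mult_right: "linear (\<lambda>A::complex^'n^'n. A ** (C :: complex^'n^'n))"
  by (rule linearI) (simp_all only: matrix_add_rdistrib_c matrix_mult_scaleR_left)

lemma linear_Ad: "linear (Ad U)"
  using linear_compose[OF linear_mult_left[of U] linear_mult_right[of "conj_transpose U"]]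
  by (simp add: Ad_def[abs_def] o_def)

lemma norm_smat: "norm (smat c A) = cmod c * norm (A :: complex^'n^'n)"
proof -
  have "norm (\<chi> j. c * v $ j) = cmod c * norm (v :: complex^'n)" for v
    by (simp add: norm_vec_def norm_mult L2_set_right_distrib)
  then have "norm (smat c A $ i) = cmod c * norm (A $ i)" for i
    by (simp add: smat_def)
  then show ?thesis
    by (simp add: norm_vec_def[of "smat c A"] norm_vec_def[of A] L2_set_right_distrib)
qed

lemma inner_matrix: "inner A B = (\<Sum>i\<in>UNIV. \<Sum>j\<in>UNIV. Re (cnj (A$i$j) * B$i$j))"
  for A B :: "complex^'n^'n"
  by (simp add: inner_vec_def inner_complex_def)

lemma inner_eq_trace: "inner A B = Re (trace (conj_transpose A ** B))"
  for A B :: "complex^'n^'n"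
  unfolding inner_matrix
  by (subst sum.swap) (simp add: trace_def matrix_matrix_mult_def)

lemma trace_smat: "trace (smat c A) = c * trace A"
  by (simp add: trace_def sum_distrib_left)

lemma herm0_iff: "A \<in> herm0 \<longleftrightarrow> conj_transpose A = A \<and> trace A = 0"
  by (simp add: herm0_def)

lemma herm0_nth: "A \<in> herm0 \<Longrightarrow> A$i$j = cnj (A$j$i)"
  unfolding herm0_def by (metis (mono_tags, lifting) conj_transpose_nth mem_Collect_eq)

lemma subspace_herm0: "subspace herm0"
  unfolding subspace_def
proof (intro conjI ballI allI)
  show "0 \<in> herm0" by (simp add: herm0_iff trace_def vec_eq_iff)
qed (simp_all add: herm0_closed)

lemma herm0_trace_real:
  fixes A B :: "complex^'n^'n"
  assumes "A \<in> herm0" "B \<in> herm0"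
  shows "trace (A ** B) = complex_of_real (inner A B)"
proof -
  have "cnj (trace (A ** B)) = trace (conj_transpose (A ** B))"
    by (simp add: trace_def)
  also have "\<dots> = trace (B ** A)" using assms by (simp add: conj_transpose_mult herm0_iff)
  also have "\<dots> = trace (A ** B)" by (rule trace_mul_sym)
  finally have "Im (trace (A ** B)) = 0"
    by (metis complex_cnj_cancel_iff complex_is_Real_iff Reals_cnj_iff)
  then show ?thesis using assms by (simp add: inner_eq_trace herm0_iff complex_eq_iff)
qed

lemma unitary_Ad: "unitary_matrix U \<Longrightarrow> U ** A ** matrix_inv U = Ad U A"
  by (simp add: Ad_def matrix_inv_unitary)

lemma Ad_herm0: "unitary_matrix U \<Longrightarrow> A \<in> herm0 \<Longrightarrow> Ad U A \<in> herm0"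
  using herm0_conj[of U A] by (simp add: unitary_Ad)

lemma unitary_matrixI: "U ** conj_transpose U = mat 1 \<Longrightarrow> unitary_matrix U"
  by (simp add: unitary_matrix_def matrix_left_right_inverse)

lemma unitary_conj_transpose: "unitary_matrix U \<Longrightarrow> unitary_matrix (conj_transpose U)"
  by (simp add: unitary_matrix_def)

lemma unitary_mult: "unitary_matrix U \<Longrightarrow> unitary_matrix V \<Longrightarrow> unitary_matrix (U ** V)"
  unfolding unitary_matrix_def conj_transpose_mult
  by (metis matrix_mul_assoc matrix_mul_rid)

lemma unitary_mat_1: "unitary_matrix (mat 1)"
  by (simp add: unitary_matrix_def)

lemma Ad_mat_1 [simp]: "Ad (mat 1) A = A"
  by (simp add: Ad_def)

lemma Ad_Ad: "Ad U (Ad V A) = Ad (U ** V) A"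
  by (simp add: Ad_def conj_transpose_mult matrix_mul_assoc)

lemma Ad_inverse:
  assumes "unitary_matrix U"
  shows "Ad (conj_transpose U) (Ad U A) = A" "Ad U (Ad (conj_transpose U) A) = A"
  using assms by (simp_all add: Ad_Ad unitary_matrix_def)

lemma Ad_mult:
  assumes "unitary_matrix U"
  shows "Ad U (A ** B) = Ad U A ** Ad U B"
proof -
  have "Ad U A ** Ad U B = U ** A ** (conj_transpose U ** U) ** B ** conj_transpose U"
    by (simp add: Ad_def matrix_mul_assoc)
  also have "\<dots> = Ad U (A ** B)"
    using assms by (simp only: unitary_matrix_def matrix_mul_rid) (simp add: Ad_def matrix_mul_assoc)
  finally show ?thesis by simp
qed

lemma conj_transpose_Ad: "conj_transpose (Ad U A) = Ad U (conj_transpose A)"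
  by (simp add: Ad_def conj_transpose_mult matrix_mul_assoc)

lemma trace_Ad: "unitary_matrix U \<Longrightarrow> trace (Ad U A) = trace A"
  unfolding Ad_def by (metis matrix_mul_assoc matrix_mul_lid trace_mul_sym unitary_matrix_def)

lemma inner_Ad: "unitary_matrix U \<Longrightarrow> inner (Ad U A) (Ad U B) = inner A B"
  unfolding inner_eq_trace conj_transpose_Ad by (simp add: Ad_mult[symmetric] trace_Ad)

lemma norm_Ad: "unitary_matrix U \<Longrightarrow> norm (Ad U A) = norm A"
  by (simp add: norm_eq_sqrt_inner inner_Ad)

lemma Ad_comm_iff:
  assumes "unitary_matrix U"
  shows "Ad U A ** Ad U B = Ad U B ** Ad U A \<longleftrightarrow> A ** B = B ** A"
  unfolding Ad_mult[OF assms, symmetric] by (metis Ad_inverse(1)[OF assms])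

lemma linear_dg: "linear dg"
  by (rule linearI) (auto simp: vec_eq_iff dg_nth complex_eq_iff)

lemma linear_dpart: "linear dpart"
  by (rule linearI) (auto simp: vec_eq_iff)

lemma dpart_dg [simp]: "dpart (dg x) = x"
  by (simp add: vec_eq_iff dg_nth)

lemma dg_herm0_iff: "dg x \<in> herm0 \<longleftrightarrow> x \<in> sum0"
  by (auto simp: herm0_iff sum0_def vec_eq_iff dg_nth trace_def simp flip: of_real_sum)

lemma dpart_sum0: "A \<in> herm0 \<Longrightarrow> dpart A \<in> sum0"
  by (simp add: herm0_iff sum0_def trace_def flip: Re_sum)

lemma inner_dg: "inner (dg x) A = inner x (dpart A)"
  by (simp add: inner_matrix inner_vec_def dg_nth if_distrib[of cnj] if_distrib[of "\<lambda>z. z * _"] if_distrib[of Re] cong: if_cong)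

lemma norm_dg [simp]: "norm (dg x) = norm x"
  by (simp add: norm_eq_sqrt_inner inner_dg)

lemma subspace_sum0: "subspace sum0"
  by (auto simp: subspace_def sum0_def sum.distrib simp flip: sum_distrib_left)

lemma dg_mult_nth: "(dg x ** A) $ i $ j = of_real (x$i) * A$i$j"
  "(A ** dg x) $ i $ j = A$i$j * of_real (x$j)"
  by (simp_all add: matrix_matrix_mult_def dg_nth if_distrib[of "\<lambda>z. _ * z"] if_distrib[of "\<lambda>z. z * _"] cong: if_cong)

lemma dg_comm_iff: "dg x ** A = A ** dg x \<longleftrightarrow> (\<forall>i j. x$i \<noteq> x$j \<longrightarrow> A$i$j = 0)"
  by (auto simp: vec_eq_iff dg_mult_nth)

lemma herm0_diagonal: "A \<in> herm0 \<Longrightarrow> (\<And>i j. i \<noteq> j \<Longrightarrow> A$i$j = 0) \<Longrightarrow> A = dg (dpart A)"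
proof -
  assume "A \<in> herm0" and *: "\<And>i j. i \<noteq> j \<Longrightarrow> A$i$j = 0"
  then have "Im (A$i$i) = 0" for i
    using arg_cong[OF herm0_nth[of A i i], of Im] by simp
  with * show "A = dg (dpart A)" by (auto simp: vec_eq_iff dg_nth complex_eq_iff)
qed

lemma dg_comm: "dg x ** dg y = dg y ** dg x"
  by (auto simp: dg_comm_iff dg_nth)

lemma br_herm0:
  assumes "conj_transpose A = A" "conj_transpose B = B"
  shows "br A B \<in> herm0"
proof -
  have "trace (A ** B - B ** A) = 0" by (simp add: trace_sub trace_mul_sym[of A B])
  then have "trace (br A B) = 0"
    by (simp add: br_def trace_smat)
  moreover have "conj_transpose (br A B) = br A B"
    using assms by (simp add: br_def conj_transpose_smat conj_transpose_diff conj_transpose_mult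
        smat_minus_left smat_diff_right)
  ultimately show ?thesis by (simp add: herm0_iff)
qed

text \<open>Cyclicity of the trace. It is used to move a derivative from the matrix being varied to
  the generator of the variation.\<close>

lemma inner_br:
  assumes "conj_transpose A = A" "conj_transpose B = B" "conj_transpose C = C"
  shows "inner A (br B C) = inner B (br C A)"
proof -
  have 1: "trace (A ** (B ** C)) = trace (B ** (C ** A))"
    by (metis matrix_mul_assoc trace_mul_sym)
  have 2: "trace (A ** (C ** B)) = trace (B ** (A ** C))"
    by (metis matrix_mul_assoc trace_mul_sym)
  show ?thesis using assms 1 2
    by (simp add: inner_eq_trace br_def trace_smat matrix_mult_distribs trace_sub)
qed

lemma linear_br: "linear (br P)"
  by (rule linearI) (simp_all add: br_def vec_eq_iff matrix_add_ldistrib matrix_add_rdistrib_c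
      matrix_mult_scaleR_left matrix_mult_scaleR_right algebra_simps)

lemma br_eq_0_iff: "br A B = 0 \<longleftrightarrow> A ** B = B ** A"
  by (auto simp: br_def vec_eq_iff)

lemma linear_bound:
  assumes "linear (f :: 'a::euclidean_space \<Rightarrow> 'b::real_normed_vector)"
  shows "\<exists>B>0. \<forall>x. norm (f x) \<le> B * norm x"
  using linear_bounded_pos[OF assms] by metis

subsection \<open>Unitaries close to the identity\<close>

text \<open>For a unit vector \<open>v\<close> this is \<open>exp (\<i> t P)\<close> with the
  projection \<open>P = outer v\<close>; since \<open>P\<close> is idempotent, the exponential
  series collapses to this closed form.\<close>

definition rot :: "complex^'n \<Rightarrow> real \<Rightarrow> complex^'n^'n" where
  "rot v t = mat 1 + smat (cis t - 1) (outer v)"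

lemma conj_transpose_outer [simp]: "conj_transpose (outer v) = outer v"
  by (simp add: vec_eq_iff outer_def)

lemma outer_mult_outer:
  fixes v :: "complex^'n"
  assumes "norm v = 1"
  shows "outer v ** outer v = outer v"
proof -
  have "complex_of_real ((norm v)\<^sup>2) = (\<Sum>k\<in>UNIV. cnj (v$k) * v$k)"
    by (simp add: power2_norm_eq_inner inner_vec_def inner_complex_def complex_eq_iff)
  then have *: "(\<Sum>k\<in>UNIV. cnj (v$k) * v$k) = 1" using assms by simp
  have "(outer v ** outer v) $ i $ j = v$i * (\<Sum>k\<in>UNIV. cnj (v$k) * v$k) * cnj (v$j)" for i j
    by (simp add: matrix_matrix_mult_def outer_def sum_distrib_left sum_distrib_right mult_ac)
  then show ?thesis by (simp add: * vec_eq_iff outer_def)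
qed


lemma Ad_rot:
  fixes A :: "complex^'n^'n"
  shows "Ad (rot v t) A = A + smat (cis t - 1) (outer v ** A) + smat (cnj (cis t - 1)) (A ** outer v)
     + smat ((cis t - 1) * cnj (cis t - 1)) (outer v ** A ** outer v)"
proof -
  have *: "(mat 1 + X) ** A ** (mat 1 + Y) = A + X ** A + A ** Y + X ** A ** Y" for X Y :: "complex^'n^'n"
    by (simp add: matrix_add_ldistrib matrix_add_rdistrib_c add.assoc)
  have "conj_transpose (rot v t) = mat 1 + smat (cnj (cis t - 1)) (outer v)"
    by (simp only: rot_def conj_transpose_add conj_transpose_mat_1 conj_transpose_smat conj_transpose_outer)
  then show ?thesis
    unfolding Ad_def rot_def by (simp only: * smat_mult smat_smat mult.commute[of "cnj (cis t - 1)"])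
qed

lemma unitary_rot:
  assumes "norm v = 1"
  shows "unitary_matrix (rot v t)"
proof (rule unitary_matrixI)
  define e where "e = cis t - 1"
  have "cis t * cnj (cis t) = 1" by (simp add: cis_cnj cis_mult)
  \<comment> \<open>This says that \<open>1 + e\<close> has modulus one; the sum is the coefficient
    of \<open>outer v\<close> in \<open>Ad (rot v t) (mat 1)\<close>.\<close>
  then have "e + cnj e + e * cnj e = 0"
    by (simp add: algebra_simps e_def)
  then have *: "smat e (outer v) + smat (cnj e) (outer v) + smat (e * cnj e) (outer v) = 0"
    by (metis smat_add_left smat_0(1))
  have "rot v t ** conj_transpose (rot v t) = Ad (rot v t) (mat 1)"
    by (simp add: Ad_def)
  also have "\<dots> = mat 1 + (smat e (outer v) + smat (cnj e) (outer v) + smat (e * cnj e) (outer v))"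
    by (simp only: Ad_rot e_def[symmetric] matrix_mul_lid matrix_mul_rid outer_mult_outer[OF assms] add.assoc)
  finally show "rot v t ** conj_transpose (rot v t) = mat 1"
    by (simp only: * add_0_right)
qed

lemma cis_bound: "cmod (cis t - 1 - \<i> * of_real t) \<le> t\<^sup>2"
proof -
  have "(\<Sum>k\<le>1. (\<i> * of_real t) ^ k / fact k) = 1 + \<i> * complex_of_real t" by simp
  with Taylor_exp[of "\<i> * of_real t" 1] show ?thesis
    by (simp add: cis_conv_exp norm_mult power2_eq_square diff_diff_eq)
qed

lemma cis_bound_1: "cmod (cis t - 1) \<le> \<bar>t\<bar>"
  using Taylor_exp[of "\<i> * of_real t" 0] by (simp add: cis_conv_exp norm_mult)

text \<open>The bounds \<open>cis_bound\<close> and \<open>cis_bound_1\<close> hold for every real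
  \<open>t\<close>, so the constant depends on \<open>v\<close> alone and \<open>t\<close> need not
  be small.\<close>

lemma Ad_rot_expansion:
  fixes v :: "complex^'n"
  shows "\<exists>C\<ge>0. \<forall>A t. norm (Ad (rot v t) A - (A + t *\<^sub>R br (outer v) A)) \<le> C * t\<^sup>2 * norm A"
proof -
  let ?P = "outer v"
  have l: "linear (\<lambda>A :: complex^'n^'n. ?P ** A)" "linear (\<lambda>A :: complex^'n^'n. A ** ?P)"
    by (rule linear_mult_left linear_mult_right)+
  obtain a where a: "a > 0" "\<forall>A :: complex^'n^'n. norm (?P ** A) \<le> a * norm A"
    using linear_bound[OF l(1)] by blast
  obtain b where b: "b > 0" "\<forall>A :: complex^'n^'n. norm (A ** ?P) \<le> b * norm A"
    using linear_bound[OF l(2)] by blast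
  show ?thesis
  proof (intro exI[of _ "a + b + b * a"] conjI allI)
    show "0 \<le> a + b + b * a" using a b by simp
    fix A t
    define e where "e = cis t - 1"
    have e1: "cmod (e - \<i> * of_real t) \<le> t\<^sup>2" and "cmod e \<le> \<bar>t\<bar>"
      using cis_bound[of t] cis_bound_1[of t] by (simp_all only: e_def)
    have "cnj e + \<i> * of_real t = cnj (e - \<i> * of_real t)" by simp
    then have e2: "cmod (cnj e + \<i> * of_real t) \<le> t\<^sup>2"
      using e1 by (simp only: complex_mod_cnj)
    have "cmod e * cmod e \<le> \<bar>t\<bar> * \<bar>t\<bar>"
      using \<open>cmod e \<le> \<bar>t\<bar>\<close> by (intro mult_mono) auto
    then have e3: "cmod (e * cnj e) \<le> t\<^sup>2"
      by (simp only: norm_mult complex_mod_cnj power2_eq_square abs_mult_self_eq)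
    have 1: "Ad (rot v t) A = A + smat e (?P ** A) + smat (cnj e) (A ** ?P) + smat (e * cnj e) (?P ** A ** ?P)"
      unfolding e_def by (rule Ad_rot)
    have 2: "t *\<^sub>R br ?P A = smat (\<i> * of_real t) (?P ** A) - smat (\<i> * of_real t) (A ** ?P)"
      by (simp add: br_def smat_of_real[symmetric] smat_diff_right mult.commute)
    have "Ad (rot v t) A - (A + t *\<^sub>R br ?P A) = smat (e - \<i> * of_real t) (?P ** A)
        + smat (cnj e + \<i> * of_real t) (A ** ?P) + smat (e * cnj e) (?P ** A ** ?P)"
      unfolding 1 2 smat_diff_left smat_add_left by (simp only: add.assoc add_diff_eq diff_diff_eq diff_add_eq) (simp add: algebra_simps)
    also have "norm \<dots> \<le> norm (smat (e - \<i> * of_real t) (?P ** A))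
        + norm (smat (cnj e + \<i> * of_real t) (A ** ?P)) + norm (smat (e * cnj e) (?P ** A ** ?P))"
      using norm_triangle_ineq[of "smat (e - \<i> * of_real t) (?P ** A)" "smat (cnj e + \<i> * of_real t) (A ** ?P)"]
      by (intro order.trans[OF norm_triangle_ineq]) linarith
    also have "\<dots> \<le> t\<^sup>2 * (a * norm A) + t\<^sup>2 * (b * norm A) + t\<^sup>2 * (b * (a * norm A))"
    proof -
      have "norm (?P ** A ** ?P) \<le> b * (a * norm A)"
        using b(2)[rule_format, of "?P ** A"] mult_left_mono[OF a(2)[rule_format, of A], of b] b(1) by linarith
      then show ?thesis
        unfolding norm_smat
        by (intro add_mono mult_mono e1 e2 e3 a(2)[rule_format] b(2)[rule_format]) auto
    qed
    finally show "norm (Ad (rot v t) A - (A + t *\<^sub>R br ?P A)) \<le> (a + b + b * a) * t\<^sup>2 * norm A"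
      by (simp add: algebra_simps)
  qed
qed

subsection \<open>Simultaneous diagonalization\<close>

lemma linear_term_eq_0:
  fixes c C :: real
  assumes "\<And>t. t * c \<le> C * t\<^sup>2"
  shows "c = 0"
proof (rule ccontr)
  assume "c \<noteq> 0"
  define K where "K = \<bar>C\<bar> + 1"
  have K: "K > 0" "C \<le> K" by (auto simp: K_def)
  \<comment> \<open>At \<open>t = c / (2 * K)\<close> the linear term is twice as large as
    \<open>K * t\<^sup>2\<close>.\<close>
  have "c\<^sup>2 / (2 * K) \<le> C * (c / (2 * K))\<^sup>2"
    using assms[of "c / (2 * K)"] by (simp add: power2_eq_square)
  also have "\<dots> \<le> K * (c / (2 * K))\<^sup>2" using K by (intro mult_right_mono) auto
  also have "\<dots> = c\<^sup>2 / (4 * K)" using K by (simp add: power2_eq_square)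
  finally show False using K \<open>c \<noteq> 0\<close> by (simp add: field_simps)
qed

text \<open>Polarization vectors: by \<open>inner_outer_pair_vec\<close>, the projection onto this
  vector sees the real part of \<open>Z$i$j * z\<close>, so \<open>z = 1\<close> and
  \<open>z = \<i>\<close> together recover a complex entry.\<close>

definition pair_vec :: "'n \<Rightarrow> 'n \<Rightarrow> complex \<Rightarrow> complex^'n" where
  "pair_vec i j z = (\<chi> k. (if k = i then of_real (1 / sqrt 2) else 0) + (if k = j then of_real (1 / sqrt 2) * z else 0))"

lemma half_sqrt2: "complex_of_real (1 / sqrt 2) * complex_of_real (1 / sqrt 2) = 1 / 2"
proof -
  have "(1 / sqrt 2) * (1 / sqrt 2) = (1 / 2 :: real)" by simp
  then show ?thesis
    by (metis of_real_mult of_real_divide of_real_1 of_real_numeral)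
qed

lemma norm_pair_vec:
  fixes i j :: "'n::finite"
  assumes "i \<noteq> j" "cmod z = 1"
  shows "norm (pair_vec i j z) = 1"
proof -
  have "(cmod (pair_vec i j z $ k))\<^sup>2 = (if k = i then 1/2 else 0) + (if k = j then 1/2 else 0)" for k
    using assms by (auto simp: pair_vec_def norm_mult norm_divide power_divide)
  then show ?thesis by (simp add: norm_vec_def L2_set_def sum.distrib)
qed

lemma inner_outer: "inner (outer v) Z = Re (\<Sum>a\<in>UNIV. cnj (v$a) * (\<Sum>b\<in>UNIV. Z$a$b * v$b))"
  by (simp add: inner_matrix outer_def sum_distrib_left mult_ac)

lemma inner_outer_pair_vec:
  fixes Z :: "complex^'n^'n"
  assumes "i \<noteq> j" "cmod z = 1" "conj_transpose Z = Z"
  shows "inner (outer (pair_vec i j z)) Z = Re (Z$i$i + Z$j$j) / 2 + Re (Z$i$j * z)"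
proof -
  let ?s = "complex_of_real (1 / sqrt 2)"
  have Z: "Z$j$i = cnj (Z$i$j)" using assms(3) by (metis conj_transpose_nth)
  have zz: "cnj z * z = 1" using assms(2) by (metis complex_norm_square mult.commute of_real_1 one_power2)
  have 1: "(\<Sum>b\<in>UNIV. Z$a$b * pair_vec i j z $ b) = ?s * (Z$a$i + Z$a$j * z)" for a
    by (simp add: pair_vec_def distrib_left sum.distrib if_distrib[of "\<lambda>x. _ * x"] mult_ac del: of_real_divide cong: if_cong)
  have "(\<Sum>a\<in>UNIV. cnj (pair_vec i j z $ a) * g a) = ?s * (g i + cnj z * g j)" for g
    by (simp add: pair_vec_def distrib_right distrib_left sum.distrib if_distrib[of "\<lambda>x. x * _"] if_distrib[of "\<lambda>x. _ * x"] if_distrib[of cnj] mult_ac del: of_real_divide cong: if_cong)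
  then have "inner (outer (pair_vec i j z)) Z
      = Re (?s * (?s * (Z$i$i + Z$i$j * z) + cnj z * (?s * (Z$j$i + Z$j$j * z))))"
    unfolding inner_outer 1 by (simp only:)
  also have "?s * (?s * (Z$i$i + Z$i$j * z) + cnj z * (?s * (Z$j$i + Z$j$j * z)))
     = (?s * ?s) * (Z$i$i + Z$i$j * z + cnj z * Z$j$i + (cnj z * z) * Z$j$j)"
    by (simp add: algebra_simps del: of_real_divide)
  also have "\<dots> = (1/2) * (Z$i$i + Z$i$j * z + cnj (Z$i$j * z) + Z$j$j)"
    unfolding half_sqrt2 zz Z by simp
  also have "Re \<dots> = Re (Z$i$i + Z$j$j) / 2 + Re (Z$i$j * z)"
    by simp
  finally show ?thesis .
qed

text \<open>Polarization of the quadratic form of \<open>Z\<close>: basis vectors give the diagonal,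
  \<open>pair_vec\<close> gives the rest. The contrapositive later supplies a rank one projection
  that detects a nonzero commutator.\<close>

lemma hermitian_eq_0:
  fixes Z :: "complex^'n^'n"
  assumes h: "conj_transpose Z = Z" and v: "\<And>v. norm v = 1 \<Longrightarrow> inner (outer v) Z = 0"
  shows "Z = 0"
proof -
  have r: "Im (Z$i$i) = 0" for i
    using arg_cong[OF h, of "\<lambda>A. Im (A$i$i)"] by simp
  have d: "Z$i$i = 0" for i
  proof -
    have "inner (outer (axis i 1)) Z = Re (Z$i$i)"
      by (simp add: inner_outer axis_def if_distrib[of "\<lambda>x. _ * x"] if_distrib[of "\<lambda>x. x * _"]
          if_distrib[of cnj] cong: if_cong)
    then show ?thesis using v[of "axis i 1"] r[of i] by (simp add: norm_axis_1 complex_eq_iff)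
  qed
  have "Z$i$j = 0" if "i \<noteq> j" for i j
  proof -
    have "Re (Z$i$j * z) = 0" if "cmod z = 1" for z
      using v[OF norm_pair_vec[OF \<open>i \<noteq> j\<close> that]] inner_outer_pair_vec[OF \<open>i \<noteq> j\<close> that h]
      by (simp add: d)
    from this[of 1] this[of \<i>] show ?thesis by (simp add: complex_eq_iff)
  qed
  with d show ?thesis by (metis vec_eq_iff zero_index)
qed

lemma continuous_on_matrix_mult [continuous_intros]:
  fixes f g :: "'a::topological_space \<Rightarrow> complex^'n^'n"
  assumes "continuous_on S f" "continuous_on S g"
  shows "continuous_on S (\<lambda>x. f x ** g x)"
  unfolding matrix_matrix_mult_def
  by (intro continuous_on_vec_lambda continuous_on_sum continuous_on_mult continuous_on_component assms)

lemma continuous_on_conj_transpose [continuous_intros]: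
  fixes f :: "'a::topological_space \<Rightarrow> complex^'n^'n"
  assumes "continuous_on S f"
  shows "continuous_on S (\<lambda>x. conj_transpose (f x))"
proof -
  have "(\<lambda>x. conj_transpose (f x)) = (\<lambda>x. \<chi> i j. cnj (f x $ j $ i))"
    by (simp add: fun_eq_iff vec_eq_iff)
  then show ?thesis
    by (simp only:) (intro continuous_on_vec_lambda continuous_on_cnj continuous_on_component assms)
qed

lemma distinct_weights: "\<exists>w::real^'n. \<forall>i j. w$i = w$j \<longrightarrow> i = j"
proof -
  obtain f :: "'n \<Rightarrow> nat" where "inj f"
    using finite_imp_inj_to_nat_seg[of "UNIV :: 'n set"] by auto
  then have "\<forall>i j. (\<chi> i. real (f i)) $ i = (\<chi> i. real (f i)) $ j \<longrightarrow> i = j"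
    by (simp add: inj_eq)
  then show ?thesis by blast
qed

lemma bounded_unitary: "bounded {U :: complex^'n^'n. unitary_matrix U}"
proof -
  have "norm U \<le> sqrt (norm (trace (mat 1 :: complex^'n^'n)))" if "unitary_matrix U" for U :: "complex^'n^'n"
    using that abs_Re_le_cmod[of "trace (mat 1 :: complex^'n^'n)"]
    by (simp add: norm_eq_sqrt_inner inner_eq_trace unitary_matrix_def)
  then show ?thesis unfolding bounded_iff by blast
qed

text \<open>Among the unitaries commuting with \<open>D\<close>, one that maximizes the inner product of
  \<open>U B U\<^sup>*\<close> with a diagonal matrix with distinct entries makes \<open>U B U\<^sup>*\<close> diagonal.\<close>

lemma diagonalize_commuting:
  fixes B :: "complex^'n^'n" and d :: "real^'n"
  assumes B: "conj_transpose B = B" and comm: "dg d ** B = B ** dg d"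
  shows "\<exists>U b. unitary_matrix U \<and> Ad U (dg d) = dg d \<and> Ad U B = dg b"
proof -
  obtain w :: "real^'n" where w: "\<And>i j. w$i = w$j \<Longrightarrow> i = j" using distinct_weights by metis
  define S where "S = {U :: complex^'n^'n. unitary_matrix U \<and> U ** dg d = dg d ** U}"
  have "closed S"
    unfolding S_def unitary_matrix_def
    by (intro closed_Collect_conj closed_Collect_eq continuous_intros)
  moreover have "bounded S"
    using bounded_unitary by (rule bounded_subset) (auto simp: S_def)
  ultimately have "compact S" by (simp add: compact_eq_bounded_closed)
  moreover have "S \<noteq> {}" using unitary_mat_1 by (auto simp: S_def)
  moreover have "continuous_on S (\<lambda>U. inner (dg w) (Ad U B))"
    unfolding Ad_def by (intro continuous_intros)
  ultimately obtain U where U: "U \<in> S" and max: "\<And>V. V \<in> S \<Longrightarrow> inner (dg w) (Ad V B) \<le> inner (dg w) (Ad U B)"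
    using continuous_attains_sup[of S "\<lambda>U. inner (dg w) (Ad U B)"] by metis
  have uU: "unitary_matrix U" and cU: "U ** dg d = dg d ** U" using U by (auto simp: S_def)
  have fixd: "Ad U (dg d) = dg d"
    using cU uU by (metis Ad_def matrix_mul_assoc matrix_mul_rid unitary_matrix_def)
  define B' where "B' = Ad U B"
  have hB': "conj_transpose B' = B'" by (simp add: B'_def conj_transpose_Ad B)
  have commB': "dg d ** B' = B' ** dg d"
    using Ad_comm_iff[OF uU, of "dg d" B] comm by (simp add: fixd B'_def)
  \<comment> \<open>The gradient of the maximized function: by \<open>inner_br\<close>, pairing it
    with a projection gives the derivative along the corresponding rotation. Since the weights are
    distinct, its off-diagonal entries vanish exactly when those of \<open>B'\<close> do.\<close>
  let ?Z = "br B' (dg w)"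
  have hZ: "conj_transpose ?Z = ?Z"
    using br_herm0[OF hB', of "dg w"] by (simp add: herm0_iff vec_eq_iff dg_nth)
  have Z: "?Z$i$j = \<i> * B'$i$j * (w$j - w$i)" for i j
    by (simp add: br_def dg_mult_nth algebra_simps)
  have "B'$i$j = 0" if "i \<noteq> j" for i j
  proof (cases "d$i = d$j")
    \<comment> \<open>Equal entries of \<open>d\<close> make the projection onto
      \<open>pair_vec i j z\<close> commute with \<open>dg d\<close>, so the rotated unitary stays
      in \<open>S\<close> and competes with the maximizer.\<close>
    case True
    have "Re (?Z$i$j * z) = 0" if z: "cmod z = 1" for z
    proof -
      let ?v = "pair_vec i j z"
      have v: "norm ?v = 1" using norm_pair_vec \<open>i \<noteq> j\<close> z by blast
      obtain C where C: "C \<ge> 0"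
        "\<forall>A t. norm (Ad (rot ?v t) A - (A + t *\<^sub>R br (outer ?v) A)) \<le> C * t\<^sup>2 * norm A"
        using Ad_rot_expansion[of ?v] by blast
      have "dg d ** outer ?v = outer ?v ** dg d"
        unfolding dg_comm_iff
      proof (intro allI impI)
        fix a b assume "d$a \<noteq> d$b"
        then have "(a \<noteq> i \<and> a \<noteq> j) \<or> (b \<noteq> i \<and> b \<noteq> j)" using True by metis
        then show "outer ?v $ a $ b = 0" by (auto simp: outer_def pair_vec_def)
      qed
      then have comm_rot: "rot ?v t ** dg d = dg d ** rot ?v t" for t
        by (simp add: rot_def matrix_add_ldistrib matrix_add_rdistrib_c)
      have "t * inner (dg w) (br (outer ?v) B') \<le> (norm w * C * norm B') * t\<^sup>2" for t
      proof -
        have "rot ?v t ** U \<in> S"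
          using unitary_mult[OF unitary_rot[OF v] uU] comm_rot cU
          by (auto simp: S_def) (metis matrix_mul_assoc)
        then have "inner (dg w) (Ad (rot ?v t) B') \<le> inner (dg w) B'"
          using max by (simp add: B'_def Ad_Ad)
        moreover have "\<bar>inner (dg w) (Ad (rot ?v t) B' - (B' + t *\<^sub>R br (outer ?v) B'))\<bar> \<le> norm w * (C * t\<^sup>2 * norm B')"
          using Cauchy_Schwarz_ineq2[of "dg w"] mult_left_mono[OF C(2)[rule_format, of t B'], of "norm w"]
          by (smt (verit) norm_dg norm_ge_zero)
        ultimately show ?thesis by (simp add: inner_simps algebra_simps)
      qed
      then have "inner (dg w) (br (outer ?v) B') = 0" by (rule linear_term_eq_0)
      then have "inner (outer ?v) ?Z = 0"
        using inner_br[of "outer ?v" B' "dg w"] inner_br[of B' "dg w" "outer ?v"] hB'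
        by (simp add: vec_eq_iff dg_nth)
      then show ?thesis
        using inner_outer_pair_vec[OF \<open>i \<noteq> j\<close> z hZ] by (simp add: Z)
    qed
    from this[of 1] this[of \<i>] have "?Z$i$j = 0" by (simp add: complex_eq_iff)
    with w[of i j] \<open>i \<noteq> j\<close> show ?thesis by (auto simp: Z)
  next
    case False
    with commB' show ?thesis by (simp add: dg_comm_iff)
  qed
  moreover have "Im (B'$i$i) = 0" for i
    using arg_cong[OF hB', of "\<lambda>A. Im (A$i$i)"] by simp
  ultimately have "B' = dg (dpart B')" by (auto simp: vec_eq_iff dg_nth complex_eq_iff)
  with uU fixd show ?thesis unfolding B'_def by blast
qed

lemma diagonalize:
  fixes A :: "complex^'n^'n"
  assumes "A \<in> herm0"
  obtains U x where "unitary_matrix U" "x \<in> sum0" "A = Ad U (dg x)"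
proof -
  \<comment> \<open>With \<open>d = 0\<close> the commutation hypothesis of
    \<open>diagonalize_commuting\<close> is void.\<close>
  have "conj_transpose A = A" "dg 0 ** A = A ** dg 0"
    using assms by (simp_all add: herm0_iff dg_comm_iff)
  then obtain U x where U: "unitary_matrix U" "Ad U A = dg x"
    using diagonalize_commuting by blast
  then have "x \<in> sum0" by (metis Ad_herm0 assms dg_herm0_iff)
  with U show thesis by (metis that Ad_inverse(1) unitary_conj_transpose)
qed

lemma diagonalize_pair:
  fixes A B :: "complex^'n^'n"
  assumes A: "A \<in> herm0" and B: "B \<in> herm0" and comm: "A ** B = B ** A"
  obtains U x y where "unitary_matrix U" "x \<in> sum0" "y \<in> sum0" "A = Ad U (dg x)" "B = Ad U (dg y)"
proof -
  obtain U x where U: "unitary_matrix U" and x: "x \<in> sum0" "A = Ad U (dg x)"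
    using diagonalize[OF A] by blast
  define B' where "B' = Ad (conj_transpose U) B"
  have U': "unitary_matrix (conj_transpose U)" using U by (rule unitary_conj_transpose)
  have B': "B' \<in> herm0" using Ad_herm0[OF U' B] by (simp add: B'_def)
  have BB': "B = Ad U B'" by (simp add: B'_def Ad_inverse[OF U])
  have "dg x ** B' = B' ** dg x"
    using comm by (simp add: x BB' Ad_comm_iff[OF U])
  then obtain V y where V: "unitary_matrix V" "Ad V (dg x) = dg x" "Ad V B' = dg y"
    using diagonalize_commuting[of B' x] B' by (auto simp: herm0_iff)
  have y: "y \<in> sum0" using Ad_herm0[OF V(1) B'] V(3) by (simp add: dg_herm0_iff)
  \<comment> \<open>\<open>V\<close> fixes \<open>dg x\<close>, so this unitary diagonalizes
    \<open>B\<close> without disturbing \<open>A\<close>.\<close>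
  show thesis
  proof (rule that[of "U ** conj_transpose V" x y])
    show "unitary_matrix (U ** conj_transpose V)"
      using U V(1) by (intro unitary_mult unitary_conj_transpose)
    show "A = Ad (U ** conj_transpose V) (dg x)"
      using Ad_inverse(1)[OF V(1), of "dg x"] by (simp add: x V(2) flip: Ad_Ad)
    show "B = Ad (U ** conj_transpose V) (dg y)"
      using Ad_inverse(1)[OF V(1), of B'] by (simp add: BB' V(3) flip: Ad_Ad)
  qed (use x y in auto)
qed

subsection \<open>Norms on a subspace and invariant quadratic forms\<close>

text \<open>Isometries are linear only on \<open>herm0\<close>; precomposing with this projection
  makes them total linear maps, and its self-adjointness gives adjoints relative to the
  subspace.\<close>

lemma orthogonal_projection_exists:
  fixes S :: "'a::euclidean_space set"
  assumes "subspace S"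
  shows "\<exists>P. linear P \<and> (\<forall>x. P x \<in> S) \<and> (\<forall>x\<in>S. P x = x) \<and> (\<forall>x. \<forall>y\<in>S. inner (P x) y = inner x y)"
proof -
  obtain B where B: "B \<subseteq> S" "pairwise orthogonal B" "\<And>x. x \<in> B \<Longrightarrow> norm x = 1" "independent B" "span B = S"
    using orthonormal_basis_subspace[OF assms] by metis
  have fin: "finite B" using B(4) by (rule independent_imp_finite)
  define P where "P x = (\<Sum>b\<in>B. (x \<bullet> b) *\<^sub>R b)" for x
  have fix_S: "P x = x" if "x \<in> S" for x
    using orthonormal_basis_expand[OF B(2,3) _ fin] that B(5) by (simp add: P_def)
  have "linear P" unfolding P_def
    by (rule linearI) (simp_all add: inner_simps scaleR_add_left sum.distrib scaleR_sum_right)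
  moreover have "P x \<in> S" for x
    unfolding P_def using B(1) by (intro subspace_sum[OF assms] subspace_scale[OF assms]) auto
  moreover have "inner (P x) y = inner x y" if "y \<in> S" for x y
  proof -
    have "inner (P x) y = inner x (P y)"
      by (simp add: P_def inner_sum_left inner_sum_right inner_commute mult.commute)
    then show ?thesis by (simp add: fix_S[OF that])
  qed
  ultimately show ?thesis using fix_S by blast
qed

lemma norm_on_upper:
  fixes S :: "'a::euclidean_space set"
  assumes S: "subspace S" and N: "norm_on S N"
  shows "\<exists>L>0. \<forall>x\<in>S. N x \<le> L * norm x"
proof -
  obtain B where B: "B \<subseteq> S" "pairwise orthogonal B" "\<And>x. x \<in> B \<Longrightarrow> norm x = 1" "independent B" "span B = S"
    using orthonormal_basis_subspace[OF S] by metis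
  have fin: "finite B" using B(4) by (rule independent_imp_finite)
  have N0: "N 0 = 0" using N subspace_0[OF S] by (auto simp: norm_on_def)
  have *: "N (\<Sum>b\<in>F. c b *\<^sub>R b) \<le> (\<Sum>b\<in>F. \<bar>c b\<bar> * N b)" if "F \<subseteq> B" for F c
    using finite_subset[OF that fin] that
  proof (induction F rule: finite_induct)
    case (insert b F)
    have "b \<in> S" "(\<Sum>b\<in>F. c b *\<^sub>R b) \<in> S"
      using insert B(1) by (auto intro!: subspace_sum[OF S] subspace_scale[OF S])
    then have "N (c b *\<^sub>R b + (\<Sum>b\<in>F. c b *\<^sub>R b)) \<le> \<bar>c b\<bar> * N b + N (\<Sum>b\<in>F. c b *\<^sub>R b)"
      using N subspace_scale[OF S, of b] unfolding norm_on_def by metis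
    with insert show ?case by simp
  qed (simp add: N0)
  have nn: "0 \<le> N b" if "b \<in> B" for b using that B(1) N unfolding norm_on_def by blast
  show ?thesis
  proof (intro exI[of _ "(\<Sum>b\<in>B. N b) + 1"] conjI ballI)
    show "0 < (\<Sum>b\<in>B. N b) + 1" using nn by (simp add: sum_nonneg add_nonneg_pos)
    fix x assume "x \<in> S"
    then have "N x = N (\<Sum>b\<in>B. (x \<bullet> b) *\<^sub>R b)"
      using orthonormal_basis_expand[OF B(2,3) _ fin] B(5) by simp
    also have "\<dots> \<le> (\<Sum>b\<in>B. \<bar>x \<bullet> b\<bar> * N b)" by (rule *) simp
    also have "\<dots> \<le> (\<Sum>b\<in>B. norm x * N b)"
    proof (intro sum_mono mult_right_mono nn)
      fix b assume "b \<in> B" then show "\<bar>x \<bullet> b\<bar> \<le> norm x"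
        using Cauchy_Schwarz_ineq2[of x b] B(3) by simp
    qed
    also have "\<dots> = norm x * (\<Sum>b\<in>B. N b)"
      by (simp add: sum_distrib_left)
    also have "\<dots> \<le> ((\<Sum>b\<in>B. N b) + 1) * norm x"
      by (simp add: algebra_simps)
    finally show "N x \<le> ((\<Sum>b\<in>B. N b) + 1) * norm x" .
  qed
qed

lemma norm_on_continuous:
  fixes S :: "'a::euclidean_space set"
  assumes S: "subspace S" and N: "norm_on S N"
  shows "continuous_on S N"
proof -
  obtain L where L: "L > 0" "\<And>x. x \<in> S \<Longrightarrow> N x \<le> L * norm x" using norm_on_upper[OF S N] by metis
  have 1: "N x - N y \<le> L * dist x y" if "x \<in> S" "y \<in> S" for x y
  proof -
    have "N ((x - y) + y) \<le> N (x - y) + N y"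
      using N that subspace_diff[OF S] unfolding norm_on_def by blast
    with L(2)[of "x - y"] that subspace_diff[OF S, of x y] show ?thesis by (simp add: dist_norm)
  qed
  have "L-lipschitz_on S N"
  proof (rule lipschitz_onI)
    fix x y assume "x \<in> S" "y \<in> S"
    then show "dist (N x) (N y) \<le> L * dist x y"
      using 1[of x y] 1[of y x] by (simp add: dist_real_def abs_le_iff dist_commute)
  qed (use L in auto)
  then show ?thesis by (rule lipschitz_on_continuous_on)
qed

text \<open>The continuous function \<open>N\<close> attains a positive minimum on the compact unit
  sphere of \<open>S\<close>; that sphere is empty only for the zero subspace.\<close>

lemma norm_on_lower:
  fixes S :: "'a::euclidean_space set"
  assumes S: "subspace S" and N: "norm_on S N"
  shows "\<exists>l>0. \<forall>x\<in>S. l * norm x \<le> N x"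
proof (cases "S \<inter> sphere 0 1 = {}")
  case True
  have "x = 0" if "x \<in> S" for x
  proof (rule ccontr)
    assume "x \<noteq> 0"
    then have "(1 / norm x) *\<^sub>R x \<in> S \<inter> sphere 0 1"
      using subspace_scale[OF S that] by simp
    with True show False by blast
  qed
  moreover have "N 0 = 0" using N subspace_0[OF S] by (auto simp: norm_on_def)
  ultimately show ?thesis by (intro exI[of _ 1]) (metis mult_1 norm_zero order_refl zero_less_one)
next
  case False
  have "compact (S \<inter> sphere 0 1)"
    using closed_subspace[OF S] by (simp add: closed_Int_compact)
  moreover have "continuous_on (S \<inter> sphere 0 1) N"
    using norm_on_continuous[OF S N] by (rule continuous_on_subset) blast
  ultimately obtain x0 where x0: "x0 \<in> S \<inter> sphere 0 1" "\<And>x. x \<in> S \<inter> sphere 0 1 \<Longrightarrow> N x0 \<le> N x"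
    using continuous_attains_inf False by metis
  have "N x0 \<ge> 0" "N x0 = 0 \<longleftrightarrow> x0 = 0" using N x0(1) unfolding norm_on_def by blast+
  then have pos: "N x0 > 0" using x0(1) by fastforce
  have "N x0 * norm x \<le> N x" if "x \<in> S" for x
  proof (cases "x = 0")
    case False
    have "N x0 \<le> N ((1 / norm x) *\<^sub>R x)"
      using x0(2)[of "(1 / norm x) *\<^sub>R x"] subspace_scale[OF S that] False by simp
    also have "\<dots> = N x / norm x"
      using N that unfolding norm_on_def by simp
    finally show ?thesis using False by (simp add: field_simps)
  qed (use N that in \<open>auto simp: norm_on_def\<close>)
  with pos show ?thesis by blast
qed

lemma integrable_continuous_compact:
  fixes f :: "'a::euclidean_space \<Rightarrow> 'b::euclidean_space"
  assumes "compact B" "continuous_on B f"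
  shows "f absolutely_integrable_on B"
  using borel_integrable_compact[OF assms] unfolding set_integrable_def
  by (simp add: integrable_completion)

text \<open>A set of finite nonzero measure that \<open>T\<close> maps onto itself forces the
  determinant of \<open>T\<close> to be 1 or -1. The \<open>wellorder\<close> index type and the
  detour through \<open>real^1\<close> fit the change of variables formula.\<close>

lemma integral_measure_preserving_linear:
  fixes T :: "real^'m::{finite,wellorder} \<Rightarrow> real^'m::_" and f :: "real^'m::_ \<Rightarrow> real"
  assumes T: "linear T" and TB: "T ` B = B" and B: "compact B" "\<not> negligible B"
    and f: "continuous_on UNIV f"
  shows "integral B (\<lambda>x. f (T x)) = integral B f"
proof -
  have lB: "B \<in> lmeasurable" using B(1) by (rule lmeasurable_compact)
  then have "measure lebesgue B \<noteq> 0" using B(2) negligible_iff_measure0 by blast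
  moreover have "measure lebesgue B = \<bar>det (matrix T)\<bar> * measure lebesgue B"
    using measure_linear_image[OF T lB] TB by simp
  ultimately have det: "\<bar>det (matrix T)\<bar> = 1" by simp
  let ?F = "\<lambda>x. (vec (f x) :: real^1)"
  have F: "continuous_on B ?F"
    unfolding vec_def by (intro continuous_on_vec_lambda continuous_on_subset[OF f]) simp
  have FT: "continuous_on B (\<lambda>x. ?F (T x))"
    unfolding vec_def
    by (intro continuous_on_vec_lambda continuous_on_compose2[OF f] linear_continuous_on)
      (use T in \<open>auto simp: linear_conv_bounded_linear\<close>)
  have ai: "?F absolutely_integrable_on B" "(\<lambda>x. ?F (T x)) absolutely_integrable_on B"
    using F FT B(1) by (auto intro: integrable_continuous_compact)
  have "integral (T ` B) ?F = \<bar>det (matrix T)\<bar> *\<^sub>R integral B (?F \<circ> T)"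
    using ai(1) TB by (intro integral_change_of_variables_linear T) simp
  then have "integral B ?F = integral B (\<lambda>x. ?F (T x))" by (simp add: TB det o_def)
  then have "integral B (\<lambda>x. ?F x $ 1) = integral B (\<lambda>x. ?F (T x) $ 1)"
    using ai by (simp add: set_lebesgue_integral_eq_integral(1) del: vec_component)
  then show ?thesis by simp
qed

text \<open>The second moments of the unit ball of a norm form a quadratic form which is invariant under
  all isometries of the norm, because a linear isometry preserves Lebesgue measure. The unit ball
  of \<open>S\<close> is thickened in the orthogonal directions, so that the integral is over the whole space.\<close>

lemma invariant_form_exists:
  fixes S :: "'a::euclidean_space set"
  assumes dim: "CARD('m::{finite,wellorder}) = DIM('a)" and S: "subspace S" and N: "norm_on S N"
  shows "\<exists>C. (\<forall>a b. C a b = C b a) \<and> (\<forall>a b c. C (a + b) c = C a c + C b c) \<and>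
     (\<forall>t a b. C (t *\<^sub>R a) b = t * C a b) \<and> (\<forall>a\<in>S. a \<noteq> 0 \<longrightarrow> C a a > 0) \<and>
     (\<forall>k g. linear k \<longrightarrow> k ` S = S \<longrightarrow> (\<forall>x\<in>S. N (k x) = N x) \<longrightarrow>
        (\<forall>a\<in>S. \<forall>x\<in>S. inner (g a) x = inner a (k x)) \<longrightarrow> (\<forall>a\<in>S. \<forall>b\<in>S. C (g a) (g b) = C a b))"
proof -
  \<comment> \<open>Integration takes place on \<open>real^'m\<close>, where linear maps have
    determinants; \<open>\<psi>\<close> identifies it isometrically with the given space.\<close>
  have "DIM(real^'m::_) = DIM('a)" using dim by simp
  then obtain \<psi> :: "real^'m::_ \<Rightarrow> 'a" and \<phi> where \<psi>: "linear \<psi>" "linear \<phi>" "\<And>x. norm (\<psi> x) = norm x"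
    "\<And>x. \<phi> (\<psi> x) = x" "\<And>y. \<psi> (\<phi> y) = y"
    by (rule isomorphisms_UNIV_UNIV) blast
  obtain P where P: "linear P" "\<And>x. P x \<in> S" "\<And>x. x \<in> S \<Longrightarrow> P x = x"
    "\<And>x y. y \<in> S \<Longrightarrow> inner (P x) y = inner x y"
    using orthogonal_projection_exists[OF S] by metis
  obtain l where l: "l > 0" "\<And>x. x \<in> S \<Longrightarrow> l * norm x \<le> N x" using norm_on_lower[OF S N] by metis
  let ?p = "\<lambda>z. P (\<psi> z)"
  have lp: "linear ?p" using linear_compose[OF \<psi>(1) P(1)] by (simp add: o_def)
  have cp: "continuous_on UNIV ?p" using lp by (simp add: linear_continuous_on linear_conv_bounded_linear)
  have c\<psi>: "continuous_on UNIV \<psi>" using \<psi>(1) by (simp add: linear_continuous_on linear_conv_bounded_linear)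
  have cN: "continuous_on UNIV (\<lambda>z. N (?p z))"
    by (rule continuous_on_compose2[OF norm_on_continuous[OF S N] cp]) (use P in auto)
  \<comment> \<open>In coordinates: the product of the unit ball of \<open>N\<close> in
    \<open>S\<close> and the Euclidean unit ball of the orthogonal complement. The open
    neighbourhood \<open>O1\<close> of zero inside it shows that it is not negligible.\<close>
  define B where "B = {z. N (?p z) \<le> 1 \<and> norm (\<psi> z - ?p z) \<le> 1}"
  define O1 where "O1 = {z. N (?p z) < 1 \<and> norm (\<psi> z - ?p z) < 1}"
  have "N 0 = 0" using N subspace_0[OF S] by (auto simp: norm_on_def)
  then have O1: "open O1" "0 \<in> O1" "O1 \<subseteq> B"
    unfolding O1_def B_def using linear_0[OF lp] linear_0[OF \<psi>(1)]
    by (auto intro!: open_Collect_conj open_Collect_less continuous_intros cN cp c\<psi>)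
  have "closed B"
    unfolding B_def by (intro closed_Collect_conj closed_Collect_le continuous_intros cN cp c\<psi>)
  moreover have "norm z \<le> 1 / l + 1" if "z \<in> B" for z
  proof -
    have "norm (?p z) \<le> 1 / l" using that l(2)[of "?p z"] P(2) l(1) by (simp add: B_def field_simps)
    moreover have "norm (\<psi> z) \<le> norm (?p z) + norm (\<psi> z - ?p z)"
      by (rule norm_triangle_sub)
    ultimately show ?thesis using that \<psi>(3) by (simp add: B_def)
  qed
  ultimately have B: "compact B" by (auto simp: compact_eq_bounded_closed bounded_iff)
  have nB: "\<not> negligible B" using O1 open_not_negligible negligible_subset by blast
  define f where "f a b z = inner a (?p z) * inner b (?p z)" for a b z
  have cf: "continuous_on UNIV (f a b)" for a b
    unfolding f_def by (intro continuous_intros cp)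
  have intf: "f a b integrable_on B" for a b
    using integrable_continuous_compact[OF B continuous_on_subset[OF cf]]
    by (simp add: set_lebesgue_integral_eq_integral(1))
  define C where "C a b = integral B (f a b)" for a b
  have "C a b = C b a" for a b
    unfolding C_def f_def by (simp add: mult.commute)
  moreover have "C (a + b) c = C a c + C b c" for a b c
    unfolding C_def using Henstock_Kurzweil_Integration.integral_add[OF intf intf, of a c b c]
    by (simp add: f_def[abs_def] inner_simps distrib_right)
  moreover have "C (t *\<^sub>R a) b = t * C a b" for t a b
    unfolding C_def using Henstock_Kurzweil_Integration.integral_mult[OF intf, of t a b]
    by (simp add: f_def[abs_def] mult.assoc)
  moreover have "C a a > 0" if a: "a \<in> S" "a \<noteq> 0" for a
  proof -
    have ai: "integrable lebesgue (\<lambda>z. indicator B z *\<^sub>R f a a z)"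
      using integrable_continuous_compact[OF B continuous_on_subset[OF cf]] by (simp add: set_integrable_def)
    have C: "C a a = integral\<^sup>L lebesgue (\<lambda>z. indicator B z *\<^sub>R f a a z)"
      unfolding C_def using integrable_continuous_compact[OF B continuous_on_subset[OF cf], of a a]
      by (simp add: set_lebesgue_integral_eq_integral(2)[symmetric] set_lebesgue_integral_def)
    have "C a a \<ge> 0"
      unfolding C by (rule Bochner_Integration.integral_nonneg_AE) (simp add: f_def)
    moreover have "C a a \<noteq> 0"
    proof
      \<comment> \<open>A vanishing integral would make the square \<open>f a a\<close> vanish
        almost everywhere on \<open>B\<close>, but it is positive on the nonempty open set
        \<open>O2\<close>.\<close>
      assume "C a a = 0"
      then have "AE z in lebesgue. indicator B z *\<^sub>R f a a z = 0"
        unfolding C using integral_nonneg_eq_0_iff_AE[OF ai] by (simp add: f_def)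
      then obtain Z where Z: "{z. indicator B z *\<^sub>R f a a z \<noteq> 0} \<subseteq> Z" "Z \<in> null_sets lebesgue"
        by (auto elim!: AE_E simp: null_sets_def)
      define O2 where "O2 = O1 \<inter> {z. 0 < inner a (?p z)}"
      have "open O2" unfolding O2_def
        by (intro open_Int O1 open_Collect_less continuous_intros cp)
      moreover have "O2 \<subseteq> Z"
        using Z(1) O1(3) by (auto simp: O2_def f_def indicator_def)
      moreover have "O2 \<noteq> {}"
      proof -
        obtain e where e: "e > 0" "ball 0 e \<subseteq> O1" using O1(1,2) openE by blast
        define z where "z = \<phi> ((e / (2 * norm a)) *\<^sub>R a)"
        have \<psi>z: "\<psi> z = (e / (2 * norm a)) *\<^sub>R a" by (simp add: z_def \<psi>(5))
        have "norm z = e / 2" using \<psi>(3)[of z] a e by (simp add: \<psi>z)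
        then have "z \<in> O1" using e by auto
        moreover have "?p z = \<psi> z" using a(1) subspace_scale[OF S] by (intro P(3)) (simp add: \<psi>z)
        then have "0 < inner a (?p z)" using a(2) e by (simp add: \<psi>z)
        ultimately show ?thesis by (auto simp: O2_def)
      qed
      moreover have "negligible Z" using Z(2) by (simp add: negligible_iff_null_sets)
      ultimately show False using open_not_negligible negligible_subset by blast
    qed
    ultimately show ?thesis by simp
  qed
  \<comment> \<open>Here \<open>g\<close> is the adjoint of \<open>k\<close> relative to
    \<open>S\<close>: a substitution in the integration variable passes to \<open>a\<close> and
    \<open>b\<close> as the adjoint. The form is thus shown invariant under adjoints of
    isometries.\<close>
  moreover have "C (g a) (g b) = C a b"
    if k: "linear k" "k ` S = S" "\<forall>x\<in>S. N (k x) = N x"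
      and g: "\<forall>a\<in>S. \<forall>x\<in>S. inner (g a) x = inner a (k x)" and ab: "a \<in> S" "b \<in> S" for k g a b
  proof -
    \<comment> \<open>\<open>T\<close> applies \<open>k\<close> to the component in \<open>S\<close>
      and fixes the orthogonal component, so it maps \<open>B\<close> onto itself.\<close>
    define T where "T z = \<phi> (k (?p z) + (\<psi> z - ?p z))" for z
    have lT: "linear T"
      unfolding T_def
      by (intro linear_compose[OF _ \<psi>(2), unfolded o_def] linear_compose_add linear_compose_sub
          linear_compose[OF lp k(1), unfolded o_def] \<psi>(1) lp)
    have kS: "k x \<in> S" if "x \<in> S" for x using k(2) that by blast
    have pp: "P (?p z) = ?p z" for z using P by blast
    have pT: "?p (T z) = k (?p z)" for z
      by (simp add: T_def \<psi>(5) linear_add[OF P(1)] linear_diff[OF P(1)] pp P(3) kS P(2))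
    have dT: "\<psi> (T z) - ?p (T z) = \<psi> z - ?p z" for z
      unfolding pT by (simp add: T_def \<psi>(5))
    have TB: "T z \<in> B \<longleftrightarrow> z \<in> B" for z
      using k(3) P(2) by (simp add: B_def dT) (simp add: pT)
    have "T ` B = B"
    proof (intro equalityI subsetI)
      fix y assume y: "y \<in> B"
      obtain x where x: "x \<in> S" "k x = ?p y" using k(2) P(2) by (metis imageE)
      define z where "z = \<phi> (x + (\<psi> y - ?p y))"
      have "?p z = x"
        using x by (simp add: z_def \<psi>(5) linear_add[OF P(1)] linear_diff[OF P(1)] pp P(3))
      then have "T z = y" by (simp add: T_def x(2)) (simp add: z_def \<psi> )
      with y TB show "y \<in> T ` B" by blast
    qed (use TB in auto)
    then have "integral B (\<lambda>x. f a b (T x)) = integral B (f a b)"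
      using lT B nB cf by (intro integral_measure_preserving_linear) auto
    moreover have "f a b (T x) = f (g a) (g b) x" for x
      using g ab P(2) by (simp add: f_def pT)
    ultimately show ?thesis by (simp add: C_def cong: integral_cong)
  qed
  ultimately show ?thesis by (intro exI[of _ C]) blast
qed

subsection \<open>Permutations of the diagonal\<close>

definition root_vec :: "'n \<Rightarrow> 'n \<Rightarrow> real^'n" where
  "root_vec i j = axis i 1 - axis j 1"

definition swp :: "'n \<Rightarrow> 'n \<Rightarrow> 'n \<Rightarrow> 'n" where
  "swp i j k = (if k = i then j else if k = j then i else k)"

lemma bij_swp: "bij (swp i j)"
  by (rule involuntory_imp_bij) (auto simp: swp_def)

lemma root_vec_nth: "root_vec i j $ k = (if k = i then 1 else 0) - (if k = j then 1 else 0)"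
  by (simp add: root_vec_def axis_def)

lemma root_vec_self [simp]: "root_vec i i = 0"
  by (simp add: root_vec_def)

lemma root_vec_sum0 [simp]: "root_vec i j \<in> sum0"
  by (simp add: sum0_def root_vec_nth sum_subtractf)

lemma inner_root_vec: "inner (root_vec i j) x = x$i - x$j"
  by (simp add: root_vec_def inner_diff_left inner_axis')

text \<open>The contributions at the base index \<open>i\<close> add up to minus the sum of all
  entries of \<open>x\<close>, which is zero.\<close>

lemma sum0_root_vec_expansion:
  assumes "x \<in> sum0"
  shows "x = (\<Sum>j\<in>UNIV. (- x$j) *\<^sub>R root_vec i j)"
proof -
  have "(\<Sum>j\<in>UNIV. (- x$j) *\<^sub>R root_vec i j) $ k = x $ k" for k
  proof -
    have "(\<Sum>j\<in>UNIV. (- x$j) *\<^sub>R root_vec i j) $ k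
        = (\<Sum>j\<in>UNIV. (- x$j) * (if k = i then 1 else 0) + (if k = j then x$j else 0))"
      unfolding sum_component by (rule sum.cong) (auto simp: root_vec_nth)
    also have "\<dots> = (- (\<Sum>j\<in>UNIV. x$j)) * (if k = i then 1 else 0) + x$k"
      by (simp add: sum.distrib sum_negf sum_subtractf)
    finally show ?thesis using assms by (simp add: sum0_def)
  qed
  then show ?thesis by (simp add: vec_eq_iff)
qed

lemma permutation_unitary:
  fixes p :: "'n::finite \<Rightarrow> 'n"
  assumes "bij p"
  shows "\<exists>U. unitary_matrix U \<and> (\<forall>x. Ad U (dg x) = dg (\<chi> i. x$(p i)))"
proof -
  define U :: "complex^'n^'n" where "U = (\<chi> i j. if j = p i then 1 else 0)"
  have inj: "p i = p j \<longleftrightarrow> i = j" for i j using assms by (simp add: bij_def inj_eq)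
  have "U ** conj_transpose U = mat 1"
    by (simp add: vec_eq_iff matrix_matrix_mult_def U_def mat_def inj if_distrib[of cnj]
        if_distrib[of "\<lambda>x. x * _"] cong: if_cong)
  moreover have "Ad U (dg x) = dg (\<chi> i. x$(p i))" for x
  proof -
    have "(U ** dg x) $ i $ k = (if k = p i then of_real (x$k) else 0)" for i k
      by (simp add: dg_mult_nth U_def)
    then have "Ad U (dg x) $ i $ j = (\<Sum>k\<in>UNIV. (if k = p i then of_real (x$k) else 0) * cnj (U$j$k))" for i j
      by (simp add: Ad_def matrix_matrix_mult_def[of "U ** dg x"])
    also have "\<dots> i j = (\<Sum>k\<in>UNIV. if k = p i then of_real (x$k) * cnj (U$j$k) else 0)" for i j
      by (rule sum.cong) auto
    also have "\<dots> i j = dg (\<chi> i. x$(p i)) $ i $ j" for i j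
      by (simp add: U_def dg_nth inj)
    finally show ?thesis by (simp add: vec_eq_iff)
  qed
  ultimately show ?thesis using unitary_matrixI by blast
qed

text \<open>On the roots based at one index \<open>i0\<close>, transpositions make all values
  \<open>D r r\<close> equal; the value at two different such roots follows by polarization, since
  their difference is again a root.\<close>

lemma permutation_invariant_form:
  fixes D :: "real^'n \<Rightarrow> real^'n \<Rightarrow> real"
  assumes sym: "\<And>x y. D x y = D y x" and lin: "\<And>y. linear (\<lambda>x. D x y)"
    and inv: "\<And>p x y. bij p \<Longrightarrow> x \<in> sum0 \<Longrightarrow> y \<in> sum0 \<Longrightarrow> D (\<chi> i. x$(p i)) (\<chi> i. y$(p i)) = D x y"
  shows "\<exists>c. \<forall>x\<in>sum0. D x x = c * inner x x"
proof -
  fix i0 :: 'n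
  have swp_root: "(\<chi> m. root_vec i j $ swp a b m) = root_vec (swp a b i) (swp a b j)" for i j a b :: 'n
    by (auto simp: vec_eq_iff root_vec_nth swp_def)
  have D_swp: "D (root_vec (swp a b i) (swp a b j)) (root_vec (swp a b k) (swp a b l)) = D (root_vec i j) (root_vec k l)" for a b i j k l
    using inv[OF bij_swp, of "root_vec i j" "root_vec k l" a b] by (simp add: swp_root)
  have D_add: "D (x + x') y = D x y + D x' y" for x x' y using linear_add[OF lin] by metis
  have D_scale: "D (t *\<^sub>R x) y = t * D x y" for x y t using linear_scale[OF lin] by (metis real_scaleR_def)
  have D_diff: "D (x - x') y = D x y - D x' y" for x x' y using linear_diff[OF lin] by metis
  have D_diff2: "D y (x - x') = D y x - D y x'" for x x' y using D_diff sym by metis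
  have D_0: "D 0 y = 0" "D y 0 = 0" for y using linear_0[OF lin] sym by metis+
  have diag: "D (root_vec i0 j) (root_vec i0 j) = D (root_vec i0 l) (root_vec i0 l)" if "j \<noteq> i0" "l \<noteq> i0" for j l
    using D_swp[of j l i0 j i0 j] that by (simp add: swp_def split: if_splits)
  obtain c where c: "\<And>j. j \<noteq> i0 \<Longrightarrow> D (root_vec i0 j) (root_vec i0 j) = 2 * c"
  proof (cases "\<exists>j. j \<noteq> i0")
    case True
    then obtain j where "j \<noteq> i0" by blast
    show ?thesis
    proof (rule that)
      fix l assume "l \<noteq> i0"
      then show "D (root_vec i0 l) (root_vec i0 l) = 2 * (D (root_vec i0 j) (root_vec i0 j) / 2)"
        using diag[of l j] \<open>j \<noteq> i0\<close> by simp
    qed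
  next
    case False
    then show ?thesis using that[of 0] by blast
  qed
  have "D (root_vec i0 j) (root_vec i0 l) = c * inner (root_vec i0 j) (root_vec i0 l)" for j l
  proof (cases "j = i0 \<or> l = i0 \<or> j = l")
    case True
    then show ?thesis using c[of j] D_0 by (auto simp: inner_root_vec root_vec_nth)
  next
    case False
    have "D (root_vec j l) (root_vec j l) = D (root_vec i0 l) (root_vec i0 l)"
      using D_swp[of i0 j j l j l] False by (simp add: swp_def split: if_splits)
    moreover have "root_vec j l = root_vec i0 l - root_vec i0 j" by (simp add: root_vec_def)
    then have "D (root_vec j l) (root_vec j l) = D (root_vec i0 l) (root_vec i0 l) + D (root_vec i0 j) (root_vec i0 j) - 2 * D (root_vec i0 j) (root_vec i0 l)"
      using sym[of "root_vec i0 l" "root_vec i0 j"] by (simp add: D_diff D_diff2)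
    ultimately have "D (root_vec i0 j) (root_vec i0 l) = c" using False c by simp
    then show ?thesis using False by (auto simp: inner_root_vec root_vec_nth)
  qed note DR = this
  have 1: "D x (root_vec i0 l) = c * inner x (root_vec i0 l)" if "x \<in> sum0" for x l
  proof -
    have "D x (root_vec i0 l) = (\<Sum>j\<in>UNIV. (- x$j) * D (root_vec i0 j) (root_vec i0 l))"
      by (subst sum0_root_vec_expansion[OF that, of i0]) (simp only: linear_sum[OF lin] D_scale)
    also have "\<dots> = c * (\<Sum>j\<in>UNIV. inner ((- x$j) *\<^sub>R root_vec i0 j) (root_vec i0 l))"
      by (simp add: DR sum_distrib_left mult_ac)
    also have "\<dots> = c * inner x (root_vec i0 l)"
      by (subst (2) sum0_root_vec_expansion[OF that, of i0]) (simp only: inner_sum_left)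
    finally show ?thesis .
  qed
  have "D x x = c * inner x x" if "x \<in> sum0" for x
  proof -
    have "D x x = (\<Sum>j\<in>UNIV. (- x$j) * D (root_vec i0 j) x)"
      by (subst (1) sum0_root_vec_expansion[OF that, of i0]) (simp only: linear_sum[OF lin] D_scale)
    also have "\<dots> = c * (\<Sum>j\<in>UNIV. inner x ((- x$j) *\<^sub>R root_vec i0 j))"
      using 1[OF that] by (simp add: sym[of _ x] sum_distrib_left mult_ac)
    also have "\<dots> = c * inner x x"
      by (subst (3) sum0_root_vec_expansion[OF that, of i0]) (simp only: inner_sum_right)
    finally show ?thesis .
  qed
  then show ?thesis by blast
qed

subsection \<open>Isometries preserve the Frobenius norm\<close>

text \<open>Values outside \<open>herm0\<close> are ignored here, unlike in
  \<open>isometry_group\<close>, so compositions and inverses can be formed without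
  \<open>restrict\<close>.\<close>

definition isometry :: "(complex^'n^'n \<Rightarrow> real) \<Rightarrow> (complex^'n^'n \<Rightarrow> complex^'n^'n) \<Rightarrow> bool" where
  "isometry N f \<longleftrightarrow> real_linear_on herm0 f \<and> bij_betw f herm0 herm0 \<and> (\<forall>A\<in>herm0. N (f A) = N A)"

lemma isometry_group_iff: "f \<in> isometry_group N \<longleftrightarrow> f \<in> extensional herm0 \<and> isometry N f"
  by (auto simp: isometry_group_def isometry_def GL_herm0_def Bij_def)

lemma isometryD:
  assumes "isometry N f"
  shows "A \<in> herm0 \<Longrightarrow> f A \<in> herm0" "A \<in> herm0 \<Longrightarrow> B \<in> herm0 \<Longrightarrow> f (A + B) = f A + f B"
    "A \<in> herm0 \<Longrightarrow> f (c *\<^sub>R A) = c *\<^sub>R f A" "A \<in> herm0 \<Longrightarrow> N (f A) = N A" "f ` herm0 = herm0"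
    "A \<in> herm0 \<Longrightarrow> B \<in> herm0 \<Longrightarrow> f A = f B \<longleftrightarrow> A = B"
  using assms by (auto simp: isometry_def real_linear_on_def bij_betw_def inj_on_eq_iff)

lemma isometry_compose: "isometry N f \<Longrightarrow> isometry N g \<Longrightarrow> isometry N (\<lambda>A. f (g A))"
  unfolding isometry_def
  by (auto simp: real_linear_on_def herm0_closed bij_betwE intro: bij_betw_trans[of g _ _ f, unfolded o_def])

lemma isometry_inverse:
  assumes f: "isometry N f"
  shows "\<exists>g. isometry N g \<and> (\<forall>A\<in>herm0. g (f A) = A \<and> f (g A) = A)"
proof -
  have b: "bij_betw f herm0 herm0" using f by (simp add: isometry_def)
  define g where "g = inv_into herm0 f"
  have bg: "bij_betw g herm0 herm0" unfolding g_def using b by (rule bij_betw_inv_into)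
  have gf: "g (f A) = A" "f (g A) = A" "g A \<in> herm0" if "A \<in> herm0" for A
    using b that bij_betwE[OF bg] by (auto simp: g_def bij_betw_inv_into_left bij_betw_inv_into_right)
  have "g (A + B) = g A + g B" if "A \<in> herm0" "B \<in> herm0" for A B
    using gf(1)[of "g A + g B"] that gf isometryD(2)[OF f] herm0_closed(1) by metis
  moreover have "g (c *\<^sub>R A) = c *\<^sub>R g A" if "A \<in> herm0" for A c
    using gf(1)[of "c *\<^sub>R g A"] that gf isometryD(3)[OF f] herm0_closed(2) by metis
  moreover have "N (g A) = N A" if "A \<in> herm0" for A
    using isometryD(4)[OF f gf(3)[OF that]] gf(2)[OF that] by simp
  ultimately show ?thesis using bg gf by (intro exI[of _ g]) (auto simp: isometry_def real_linear_on_def)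
qed

lemma isometry_Ad:
  assumes "unitary_similarity_invariant N" and U: "unitary_matrix U"
  shows "isometry N (Ad U)"
proof -
  have "bij_betw (Ad U) herm0 herm0"
    by (rule bij_betw_byWitness[where f' = "Ad (conj_transpose U)"])
      (use Ad_inverse[OF U] Ad_herm0[OF U] Ad_herm0[OF unitary_conj_transpose[OF U]] in auto)
  then show ?thesis
    using assms linear_add[OF linear_Ad] linear_scale[OF linear_Ad]
    by (auto simp: isometry_def real_linear_on_def unitary_similarity_invariant_def unitary_Ad)
qed

lemma isometry_linear_extension:
  fixes f :: "complex^'n^'n \<Rightarrow> complex^'n^'n"
  assumes "isometry N f"
  shows "\<exists>F. linear F \<and> (\<forall>A\<in>herm0. F A = f A) \<and> (\<forall>A. F A \<in> herm0)"
proof -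
  obtain P :: "complex^'n^'n \<Rightarrow> complex^'n^'n"
    where P: "linear P" "\<And>x. P x \<in> herm0" "\<And>x. x \<in> herm0 \<Longrightarrow> P x = x"
    using orthogonal_projection_exists[OF subspace_herm0] by metis
  have "linear (\<lambda>A. f (P A))"
    by (rule linearI) (simp_all add: linear_add[OF P(1)] linear_scale[OF P(1)] P isometryD[OF assms])
  then show ?thesis using P isometryD(1)[OF assms] by (intro exI[of _ "\<lambda>A. f (P A)"]) auto
qed

text \<open>Diagonalization reduces the claim to diagonal matrices, where permutation matrices are
  among the unitaries. This takes the place of irreducibility of the adjoint representation.\<close>

lemma unitary_invariant_form:
  fixes C :: "complex^'n^'n \<Rightarrow> complex^'n^'n \<Rightarrow> real"
  assumes sym: "\<And>a b. C a b = C b a" and lin: "\<And>b. linear (\<lambda>a. C a b)"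
    and inv: "\<And>U a b. unitary_matrix U \<Longrightarrow> a \<in> herm0 \<Longrightarrow> b \<in> herm0 \<Longrightarrow> C (Ad U a) (Ad U b) = C a b"
  shows "\<exists>c. \<forall>a\<in>herm0. C a a = c * inner a a"
proof -
  have "\<exists>c. \<forall>x\<in>sum0. C (dg x) (dg x) = c * inner x x"
  proof (rule permutation_invariant_form[where D = "\<lambda>x y. C (dg x) (dg y)"])
    show "C (dg x) (dg y) = C (dg y) (dg x)" for x y by (rule sym)
    show "linear (\<lambda>x. C (dg x) (dg y))" for y
      using linear_compose[OF linear_dg lin] by (simp add: o_def)
    show "C (dg (\<chi> i. x $ p i)) (dg (\<chi> i. y $ p i)) = C (dg x) (dg y)"
      if "bij p" "x \<in> sum0" "y \<in> sum0" for p x y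
      using permutation_unitary[OF that(1)] inv that(2,3) dg_herm0_iff by metis
  qed
  then obtain c where c: "\<And>x. x \<in> sum0 \<Longrightarrow> C (dg x) (dg x) = c * inner x x" by blast
  have "C a a = c * inner a a" if a: "a \<in> herm0" for a
  proof -
    obtain U x where U: "unitary_matrix U" "x \<in> sum0" "a = Ad U (dg x)" using diagonalize[OF a] .
    then show ?thesis using inv[OF U(1), of "dg x" "dg x"] c[OF U(2)]
      by (simp add: dg_herm0_iff inner_Ad inner_dg)
  qed
  then show ?thesis by blast
qed

text \<open>The adjoint \<open>g\<close> of \<open>f\<close> preserves the invariant form, a
  multiple of the inner product, hence it preserves the length of \<open>f A\<close>. Cauchy-Schwarz
  for \<open>inner (g (f A)) A\<close> then gives this inequality; the opposite one comes from the
  inverse isometry.\<close>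

lemma isometry_norm_le:
  fixes N :: "complex^'n^'n \<Rightarrow> real"
  assumes N: "norm_on herm0 N" "unitary_similarity_invariant N" and f: "isometry N f" and A: "A \<in> herm0"
  shows "norm (f A) \<le> norm A"
proof -
  \<comment> \<open>\<open>bit0\<close> doubles the cardinality: \<open>2 * n * n\<close> is the
    real dimension of the space of complex matrices.\<close>
  have "CARD(('n \<times> 'n) bit0) = DIM(complex^'n^'n)" by simp
  from invariant_form_exists[OF this subspace_herm0 N(1)]
  obtain C :: "complex^'n^'n \<Rightarrow> complex^'n^'n \<Rightarrow> real"
    where C: "\<forall>a b. C a b = C b a" "\<forall>a b c. C (a + b) c = C a c + C b c"
    "\<forall>t a b. C (t *\<^sub>R a) b = t * C a b" "\<forall>a\<in>herm0. a \<noteq> 0 \<longrightarrow> C a a > 0"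
    "\<forall>k g. linear k \<longrightarrow> k ` herm0 = herm0 \<longrightarrow> (\<forall>x\<in>herm0. N (k x) = N x) \<longrightarrow>
        (\<forall>a\<in>herm0. \<forall>x\<in>herm0. inner (g a) x = inner a (k x)) \<longrightarrow>
        (\<forall>a\<in>herm0. \<forall>b\<in>herm0. C (g a) (g b) = C a b)"
    by (elim exE conjE) (rule that)
  note sym = C(1)[rule_format] and add = C(2)[rule_format] and scale = C(3)[rule_format]
    and pos = C(4)[rule_format] and inv = C(5)[rule_format]
  have lin: "linear (\<lambda>a. C a b)" for b by (rule linearI) (simp_all add: add scale)
  have "C (Ad U a) (Ad U b) = C a b" if U: "unitary_matrix U" and ab: "a \<in> herm0" "b \<in> herm0" for U a b
  proof (rule inv[OF linear_Ad[of "conj_transpose U"] _ _ _ ab])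
    have U': "isometry N (Ad (conj_transpose U))"
      using isometry_Ad[OF N(2)] unitary_conj_transpose[OF U] by blast
    show "Ad (conj_transpose U) ` herm0 = herm0"
      "\<And>x. x \<in> herm0 \<Longrightarrow> N (Ad (conj_transpose U) x) = N x"
      using isometryD[OF U'] by auto
    show "Ad U a \<bullet> x = a \<bullet> Ad (conj_transpose U) x" for a x
      using inner_Ad[OF U] Ad_inverse[OF U] by metis
  qed
  then obtain c where c: "\<And>a. a \<in> herm0 \<Longrightarrow> C a a = c * inner a a"
    using unitary_invariant_form[of C, OF sym lin] by blast
  obtain F where F: "linear F" "\<And>A. A \<in> herm0 \<Longrightarrow> F A = f A" "\<And>A. F A \<in> herm0"
    using isometry_linear_extension[OF f] by metis
  obtain P :: "complex^'n^'n \<Rightarrow> complex^'n^'n" where P: "linear P" "\<And>x. P x \<in> herm0" "\<And>x. x \<in> herm0 \<Longrightarrow> P x = x"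
    "\<And>x y. y \<in> herm0 \<Longrightarrow> inner (P x) y = inner x y"
    using orthogonal_projection_exists[OF subspace_herm0] by metis
  define g where "g a = P (adjoint F a)" for a
  have g: "inner (g a) x = inner a (F x)" if "x \<in> herm0" for a x
    using that P(4) adjoint_works[OF F(1)] by (simp add: g_def inner_commute)
  show ?thesis
  proof (cases "f A = 0")
    case False
    have fA: "f A \<in> herm0" using isometryD(1)[OF f A] .
    have "C (g (f A)) (g (f A)) = C (f A) (f A)"
    proof (rule inv[OF F(1) _ _ _ fA fA])
      show "F ` herm0 = herm0" using isometryD(5)[OF f] F(2) by (metis image_cong)
    qed (use isometryD(4)[OF f] F(2) g in auto)
    moreover have "c * inner (f A) (f A) > 0" using pos[OF fA False] c[OF fA] by simp
    ultimately have "norm (g (f A)) = norm (f A)"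
      using c[OF fA] c[of "g (f A)"] P(2) by (auto simp: g_def norm_eq_sqrt_inner)
    moreover have "(norm (f A))\<^sup>2 = inner (g (f A)) A"
      using g[OF A] F(2)[OF A] by (simp add: power2_norm_eq_inner)
    ultimately have "norm (f A) * norm (f A) \<le> norm (f A) * norm A"
      using Cauchy_Schwarz_ineq2[of "g (f A)" A] by (simp add: power2_eq_square)
    then show ?thesis using False by simp
  qed simp
qed

lemma isometry_norm:
  fixes N :: "complex^'n^'n \<Rightarrow> real"
  assumes N: "norm_on herm0 N" "unitary_similarity_invariant N" and f: "isometry N f" and A: "A \<in> herm0"
  shows "norm (f A) = norm A"
proof -
  obtain g where g: "isometry N g" "\<And>A. A \<in> herm0 \<Longrightarrow> g (f A) = A" using isometry_inverse[OF f] by metis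
  show ?thesis
    using isometry_norm_le[OF N f A] isometry_norm_le[OF N g(1) isometryD(1)[OF f A]] g(2)[OF A] by simp
qed

subsection \<open>Infinitesimal isometries of a symmetric norm\<close>

definition perm_vec :: "('n \<Rightarrow> 'n) \<Rightarrow> real^'n \<Rightarrow> real^'n" where
  "perm_vec p x = (\<chi> i. x$(p i))"

text \<open>A stand-in for the Lie algebra of the isometry group of \<open>M\<close>. The bound is
  one-sided because pinching gives only upper bounds; the factor \<open>norm x\<close> makes it
  homogeneous in \<open>x\<close>. Skew symmetry and zero row sums together make \<open>Y\<close>
  map into \<open>sum0\<close>.\<close>

definition infinitesimal_isometries :: "(real^'n \<Rightarrow> real) \<Rightarrow> (real^'n^'n) set" where
  "infinitesimal_isometries M =
     {Y. (\<forall>i j. Y$i$j + Y$j$i = 0) \<and> (\<forall>i. (\<Sum>j\<in>UNIV. Y$i$j) = 0) \<and>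
         (\<exists>C. \<forall>x\<in>sum0. \<forall>t. M (x + t *\<^sub>R (Y *v x)) \<le> M x + C * t\<^sup>2 * norm x)}"

text \<open>For orthonormal \<open>u\<close>, \<open>v\<close>, the matrix \<open>wedge v u\<close>
  is the infinitesimal rotation sending \<open>u\<close> to \<open>v\<close> and \<open>v\<close> to
  \<open>- u\<close>.\<close>

definition wedge :: "real^'n \<Rightarrow> real^'n \<Rightarrow> real^'n^'n" where
  "wedge u v = (\<chi> a b. u$a * v$b - v$a * u$b)"

lemma wedge_mult: "wedge u v *v x = inner v x *\<^sub>R u - inner u x *\<^sub>R v"
  by (simp add: vec_eq_iff wedge_def matrix_vector_mult_def inner_vec_def left_diff_distrib
      right_diff_distrib sum_subtractf sum_distrib_left sum_distrib_right mult_ac)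

lemma linear_wedge: "linear (\<lambda>u. wedge u v)" "linear (wedge u)"
  by (rule linearI; simp add: wedge_def vec_eq_iff algebra_simps)+

lemma perm_vec_nth [simp]: "perm_vec p x $ i = x $ p i"
  by (simp add: perm_vec_def)

lemma norm_perm_vec:
  fixes p :: "'n::finite \<Rightarrow> 'n"
  assumes "bij p"
  shows "norm (perm_vec p x) = norm x"
proof -
  have "(\<Sum>i\<in>UNIV. (x $ p i)\<^sup>2) = (\<Sum>i\<in>UNIV. (x $ i)\<^sup>2)"
    using sum.reindex_bij_betw[of p UNIV UNIV "\<lambda>i. (x$i)\<^sup>2"] assms by simp
  then show ?thesis by (simp add: norm_vec_def L2_set_def)
qed

lemma perm_vec_sum0:
  fixes p :: "'n::finite \<Rightarrow> 'n"
  assumes "bij p"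
  shows "perm_vec p x \<in> sum0 \<longleftrightarrow> x \<in> sum0"
  using sum.reindex_bij_betw[of p UNIV UNIV "\<lambda>i. x$i"] assms by (simp add: sum0_def)

text \<open>Stepping back from \<open>s + h\<close> by \<open>- h\<close> turns the one-sided bound
  into a two-sided one, so the derivative is zero everywhere.\<close>

lemma quadratic_increments_constant:
  fixes g :: "real \<Rightarrow> real"
  assumes "\<And>s h. g (s + h) \<le> g s + K * h\<^sup>2"
  shows "g a = g b"
proof -
  have bound: "\<bar>g (s + h) - g s\<bar> \<le> K * h\<^sup>2" for s h
    using assms[of s h] assms[of "s + h" "- h"] by simp
  have "DERIV g x :> 0" for x
    unfolding DERIV_def
  proof (rule Lim_null_comparison)
    show "\<forall>\<^sub>F h in at 0. norm ((g (x + h) - g x) / h) \<le> K * \<bar>h\<bar>"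
    proof (intro always_eventually allI)
      fix h :: real
      show "norm ((g (x + h) - g x) / h) \<le> K * \<bar>h\<bar>"
      proof (cases "h = 0")
        case False
        then show ?thesis using bound[of x h]
          by (simp add: divide_le_eq power2_eq_square mult.assoc abs_mult_self_eq)
      qed simp
    qed
    show "((\<lambda>h. K * \<bar>h\<bar>) \<longlongrightarrow> 0) (at 0)"
      by (intro tendsto_mult_right_zero tendsto_rabs_zero tendsto_ident_at)
  qed
  then show ?thesis by (rule DERIV_isconst_all[rule_format])
qed

context
  fixes M :: "real^'n \<Rightarrow> real"
  assumes M: "norm_on sum0 M"
    and perm: "\<And>p x. bij p \<Longrightarrow> x \<in> sum0 \<Longrightarrow> M (perm_vec p x) = M x"
begin

private lemma M_add: "x \<in> sum0 \<Longrightarrow> y \<in> sum0 \<Longrightarrow> M (x + y) \<le> M x + M y"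
  and M_scale: "x \<in> sum0 \<Longrightarrow> M (c *\<^sub>R x) = \<bar>c\<bar> * M x"
  and M_nonneg: "x \<in> sum0 \<Longrightarrow> 0 \<le> M x"
  using M by (auto simp: norm_on_def)

private lemma sum0_rules: "x \<in> sum0 \<Longrightarrow> y \<in> sum0 \<Longrightarrow> x + y \<in> sum0"
  "x \<in> sum0 \<Longrightarrow> c *\<^sub>R x \<in> sum0"  "x \<in> sum0 \<Longrightarrow> y \<in> sum0 \<Longrightarrow> x - y \<in> sum0"
  by (auto intro: subspace_add subspace_scale subspace_diff subspace_sum0)

private lemma skew_mult_sum0:
  assumes "\<forall>i j. Y$i$j + Y$j$i = 0" "\<forall>i. (\<Sum>j\<in>UNIV. Y$i$j) = 0"
  shows "Y *v x \<in> sum0"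
proof -
  have "(\<Sum>i\<in>UNIV. Y$i$j) = 0" for j
    using sum.distrib[of "\<lambda>i. Y$i$j" "\<lambda>i. Y$j$i" UNIV] assms by simp
  then have "(\<Sum>j\<in>UNIV. (\<Sum>i\<in>UNIV. Y$i$j) * x$j) = 0" by simp
  then have "(\<Sum>i\<in>UNIV. \<Sum>j\<in>UNIV. Y$i$j * x$j) = 0"
    by (subst sum.swap) (simp add: sum_distrib_right)
  then show ?thesis by (simp add: sum0_def matrix_vector_mult_def)
qed

text \<open>For \<open>t\<close> of modulus above 1 the triangle inequality gives an error linear in
  \<open>t\<close>, which is then dominated by \<open>t\<^sup>2\<close>. Hence only small
  \<open>t\<close> need be examined.\<close>

private lemma bound_all_t:
  assumes Y: "\<And>x. Y *v x \<in> sum0"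
    and C: "\<forall>x\<in>sum0. \<forall>t. \<bar>t\<bar> \<le> 1 \<longrightarrow> M (x + t *\<^sub>R (Y *v x)) \<le> M x + C * t\<^sup>2 * norm x"
  shows "\<exists>C. \<forall>x\<in>sum0. \<forall>t. M (x + t *\<^sub>R (Y *v x)) \<le> M x + C * t\<^sup>2 * norm x"
proof -
  obtain L where L: "L > 0" "\<forall>x\<in>sum0. M x \<le> L * norm x"
    using norm_on_upper[OF subspace_sum0 M] by blast
  obtain b where b: "b > 0" "\<forall>x. norm (Y *v x) \<le> b * norm x"
    using linear_bound[OF matrix_vector_mul_linear[of Y]] by blast
  have "M (x + t *\<^sub>R (Y *v x)) \<le> M x + max C (L * b) * t\<^sup>2 * norm x" if x: "x \<in> sum0" for x t
  proof (cases "\<bar>t\<bar> \<le> 1")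
    case True
    then have "M (x + t *\<^sub>R (Y *v x)) \<le> M x + C * (t\<^sup>2 * norm x)" using C x by (simp add: mult.assoc)
    moreover have "C * (t\<^sup>2 * norm x) \<le> max C (L * b) * (t\<^sup>2 * norm x)"
      by (intro mult_right_mono) auto
    ultimately show ?thesis by (simp add: mult.assoc)
  next
    case False
    then have "1 * \<bar>t\<bar> \<le> \<bar>t\<bar> * \<bar>t\<bar>" by (intro mult_right_mono) auto
    then have t: "\<bar>t\<bar> \<le> t\<^sup>2" by (simp add: power2_eq_square)
    have "M (x + t *\<^sub>R (Y *v x)) \<le> M x + \<bar>t\<bar> * M (Y *v x)"
      using M_add[OF x sum0_rules(2)[OF Y]] M_scale[OF Y] by simp
    also have "\<bar>t\<bar> * M (Y *v x) \<le> t\<^sup>2 * (L * (b * norm x))"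
      using t b L Y by (intro mult_mono order.trans[OF L(2)[rule_format]] mult_left_mono) (auto intro: M_nonneg)
    also have "\<dots> \<le> max C (L * b) * (t\<^sup>2 * norm x)"
      using mult_right_mono[of "L * b" "max C (L * b)" "t\<^sup>2 * norm x"] by (simp add: mult_ac)
    finally show ?thesis by (simp add: mult_ac)
  qed
  then show ?thesis by blast
qed

lemma subspace_infinitesimal_isometries: "subspace (infinitesimal_isometries M)"
  unfolding subspace_def
proof (intro conjI ballI allI)
  show "0 \<in> infinitesimal_isometries M"
    by (auto simp: infinitesimal_isometries_def intro!: exI[of _ 0])
next
  fix Y c assume Y: "Y \<in> infinitesimal_isometries M"
  then obtain C where C: "\<forall>x\<in>sum0. \<forall>t. M (x + t *\<^sub>R (Y *v x)) \<le> M x + C * t\<^sup>2 * norm x"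
    by (auto simp: infinitesimal_isometries_def)
  have "\<forall>x\<in>sum0. \<forall>t. M (x + t *\<^sub>R ((c *\<^sub>R Y) *v x)) \<le> M x + (C * c\<^sup>2) * t\<^sup>2 * norm x"
  proof (intro ballI allI)
    fix x :: "real^'n" and t :: real assume "x \<in> sum0"
    then show "M (x + t *\<^sub>R ((c *\<^sub>R Y) *v x)) \<le> M x + (C * c\<^sup>2) * t\<^sup>2 * norm x"
      using C[rule_format, of x "t * c"] by (simp add: scaleR_matrix_vector_assoc[symmetric] power_mult_distrib mult_ac)
  qed
  moreover have "c * Y$i$j + c * Y$j$i = 0" for i j
    using Y by (simp add: infinitesimal_isometries_def flip: distrib_left)
  ultimately show "c *\<^sub>R Y \<in> infinitesimal_isometries M"
    using Y by (auto simp: infinitesimal_isometries_def simp flip: sum_distrib_left)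
next
  fix Y Z assume Y: "Y \<in> infinitesimal_isometries M" and Z: "Z \<in> infinitesimal_isometries M"
  obtain C where C: "\<forall>x\<in>sum0. \<forall>t. M (x + t *\<^sub>R (Y *v x)) \<le> M x + C * t\<^sup>2 * norm x"
    using Y by (auto simp: infinitesimal_isometries_def)
  obtain D where D: "\<forall>x\<in>sum0. \<forall>t. M (x + t *\<^sub>R (Z *v x)) \<le> M x + D * t\<^sup>2 * norm x"
    using Z by (auto simp: infinitesimal_isometries_def)
  have Y0: "Y *v x \<in> sum0" and Z0: "Z *v x \<in> sum0" for x
    using Y Z by (auto simp: infinitesimal_isometries_def intro!: skew_mult_sum0)
  obtain L where L: "L > 0" "\<forall>x\<in>sum0. M x \<le> L * norm x"
    using norm_on_upper[OF subspace_sum0 M] by blast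
  obtain a where a: "a > 0" "\<forall>x. norm (Z *v x) \<le> a * norm x"
    using linear_bound[OF matrix_vector_mul_linear[of Z]] by blast
  obtain b where b: "b > 0" "\<forall>x. norm (Y *v x) \<le> b * norm x"
    using linear_bound[OF matrix_vector_mul_linear[of Y]] by blast
  define C' where "C' = \<bar>C\<bar>"
  have "M (x + t *\<^sub>R ((Y + Z) *v x)) \<le> M x + (L * b * a + C' * (1 + a) + D) * t\<^sup>2 * norm x"
    if x: "x \<in> sum0" and t: "\<bar>t\<bar> \<le> 1" for x t
  proof -
    define w where "w = x + t *\<^sub>R (Z *v x)"
    have w: "w \<in> sum0" using x Z0 by (simp add: w_def sum0_rules)
    have wYw: "w + t *\<^sub>R (Y *v w) \<in> sum0" using w Y0 by (simp add: sum0_rules)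
    have "\<bar>t\<bar> * norm (Z *v x) \<le> 1 * (a * norm x)"
      using t a by (intro mult_mono) auto
    then have nw: "norm w \<le> (1 + a) * norm x"
      using norm_triangle_ineq[of x "t *\<^sub>R (Z *v x)"] by (simp add: w_def algebra_simps)
    \<comment> \<open>A step along \<open>Z\<close> followed by one along \<open>Y\<close> differs
      from a step along \<open>Y + Z\<close> by \<open>t\<^sup>2\<close> times
      \<open>Y *v (Z *v x)\<close>, which is within the allowed error.\<close>
    have eq: "x + t *\<^sub>R ((Y + Z) *v x) = (w + t *\<^sub>R (Y *v w)) + (- t\<^sup>2) *\<^sub>R (Y *v (Z *v x))"
      by (simp add: w_def matrix_vector_mult_add_rdistrib matrix_vector_right_distrib scaleR_right_distrib
          matrix_vector_mult_scaleR power2_eq_square)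
    have "M (Y *v (Z *v x)) \<le> L * (b * (a * norm x))"
      using L(2)[rule_format, OF Y0, of "Z *v x"] b(2)[rule_format, of "Z *v x"] a(2)[rule_format, of x] L(1) b(1)
      by (meson mult_left_mono order.trans less_imp_le)
    then have 1: "t\<^sup>2 * M (Y *v (Z *v x)) \<le> t\<^sup>2 * (L * (b * (a * norm x)))"
      by (intro mult_left_mono) auto
    have "M (x + t *\<^sub>R ((Y + Z) *v x)) \<le> M (w + t *\<^sub>R (Y *v w)) + t\<^sup>2 * M (Y *v (Z *v x))"
      unfolding eq using M_add[OF wYw sum0_rules(2)[OF Y0], of "- t\<^sup>2" "Z *v x"]
        M_scale[OF Y0, of "- t\<^sup>2" "Z *v x"] by simp
    moreover have "M (w + t *\<^sub>R (Y *v w)) \<le> M w + C' * (t\<^sup>2 * norm w)"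
    proof -
      have "C * (t\<^sup>2 * norm w) \<le> C' * (t\<^sup>2 * norm w)" by (intro mult_right_mono) (auto simp: C'_def)
      then show ?thesis using C[rule_format, OF w, of t] by (simp add: mult.assoc)
    qed
    moreover have "C' * (t\<^sup>2 * norm w) \<le> C' * (t\<^sup>2 * ((1 + a) * norm x))"
      using nw by (intro mult_left_mono) (auto simp: C'_def)
    moreover have "M w \<le> M x + D * t\<^sup>2 * norm x" using D x by (simp add: w_def)
    ultimately show ?thesis using 1 by (simp add: algebra_simps)
  qed
  then have "\<exists>C. \<forall>x\<in>sum0. \<forall>t. M (x + t *\<^sub>R ((Y + Z) *v x)) \<le> M x + C * t\<^sup>2 * norm x"
    using Y0 Z0 by (intro bound_all_t[where C = "L * b * a + C' * (1 + a) + D"])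
      (auto simp: matrix_vector_mult_add_rdistrib sum0_rules)
  moreover have "(Y$i$j + Z$i$j) + (Y$j$i + Z$j$i) = 0" for i j
    using Y Z by (simp add: infinitesimal_isometries_def add.left_commute add.assoc)
  ultimately show "Y + Z \<in> infinitesimal_isometries M"
    using Y Z by (simp add: infinitesimal_isometries_def sum.distrib)
qed

lemma infinitesimal_isometries_perm:
  assumes Y: "Y \<in> infinitesimal_isometries M" and p: "bij p"
  shows "(\<chi> i j. Y $ p i $ p j) \<in> infinitesimal_isometries M"
proof -
  let ?Y = "\<chi> i j. Y $ p i $ p j"
  obtain C where C: "\<forall>x\<in>sum0. \<forall>t. M (x + t *\<^sub>R (Y *v x)) \<le> M x + C * t\<^sup>2 * norm x"
    using Y by (auto simp: infinitesimal_isometries_def)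
  have Y0: "Y *v x \<in> sum0" for x
    using Y by (auto simp: infinitesimal_isometries_def intro!: skew_mult_sum0)
  have re: "(\<Sum>j\<in>UNIV. g (p j)) = (\<Sum>j\<in>UNIV. g j)" for g :: "'n \<Rightarrow> real"
    using sum.reindex_bij_betw[of p UNIV UNIV g] p by simp
  have *: "?Y *v perm_vec p x = perm_vec p (Y *v x)" for x
    by (simp add: vec_eq_iff matrix_vector_mult_def re[of "\<lambda>j. Y $ p i $ j * x $ j" for i])
  have "M (x + t *\<^sub>R (?Y *v x)) \<le> M x + C * t\<^sup>2 * norm x" if x: "x \<in> sum0" for x t
  proof -
    define x' where "x' = perm_vec (inv_into UNIV p) x"
    have x': "x = perm_vec p x'" using p by (simp add: x'_def vec_eq_iff bij_is_inj)
    have x0: "x' \<in> sum0" using x p by (simp add: x' perm_vec_sum0)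
    have "x + t *\<^sub>R (?Y *v x) = perm_vec p (x' + t *\<^sub>R (Y *v x'))"
      by (simp add: x' *) (simp add: vec_eq_iff)
    then have "M (x + t *\<^sub>R (?Y *v x)) = M (x' + t *\<^sub>R (Y *v x'))"
      using perm[OF p] x0 Y0 by (simp add: sum0_rules)
    also have "\<dots> \<le> M x' + C * t\<^sup>2 * norm x'" using C x0 by blast
    also have "M x' + C * t\<^sup>2 * norm x' = M x + C * t\<^sup>2 * norm x"
      using perm[OF p x0] norm_perm_vec[OF p] by (simp add: x')
    finally show ?thesis by simp
  qed
  then show ?thesis
    using Y re[of "\<lambda>j. Y $ i $ j" for i] by (simp add: infinitesimal_isometries_def) blast
qed

text \<open>The exterior square of the sum-zero vectors is irreducible under permutations: antisymmetrizing
  \<open>Y\<close> over the permutations of three suitable indices yields a multiple of a single wedge.\<close>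

lemma infinitesimal_isometries_wedge:
  assumes Y: "Y \<in> infinitesimal_isometries M" "Y \<noteq> 0" and uv: "u \<in> sum0" "v \<in> sum0"
  shows "wedge u v \<in> infinitesimal_isometries M"
proof -
  let ?A = "infinitesimal_isometries M"
  note sub = subspace_infinitesimal_isometries
  have skew: "Y$b$a = - Y$a$b" for a b
    using Y(1) unfolding infinitesimal_isometries_def eq_neg_iff_add_eq_0 by blast
  have rows: "(\<Sum>b\<in>UNIV. Y$a$b) = 0" for a using Y(1) by (simp add: infinitesimal_isometries_def)
  have diag: "Y$a$a = 0" for a using skew[of a a] by linarith
  obtain i j where "Y$i$j \<noteq> 0" using Y(2) by (metis vec_eq_iff zero_index)
  moreover have "(\<Sum>k\<in>UNIV. Y$k$i) = (\<Sum>k\<in>UNIV. - Y$i$k)"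
    by (rule sum.cong[OF refl skew])
  \<comment> \<open>Zero row and column sums leave only the term \<open>Y$i$j\<close> in the sum
    over \<open>k\<close>, so some cyclic sum is nonzero.\<close>
  then have "(\<Sum>k\<in>UNIV. Y$i$j + Y$j$k + Y$k$i) = real CARD('n) * Y$i$j"
    by (simp add: sum.distrib sum_negf rows)
  ultimately have "(\<Sum>k\<in>UNIV. Y$i$j + Y$j$k + Y$k$i) \<noteq> 0" by simp
  then obtain k where s: "Y$i$j + Y$j$k + Y$k$i \<noteq> 0"
    by (rule sum.not_neutral_contains_not_neutral)
  define s where "s = Y$i$j + Y$j$k + Y$k$i"
  have neq: "i \<noteq> j" "j \<noteq> k" "i \<noteq> k"
  proof -
    show "i \<noteq> j"
    proof
      assume "i = j"
      then have "Y$i$j = 0" "Y$j$k = Y$i$k" by (simp_all only: diag)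
      with s skew[of i k] show False by linarith
    qed
    show "j \<noteq> k"
    proof
      assume "j = k"
      then have "Y$j$k = 0" "Y$k$i = Y$j$i" by (simp_all only: diag)
      with s skew[of i j] show False by linarith
    qed
    show "i \<noteq> k"
    proof
      assume "i = k"
      then have "Y$k$i = 0" "Y$j$k = Y$j$i" by (simp_all only: diag)
      with s skew[of i j] show False by linarith
    qed
  qed
  \<comment> \<open>\<open>c\<close> and \<open>d\<close> are the two 3-cycles on
    \<open>i, j, k\<close>. Adding the rotated copies and subtracting the copies under
    \<open>swp i j\<close> antisymmetrizes over all six permutations: entries with at most one index
    in the triple cancel, and off-diagonal entries inside it become \<open>2 * s\<close> up to
    sign.\<close>
  define c where "c a = (if a = i then j else if a = j then k else if a = k then i else a)" for a
  define d where "d a = (if a = i then k else if a = j then i else if a = k then j else a)" for a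
  have "c \<circ> d = id" "d \<circ> c = id" using neq by (auto simp: c_def d_def fun_eq_iff)
  then have bij: "bij c" "bij d" using o_bij by blast+
  define Z where "Z = Y + (\<chi> a b. Y $ c a $ c b) + (\<chi> a b. Y $ d a $ d b)"
  have "Z \<in> ?A" unfolding Z_def
    by (intro subspace_add[OF sub] infinitesimal_isometries_perm Y bij)
  then have "Z - (\<chi> a b. Z $ swp i j a $ swp i j b) \<in> ?A"
    by (intro subspace_diff[OF sub] infinitesimal_isometries_perm bij_swp)
  moreover have "Z - (\<chi> a b. Z $ swp i j a $ swp i j b) = (2 * s) *\<^sub>R wedge (root_vec i k) (root_vec j k)"
  proof -
    have "(Z - (\<chi> a b. Z $ swp i j a $ swp i j b)) $ a $ b
       = ((2 * s) *\<^sub>R wedge (root_vec i k) (root_vec j k)) $ a $ b" for a b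
    proof -
      have Z: "Z$a$b = Y$a$b + Y $ c a $ c b + Y $ d a $ d b" for a b by (simp add: Z_def)
      consider "a = i" | "a = j" | "a = k" | "a \<noteq> i" "a \<noteq> j" "a \<noteq> k" by blast
      note ca = this
      consider "b = i" | "b = j" | "b = k" | "b \<noteq> i" "b \<noteq> j" "b \<noteq> k" by blast
      then show ?thesis
        by (cases rule: ca; cases; use neq in \<open>simp add: Z c_def d_def swp_def s_def wedge_def root_vec_nth diag
            skew[of j i] skew[of k j] skew[of i k]\<close>)
    qed
    then show ?thesis by (simp add: vec_eq_iff)
  qed
  ultimately have "(1 / (2 * s)) *\<^sub>R ((2 * s) *\<^sub>R wedge (root_vec i k) (root_vec j k)) \<in> ?A"
    using subspace_scale[OF sub] by metis
  then have W: "wedge (root_vec i k) (root_vec j k) \<in> ?A" using s by (simp add: s_def)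
  have all: "wedge (root_vec a e) (root_vec b e) \<in> ?A" for a b e
  proof (cases "a = b \<or> a = e \<or> b = e")
    case True
    then have "wedge (root_vec a e) (root_vec b e) = 0" by (auto simp: wedge_def vec_eq_iff)
    then show ?thesis using subspace_0[OF sub] by simp
  next
    case False
    \<comment> \<open>Three successive transpositions carry \<open>a, b, e\<close> to
      \<open>i, j, k\<close>; the later ones do not move the indices already placed.\<close>
    define p1 where "p1 = swp a i"
    define p2 where "p2 = swp (p1 b) j"
    define p3 where "p3 = swp (p2 (p1 e)) k"
    define p where "p = p3 \<circ> (p2 \<circ> p1)"
    have p: "bij p" unfolding p_def p1_def p2_def p3_def by (intro bij_comp bij_swp)
    have "p a = i" "p b = j" "p e = k"
      using False neq by (auto simp: p_def p1_def p2_def p3_def swp_def)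
    then have "p x = i \<longleftrightarrow> x = a" "p x = j \<longleftrightarrow> x = b" "p x = k \<longleftrightarrow> x = e" for x
      using p by (auto simp: bij_def inj_eq)
    then have "(\<chi> x y. wedge (root_vec i k) (root_vec j k) $ p x $ p y) = wedge (root_vec a e) (root_vec b e)"
      by (simp add: vec_eq_iff wedge_def root_vec_nth)
    then show ?thesis using infinitesimal_isometries_perm[OF W p] by simp
  qed
  fix e :: 'n
  have root_minus: "root_vec a e = - root_vec e a" for a by (simp add: root_vec_def)
  have exp: "x = (\<Sum>a\<in>UNIV. x$a *\<^sub>R root_vec a e)" if "x \<in> sum0" for x
    using sum0_root_vec_expansion[OF that, of e] by (simp add: root_minus)
  have "wedge u (root_vec b e) \<in> ?A" for b
    by (subst exp[OF uv(1)])
      (simp add: linear_sum[OF linear_wedge(1)] linear_scale[OF linear_wedge(1)]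
        subspace_sum[OF sub] subspace_scale[OF sub] all)
  then show ?thesis
    by (subst exp[OF uv(2)])
      (simp add: linear_sum[OF linear_wedge(2)] linear_scale[OF linear_wedge(2)]
        subspace_sum[OF sub] subspace_scale[OF sub])
qed

text \<open>To first order in \<open>h\<close>, the point of the circle at \<open>s + h\<close> is
  the point at \<open>s\<close> moved by \<open>wedge v u\<close>. The remainder is quadratic, so
  \<open>quadratic_increments_constant\<close> applies to \<open>M\<close> along the circle.\<close>

private lemma constant_on_circle:
  assumes W: "wedge v u \<in> infinitesimal_isometries M"
    and uv: "u \<in> sum0" "v \<in> sum0" "norm u = 1" "norm v = 1" "inner u v = 0"
  shows "M (cos s *\<^sub>R u + sin s *\<^sub>R v) = M u"
proof -
  define g where "g s = cos s *\<^sub>R u + sin s *\<^sub>R v" for s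
  define g' where "g' s = cos s *\<^sub>R v - sin s *\<^sub>R u" for s
  have in0: "g s \<in> sum0" "g' s \<in> sum0" for s using uv by (simp_all add: g_def g'_def sum0_rules)
  obtain C where C: "\<forall>x\<in>sum0. \<forall>t. M (x + t *\<^sub>R (wedge v u *v x)) \<le> M x + C * t\<^sup>2 * norm x"
    using W by (auto simp: infinitesimal_isometries_def)
  obtain L where L: "L > 0" "\<forall>x\<in>sum0. M x \<le> L * norm x"
    using norm_on_upper[OF subspace_sum0 M] by blast
  have ip: "inner u u = 1" "inner v v = 1" "inner v u = 0"
    using uv by (simp_all add: norm_eq_1 inner_commute)
  have ng: "norm (g s) = 1" "norm (g' s) = 1" for s
    using ip uv(5) by (simp_all add: norm_eq_sqrt_inner g_def g'_def inner_simps power2_eq_square[symmetric])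
  have Wg: "wedge v u *v g s = g' s" for s
    using ip uv(5) by (simp add: wedge_mult g_def g'_def inner_simps)
  have "M (g (s + h)) \<le> M (g s) + (C + 2 * L) * h\<^sup>2" for s h
  proof -
    have ch: "\<bar>cos h - 1\<bar> \<le> h\<^sup>2" "\<bar>sin h - h\<bar> \<le> h\<^sup>2"
      using cis_bound[of h] abs_Re_le_cmod[of "cis h - 1 - \<i> * h"] abs_Im_le_cmod[of "cis h - 1 - \<i> * h"]
      by simp_all
    have eq: "g (s + h) = (g s + h *\<^sub>R (wedge v u *v g s)) + ((cos h - 1) *\<^sub>R g s + (sin h - h) *\<^sub>R g' s)"
      unfolding Wg by (simp add: g_def g'_def cos_add sin_add algebra_simps)
    have "M (g (s + h)) \<le> M (g s + h *\<^sub>R (wedge v u *v g s)) + (M ((cos h - 1) *\<^sub>R g s) + M ((sin h - h) *\<^sub>R g' s))"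
      unfolding eq by (intro order.trans[OF M_add] add_left_mono M_add) (simp_all add: Wg in0 sum0_rules)
    also have "\<dots> \<le> (M (g s) + C * h\<^sup>2 * norm (g s)) + (h\<^sup>2 * L + h\<^sup>2 * L)"
    proof (intro add_mono)
      show "M (g s + h *\<^sub>R (wedge v u *v g s)) \<le> M (g s) + C * h\<^sup>2 * norm (g s)"
        using C in0 by blast
      show "M ((cos h - 1) *\<^sub>R g s) \<le> h\<^sup>2 * L" "M ((sin h - h) *\<^sub>R g' s) \<le> h\<^sup>2 * L"
        unfolding M_scale[OF in0(1)] M_scale[OF in0(2)]
        using ch L(2)[rule_format, OF in0(1)] L(2)[rule_format, OF in0(2)] M in0
        by (intro mult_mono; simp add: ng norm_on_def)+
    qed
    finally show ?thesis by (simp add: ng algebra_simps)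
  qed
  then have "M (g s) = M (g 0)" by (rule quadratic_increments_constant)
  then show ?thesis by (simp add: g_def)
qed

text \<open>Two vectors of equal nonzero length lie on a circle about zero spanned by an orthonormal
  pair in \<open>sum0\<close>, and the wedge of that pair is an infinitesimal isometry. In the
  degenerate case \<open>w = 0\<close> they agree up to sign.\<close>

theorem infinitesimal_isometry_imp_euclidean:
  assumes Y: "Y \<in> infinitesimal_isometries M" "Y \<noteq> 0"
    and xy: "x \<in> sum0" "y \<in> sum0" "norm x = norm y"
  shows "M x = M y"
proof (cases "x = 0")
  case False
  define u where "u = (1 / norm x) *\<^sub>R x"
  define w where "w = y - inner y u *\<^sub>R u"
  have u: "u \<in> sum0" "norm u = 1" "x = norm x *\<^sub>R u" using False xy(1) by (simp_all add: u_def sum0_rules)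
  have w: "w \<in> sum0" using u xy by (simp add: w_def sum0_rules)
  have uu: "inner u u = 1" using u(2) by (simp add: norm_eq_1)
  have uw: "inner u w = 0" by (simp add: w_def inner_simps uu inner_commute)
  have y: "y = inner y u *\<^sub>R u + w" by (simp add: w_def)
  have "(norm y)\<^sup>2 = inner (inner y u *\<^sub>R u + w) (inner y u *\<^sub>R u + w)"
    using y by (metis power2_norm_eq_inner)
  also have "\<dots> = (inner y u)\<^sup>2 + (norm w)\<^sup>2"
    using uw uu by (simp add: inner_add_left inner_add_right inner_commute[of w u] power2_norm_eq_inner
        power2_eq_square[of "inner y u"])
  finally have pyth: "(inner y u)\<^sup>2 + (norm w)\<^sup>2 = (norm x)\<^sup>2" by (simp add: xy(3))
  have Mx: "M x = norm x * M u" using u(3) M_scale[OF u(1), of "norm x"] by simp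
  show ?thesis
  proof (cases "w = 0")
    case True
    then have "\<bar>inner y u\<bar>\<^sup>2 = (norm x)\<^sup>2" using pyth by simp
    then have "\<bar>inner y u\<bar> = norm x" by (rule power2_eq_imp_eq) auto
    then show ?thesis using True y M_scale[OF u(1), of "inner y u"] Mx by (metis add.right_neutral)
  next
    case w0: False
    define v where "v = (1 / norm w) *\<^sub>R w"
    have v: "v \<in> sum0" "norm v = 1" "w = norm w *\<^sub>R v" "inner u v = 0"
      using w0 w uw by (simp_all add: v_def sum0_rules)
    have "(inner y u / norm x)\<^sup>2 + (norm w / norm x)\<^sup>2 = 1"
      using pyth False by (simp add: power_divide add_divide_distrib[symmetric])
    then obtain s where s: "inner y u / norm x = cos s" "norm w / norm x = sin s"
      by (rule sincos_total_2pi) blast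
    have "y = norm x *\<^sub>R (cos s *\<^sub>R u + sin s *\<^sub>R v)"
      using y v(3) False by (simp add: s[symmetric] scaleR_right_distrib)
    moreover have "M (cos s *\<^sub>R u + sin s *\<^sub>R v) = M u"
      using infinitesimal_isometries_wedge[OF Y v(1) u(1)] u v by (intro constant_on_circle) auto
    ultimately show ?thesis
      using Mx M_scale[of "cos s *\<^sub>R u + sin s *\<^sub>R v" "norm x"] u v by (simp add: sum0_rules)
  qed
next
  case True
  then show ?thesis using xy by simp
qed

end

subsection \<open>Pinching\<close>

lemma unitary_norm_Ad: "unitary_similarity_invariant N \<Longrightarrow> unitary_matrix U \<Longrightarrow> A \<in> herm0 \<Longrightarrow> N (Ad U A) = N A"
  using isometryD(4)[OF isometry_Ad] by blast

text \<open>Averaging with the conjugate by the diagonal matrix that flips the sign at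
  \<open>i\<close> erases the off-diagonal entries of row and column \<open>i\<close>, and cannot
  increase the norm. \<open>F\<close> collects the indices already treated.\<close>

lemma pinching:
  fixes A :: "complex^'n^'n"
  assumes N: "norm_on herm0 N" "unitary_similarity_invariant N" and A: "A \<in> herm0"
  shows "N (dg (dpart A)) \<le> N A"
proof -
  define R where "R F = (\<chi> a b. if a \<noteq> b \<and> (a \<in> F \<or> b \<in> F) then 0 else A$a$b)" for F :: "'n set"
  have "R F \<in> herm0 \<and> N (R F) \<le> N A" if "finite F" for F
    using that
  proof (induction F rule: finite_induct)
    case empty
    have "R {} = A" by (simp add: R_def vec_eq_iff)
    then show ?case using A by simp
  next
    case (insert i F)
    define s :: "real^'n" where "s = (\<chi> a. if a = i then - 1 else 1)"
    have "dg s ** conj_transpose (dg s) = mat 1"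
      by (auto simp: vec_eq_iff dg_mult_nth mat_def dg_nth s_def)
    then have U: "unitary_matrix (dg s)" by (rule unitary_matrixI)
    have cs: "conj_transpose (dg s) = dg s" by (auto simp: vec_eq_iff dg_nth)
    have eq: "R (insert i F) = (1/2) *\<^sub>R (R F + Ad (dg s) (R F))"
      by (auto simp: vec_eq_iff Ad_def cs dg_mult_nth) (auto simp: R_def s_def scaleR_2[symmetric])
    have "R F \<in> herm0" "Ad (dg s) (R F) \<in> herm0" using insert Ad_herm0[OF U] by auto
    moreover have "N (R F + Ad (dg s) (R F)) \<le> N (R F) + N (Ad (dg s) (R F))"
      using N(1) calculation unfolding norm_on_def by blast
    moreover have "N (Ad (dg s) (R F)) = N (R F)" using unitary_norm_Ad[OF N(2) U] calculation by blast
    moreover have "N (R (insert i F)) = (1/2) * N (R F + Ad (dg s) (R F))"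
      using N(1) herm0_closed(1)[OF calculation(1,2)] unfolding norm_on_def eq by simp
    ultimately show ?case using insert by (simp add: eq herm0_closed)
  qed
  then have "R UNIV \<in> herm0 \<and> N (R UNIV) \<le> N A" by simp
  moreover have "Im (A$a$a) = 0" for a
    using arg_cong[OF herm0_nth[OF A, of a a], of Im] by simp
  then have "R UNIV = dg (dpart A)" by (auto simp: vec_eq_iff dg_nth R_def complex_eq_iff)
  ultimately show ?thesis by simp
qed

lemma norm_on_diagonal:
  fixes N :: "complex^'n^'n \<Rightarrow> real"
  assumes "norm_on herm0 N"
  shows "norm_on sum0 (\<lambda>x. N (dg x))"
  unfolding norm_on_def
proof (intro conjI ballI allI)
  fix x y :: "real^'n" and c :: real assume "x \<in> sum0"
  then have x: "dg x \<in> herm0" by (simp add: dg_herm0_iff)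
  have "dg x = 0 \<longleftrightarrow> x = 0" using norm_dg[of x] by (metis norm_eq_zero)
  then show "0 \<le> N (dg x)" "N (dg x) = 0 \<longleftrightarrow> x = 0" "N (dg (c *\<^sub>R x)) = \<bar>c\<bar> * N (dg x)"
    using assms x by (auto simp: norm_on_def linear_scale[OF linear_dg])
  assume "y \<in> sum0"
  then have "dg y \<in> herm0" by (simp add: dg_herm0_iff)
  then show "N (dg (x + y)) \<le> N (dg x) + N (dg y)"
    using assms x by (auto simp: norm_on_def linear_add[OF linear_dg])
qed

lemma isometry_inner:
  fixes N :: "complex^'n^'n \<Rightarrow> real"
  assumes N: "norm_on herm0 N" "unitary_similarity_invariant N" and f: "isometry N f"
    and A: "A \<in> herm0" and B: "B \<in> herm0"
  shows "inner (f A) (f B) = inner A B"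
  using isometry_norm[OF N f A] isometry_norm[OF N f B] isometry_norm[OF N f herm0_closed(1)[OF A B]]
  by (simp add: dot_norm isometryD(2)[OF f A B])

subsection \<open>Isometries that do not preserve commutativity\<close>

text \<open>\<open>Y\<close> is the diagonal part of \<open>br P\<close> transported by
  \<open>g\<close>, with \<open>h\<close> the inverse of \<open>g\<close>. As \<open>h\<close> is
  orthogonal, the pairing of \<open>w\<close> with \<open>Y *v z\<close> is
  \<open>inner P (br (g (dg z)) (g (dg w)))\<close> for sum-zero \<open>z\<close>, \<open>w\<close>;
  this exhibits the skew symmetry and, for a suitable \<open>P\<close>, the nonvanishing.\<close>

lemma noncommuting_imp_infinitesimal_isometry:
  fixes N :: "complex^'n^'n \<Rightarrow> real"
  assumes N: "norm_on herm0 N" "unitary_similarity_invariant N" and g: "isometry N g"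
    and xy: "x \<in> sum0" "y \<in> sum0" and nc: "br (g (dg x)) (g (dg y)) \<noteq> 0"
  shows "\<exists>Y \<in> infinitesimal_isometries (\<lambda>x. N (dg x)). Y \<noteq> 0"
proof -
  have gd: "g (dg z) \<in> herm0" "conj_transpose (g (dg z)) = g (dg z)" if "z \<in> sum0" for z
  proof -
    show "g (dg z) \<in> herm0" using isometryD(1)[OF g] that by (simp add: dg_herm0_iff)
    then show "conj_transpose (g (dg z)) = g (dg z)" by (simp add: herm0_iff)
  qed
  have "br (g (dg x)) (g (dg y)) \<in> herm0" using gd xy by (intro br_herm0) auto
  then obtain v where v: "norm v = 1" "inner (outer v) (br (g (dg x)) (g (dg y))) \<noteq> 0"
    using hermitian_eq_0[of "br (g (dg x)) (g (dg y))"] nc by (auto simp: herm0_iff)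
  let ?P = "outer v"
  have brP: "br ?P A \<in> herm0" if "A \<in> herm0" for A
    using that by (intro br_herm0) (auto simp: herm0_iff)
  obtain h where h: "isometry N h" "\<And>A. A \<in> herm0 \<Longrightarrow> h (g A) = A" "\<And>A. A \<in> herm0 \<Longrightarrow> g (h A) = A"
    using isometry_inverse[OF g] by metis
  obtain G where G: "linear G" "\<And>A. A \<in> herm0 \<Longrightarrow> G A = g A"
    using isometry_linear_extension[OF g] by metis
  obtain H where H: "linear H" "\<And>A. A \<in> herm0 \<Longrightarrow> H A = h A"
    using isometry_linear_extension[OF h(1)] by metis
  obtain Q :: "real^'n \<Rightarrow> real^'n" where Q: "linear Q" "\<And>z. Q z \<in> sum0" "\<And>z. z \<in> sum0 \<Longrightarrow> Q z = z"
    "\<And>z w. w \<in> sum0 \<Longrightarrow> inner (Q z) w = inner z w"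
    using orthogonal_projection_exists[OF subspace_sum0] by metis
  \<comment> \<open>\<open>Q\<close> makes the map total on \<open>real^'n\<close>; it also
    annihilates the constant vector, which gives the zero row sums.\<close>
  define T where "T z = dpart (H (br ?P (G (dg (Q z)))))" for z
  have "linear T"
    unfolding T_def[abs_def]
    by (intro linear_compose[OF _ linear_dpart, unfolded o_def] linear_compose[OF _ H(1), unfolded o_def]
      linear_compose[OF _ linear_br, unfolded o_def] linear_compose[OF _ G(1), unfolded o_def]
      linear_compose[OF Q(1) linear_dg, unfolded o_def])
  define Y where "Y = matrix T"
  have Ymul: "Y *v z = T z" for z using fun_cong[OF matrix_vector_mul(2)[OF \<open>linear T\<close>]] by (simp add: Y_def)
  have dgQ: "dg (Q z) \<in> herm0" "g (dg (Q z)) \<in> herm0" "br ?P (g (dg (Q z))) \<in> herm0" for z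
    using Q(2) gd brP by (auto simp: dg_herm0_iff)
  have T: "T z = dpart (h (br ?P (g (dg (Q z)))))" for z
    using dgQ by (simp add: T_def G(2) H(2))
  have T0: "T z \<in> sum0" for z
    unfolding T using dgQ isometryD(1)[OF h(1)] by (intro dpart_sum0) auto
  have form: "inner w (T z) = inner (g (dg w)) (br ?P (g (dg (Q z))))" if w: "w \<in> sum0" for w z
  proof -
    have "inner w (T z) = inner (dg w) (h (br ?P (g (dg (Q z)))))" by (simp add: T inner_dg)
    also have "\<dots> = inner (h (g (dg w))) (h (br ?P (g (dg (Q z)))))" using w h(2) by (simp add: dg_herm0_iff)
    also have "\<dots> = inner (g (dg w)) (br ?P (g (dg (Q z))))"
      using dgQ gd[OF w] by (intro isometry_inner[OF N h(1)])
    finally show ?thesis .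
  qed
  have form': "inner w (T z) = inner ?P (br (g (dg (Q z))) (g (dg w)))" if "w \<in> sum0" for w z
    unfolding form[OF that] using gd that Q(2) by (intro inner_br) auto
  have br_skew: "br A B = - br B A" for A B :: "complex^'n^'n"
    by (simp add: br_def vec_eq_iff algebra_simps)
  have "Y$i$j + Y$j$i = 0" for i j
  proof -
    have "Y$i$j = inner ?P (br (g (dg (Q (axis j 1)))) (g (dg (Q (axis i 1)))))" for i j
    proof -
      have "Y$i$j = (Y *v axis j 1) $ i" by (simp add: matrix_vector_mul_component inner_axis)
      also have "\<dots> = inner (axis i 1) (T (axis j 1))" by (simp add: Ymul inner_axis')
      also have "\<dots> = inner (Q (axis i 1)) (T (axis j 1))" using Q(4)[OF T0] by simp
      finally show ?thesis using form'[OF Q(2)] by simp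
    qed
    then show ?thesis using br_skew by (metis inner_minus_right add.left_inverse)
  qed
  moreover have "(\<Sum>j\<in>UNIV. Y$i$j) = 0" for i
  proof -
    have "inner (Q (\<chi> j. 1)) (Q (\<chi> j. 1)) = 0"
      using Q(2)[of "\<chi> j. 1"] unfolding Q(4)[OF Q(2)] by (simp add: inner_vec_def sum0_def)
    then have "Q (\<chi> j. 1) = 0" by simp
    then have "Y *v (\<chi> j. 1) = 0"
      unfolding Ymul T_def by (simp add: linear_0[OF linear_dg] linear_0[OF G(1)] linear_0[OF linear_br]
          linear_0[OF H(1)] linear_0[OF linear_dpart])
    then show ?thesis by (simp add: vec_eq_iff matrix_vector_mult_def)
  qed
  moreover obtain L where L: "L > 0" "\<And>A. A \<in> herm0 \<Longrightarrow> N A \<le> L * norm A"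
    using norm_on_upper[OF subspace_herm0 N(1)] by metis
  obtain C where C: "C \<ge> 0" "\<And>A t. norm (Ad (rot v t) A - (A + t *\<^sub>R br ?P A)) \<le> C * t\<^sup>2 * norm A"
    using Ad_rot_expansion[of v] by metis
  have "N (dg (z + t *\<^sub>R (Y *v z))) \<le> N (dg z) + (L * C) * t\<^sup>2 * norm z" if z: "z \<in> sum0" for z t
  proof -
    let ?A = "g (dg z)"
    let ?V = "?A + t *\<^sub>R br ?P ?A"
    have zz: "dg z \<in> herm0" using z by (simp add: dg_herm0_iff)
    have A: "?A \<in> herm0" "br ?P ?A \<in> herm0" "?V \<in> herm0"
      using gd[OF z] brP by (auto intro!: herm0_closed(1,2))
    have R: "unitary_matrix (rot v t)" using v(1) by (rule unitary_rot)
    have "h ?V = dg z + t *\<^sub>R h (br ?P ?A)"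
      using isometryD(2)[OF h(1) A(1) herm0_closed(2)[OF A(2)]] isometryD(3)[OF h(1) A(2)] h(2)[OF zz]
      by simp
    then have "dpart (h ?V) = z + t *\<^sub>R (Y *v z)"
      by (simp add: Ymul T Q(3)[OF z] linear_add[OF linear_dpart] linear_scale[OF linear_dpart])
    then have "N (dg (z + t *\<^sub>R (Y *v z))) \<le> N (h ?V)"
      using pinching[OF N isometryD(1)[OF h(1) A(3)]] by simp
    also have "\<dots> = N ?V" using isometryD(4)[OF h(1) A(3)] .
    \<comment> \<open>The rotated matrix has exactly the norm of \<open>?A\<close>, so only the
      quadratic remainder of the expansion is lost.\<close>
    also have "\<dots> \<le> N (Ad (rot v t) ?A) + N (?V - Ad (rot v t) ?A)"
    proof -
      have "N (Ad (rot v t) ?A + (?V - Ad (rot v t) ?A)) \<le> N (Ad (rot v t) ?A) + N (?V - Ad (rot v t) ?A)"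
        using N(1) Ad_herm0[OF R A(1)] subspace_diff[OF subspace_herm0 A(3) Ad_herm0[OF R A(1)]]
        unfolding norm_on_def by blast
      then show ?thesis by simp
    qed
    also have "N (Ad (rot v t) ?A) = N (dg z)"
      using unitary_norm_Ad[OF N(2) R A(1)] isometryD(4)[OF g zz] by simp
    also have "N (?V - Ad (rot v t) ?A) \<le> L * (C * t\<^sup>2 * norm z)"
    proof -
      have "norm (?V - Ad (rot v t) ?A) \<le> C * t\<^sup>2 * norm ?A"
        using C(2)[of t ?A] by (simp add: norm_minus_commute)
      then have "norm (?V - Ad (rot v t) ?A) \<le> C * t\<^sup>2 * norm z"
        using isometry_norm[OF N g zz] by simp
      then show ?thesis
        using L(2)[OF subspace_diff[OF subspace_herm0 A(3) Ad_herm0[OF R A(1)]]] L(1)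
        by (meson less_imp_le mult_left_mono order.trans)
    qed
    finally show ?thesis by (simp add: mult.assoc)
  qed
  ultimately have "Y \<in> infinitesimal_isometries (\<lambda>x. N (dg x))"
    unfolding infinitesimal_isometries_def by blast
  moreover have "inner y (T x) \<noteq> 0"
    using v(2) form'[OF xy(2), of x] by (simp add: Q(3)[OF xy(1)])
  then have "Y \<noteq> 0" using Ymul[of x] by auto
  ultimately show ?thesis by blast
qed

lemma noncommuting_imp_euclidean:
  fixes N :: "complex^'n^'n \<Rightarrow> real"
  assumes N: "norm_on herm0 N" "unitary_similarity_invariant N" and f: "isometry N f"
    and AB: "A \<in> herm0" "B \<in> herm0" "A ** B = B ** A" and nc: "f A ** f B \<noteq> f B ** f A"
    and XY: "X \<in> herm0" "Y \<in> herm0" "norm X = norm Y"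
  shows "N X = N Y"
proof -
  obtain U x y where U: "unitary_matrix U" and xy: "x \<in> sum0" "y \<in> sum0"
    and A: "A = Ad U (dg x)" and B: "B = Ad U (dg y)"
    using diagonalize_pair[OF AB] by metis
  have "isometry N (\<lambda>A. f (Ad U A))" using isometry_compose[OF f isometry_Ad[OF N(2) U]] .
  moreover have "br (f (Ad U (dg x))) (f (Ad U (dg y))) \<noteq> 0" using nc by (simp add: br_eq_0_iff A B)
  ultimately obtain W where W: "W \<in> infinitesimal_isometries (\<lambda>x. N (dg x))" "W \<noteq> 0"
    using noncommuting_imp_infinitesimal_isometry[OF N _ xy] by blast
  have perm: "N (dg (perm_vec p x)) = N (dg x)" if "bij p" "x \<in> sum0" for p x
    using permutation_unitary[OF that(1)] unitary_norm_Ad[OF N(2)] that(2)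
    by (metis dg_herm0_iff perm_vec_def)
  obtain U1 x1 where 1: "unitary_matrix U1" "x1 \<in> sum0" "X = Ad U1 (dg x1)" using diagonalize[OF XY(1)] .
  obtain U2 x2 where 2: "unitary_matrix U2" "x2 \<in> sum0" "Y = Ad U2 (dg x2)" using diagonalize[OF XY(2)] .
  have "N (dg x1) = N (dg x2)"
    using infinitesimal_isometry_imp_euclidean[OF norm_on_diagonal[OF N(1)] perm W 1(2) 2(2)] XY(3)
    by (simp add: 1 2 norm_Ad)
  then show ?thesis using unitary_norm_Ad[OF N(2)] 1 2 by (simp add: dg_herm0_iff)
qed

subsection \<open>Isometries that preserve commutativity\<close>

text \<open>Only orthogonality and commutation matter from here on, so the given norm is replaced by
  the Frobenius norm.\<close>

definition comm_isometry :: "(complex^'n^'n \<Rightarrow> complex^'n^'n) \<Rightarrow> bool" where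
  "comm_isometry f \<longleftrightarrow> isometry norm f \<and>
     (\<forall>A\<in>herm0. \<forall>B\<in>herm0. f A ** f B = f B ** f A \<longleftrightarrow> A ** B = B ** A)"

lemma norm_on_norm: "norm_on S norm"
  by (auto simp: norm_on_def norm_triangle_ineq)

lemma unitary_similarity_invariant_norm: "unitary_similarity_invariant norm"
  by (auto simp: unitary_similarity_invariant_def unitary_Ad norm_Ad)

lemma comm_isometry_isometry: "comm_isometry f \<Longrightarrow> isometry norm f"
  by (simp add: comm_isometry_def)

lemma comm_isometry_comm:
  "comm_isometry f \<Longrightarrow> A \<in> herm0 \<Longrightarrow> B \<in> herm0 \<Longrightarrow> f A ** f B = f B ** f A \<longleftrightarrow> A ** B = B ** A"
  by (simp add: comm_isometry_def)

lemmas comm_isometryD = isometryD[OF comm_isometry_isometry]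

lemma comm_isometry_inner:
  "comm_isometry f \<Longrightarrow> A \<in> herm0 \<Longrightarrow> B \<in> herm0 \<Longrightarrow> inner (f A) (f B) = inner A B"
  using isometry_inner[OF norm_on_norm unitary_similarity_invariant_norm comm_isometry_isometry] .

lemma comm_isometry_compose: "comm_isometry f \<Longrightarrow> comm_isometry g \<Longrightarrow> comm_isometry (\<lambda>A. f (g A))"
  using isometry_compose[of norm f g] isometryD(1)[of norm g] by (simp add: comm_isometry_def)

lemma comm_isometry_Ad: "unitary_matrix U \<Longrightarrow> comm_isometry (Ad U)"
  by (simp add: comm_isometry_def Ad_comm_iff isometry_Ad unitary_similarity_invariant_norm)

lemma comm_isometry_sign:
  assumes "\<bar>s\<bar> = 1"
  shows "comm_isometry (\<lambda>A. s *\<^sub>R A)"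
proof -
  have "s * s = 1" using assms by (metis abs_mult_self_eq mult_1)
  then have "bij_betw (\<lambda>A. s *\<^sub>R A) herm0 herm0"
    by (intro bij_betw_byWitness[where f' = "\<lambda>A. s *\<^sub>R A"]) (auto simp: herm0_closed)
  then show ?thesis using assms \<open>s * s = 1\<close>
    by (simp add: comm_isometry_def isometry_def real_linear_on_def scaleR_right_distrib
        matrix_mult_scaleR_left matrix_mult_scaleR_right mult.commute)
qed

lemma distinct_weights_sum0: "\<exists>w\<in>sum0. \<forall>i j. (w::real^'n)$i = w$j \<longrightarrow> i = j"
proof -
  obtain w :: "real^'n" where w: "\<forall>i j. w$i = w$j \<longrightarrow> i = j" using distinct_weights by blast
  let ?w = "\<chi> i. w$i - (\<Sum>k\<in>UNIV. w$k) / real CARD('n)"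
  have "?w \<in> sum0" by (simp add: sum0_def sum_subtractf)
  moreover have "\<forall>i j. ?w$i = ?w$j \<longrightarrow> i = j" using w by simp
  ultimately show ?thesis by blast
qed

text \<open>Diagonal matrices are the commutant of one with distinct entries, \<open>dg w\<close>.
  Its image is made diagonal as \<open>dg d\<close>, where \<open>d\<close> might have repeated
  entries; but every diagonal matrix commutes with \<open>dg d\<close>, so its preimage commutes
  with \<open>dg w\<close>. This gives one inclusion, and dimension gives equality.\<close>

lemma comm_isometry_diagonal:
  fixes f :: "complex^'n^'n \<Rightarrow> complex^'n^'n"
  assumes f: "comm_isometry f"
  shows "\<exists>U. unitary_matrix U \<and> (\<lambda>A. Ad U (f A)) ` dg ` sum0 = dg ` sum0"
proof -
  obtain w :: "real^'n" where w: "w \<in> sum0" "\<And>i j. w$i = w$j \<Longrightarrow> i = j"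
    using distinct_weights_sum0 by metis
  have wh: "dg w \<in> herm0" using w by (simp add: dg_herm0_iff)
  obtain V d where V: "unitary_matrix V" and d: "d \<in> sum0" "f (dg w) = Ad V (dg d)"
    using diagonalize[OF comm_isometryD(1)[OF f wh]] .
  let ?U = "conj_transpose V"
  have U: "unitary_matrix ?U" using V by (rule unitary_conj_transpose)
  define g where "g A = Ad ?U (f A)" for A
  have g: "comm_isometry g"
    unfolding g_def using comm_isometry_compose[OF comm_isometry_Ad[OF U] f] .
  have gw: "g (dg w) = dg d" by (simp add: g_def d Ad_inverse[OF V])
  let ?D = "dg ` (sum0 :: (real^'n) set)"
  have "?D \<subseteq> g ` ?D"
  proof
    fix A assume "A \<in> ?D"
    then obtain y where y: "y \<in> sum0" "A = dg y" by blast
    then have "A \<in> herm0" by (simp add: dg_herm0_iff)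
    then obtain B where B: "B \<in> herm0" "A = g B" using comm_isometryD(5)[OF g] by blast
    have "g (dg w) ** g B = g B ** g (dg w)" using dg_comm[of d y] by (simp add: gw B(2)[symmetric] y)
    then have "dg w ** B = B ** dg w" using comm_isometry_comm[OF g wh B(1)] by simp
    then have "B$i$j = 0" if "i \<noteq> j" for i j using that w(2) unfolding dg_comm_iff by blast
    then have "B = dg (dpart B)" using herm0_diagonal[OF B(1)] by blast
    then show "A \<in> g ` ?D" using B dpart_sum0[OF B(1)] by blast
  qed
  moreover obtain G where G: "linear G" "\<And>A. A \<in> herm0 \<Longrightarrow> G A = g A"
    using isometry_linear_extension[OF comm_isometry_isometry[OF g]] by metis
  have GD: "G ` ?D = g ` ?D" by (rule image_cong) (auto simp: G(2) dg_herm0_iff)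
  have sD: "subspace ?D" using linear_subspace_image[OF linear_dg subspace_sum0] .
  have "dim (g ` ?D) \<le> dim ?D" using dim_image_le[OF G(1), of ?D] by (simp add: GD)
  moreover have "subspace (g ` ?D)" using linear_subspace_image[OF G(1) sD] by (simp add: GD)
  ultimately have "g ` ?D = ?D" using subspace_dim_equal[OF sD] by blast
  then show ?thesis using U unfolding g_def by blast
qed

section \<open>The off-diagonal planes \<open>pl i j\<close> and the induced signed permutation of
  the diagonal\<close>

definition pl :: "'n \<Rightarrow> 'n \<Rightarrow> complex \<Rightarrow> complex^'n^'n" where
  "pl i j z = (\<chi> a b. (if a = i then (if b = j then z else 0) else 0)
     + (if a = j then (if b = i then cnj z else 0) else 0))"

lemma pl_herm0: "i \<noteq> j \<Longrightarrow> pl i j z \<in> herm0"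
  by (auto simp: herm0_iff vec_eq_iff pl_def trace_def intro!: sum.neutral)

lemma dpart_pl: "i \<noteq> j \<Longrightarrow> dpart (pl i j z) = 0"
  by (auto simp: vec_eq_iff pl_def)

lemma pl_add: "pl i j (z + w) = pl i j z + pl i j w"
  and pl_scale: "pl i j (of_real t * z) = t *\<^sub>R pl i j z"
  and pl_swap: "pl j i (cnj z) = pl i j z"
  by (auto simp: pl_def vec_eq_iff complex_eq_iff)

lemma inner_pl:
  assumes "conj_transpose X = X"
  shows "inner X (pl i j z) = 2 * Re (cnj (X$i$j) * z)"
proof -
  have "X$j$i = cnj (X$i$j)" using assms by (metis conj_transpose_nth)
  moreover have "inner X (pl i j z) = Re (\<Sum>a\<in>UNIV. \<Sum>b\<in>UNIV. cnj (X$a$b) * pl i j z$a$b)"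
    by (simp add: inner_matrix)
  moreover have "(\<Sum>b\<in>UNIV. cnj (X$a$b) * pl i j z$a$b) =
      (if a = i then cnj (X$a$j) * z else 0) + (if a = j then cnj (X$a$i) * cnj z else 0)" for a
    by (simp add: pl_def distrib_left sum.distrib mult_delta_right)
  ultimately show ?thesis by (simp add: sum.distrib)
qed

lemma pl_mult_nth:
  "(A ** pl i j z)$a$b = (if b = j then A$a$i * z else 0) + (if b = i then A$a$j * cnj z else 0)"
  "(pl i j z ** A)$a$b = (if a = i then z * A$j$b else 0) + (if a = j then cnj z * A$i$b else 0)"
  by (simp_all add: matrix_matrix_mult_def pl_def distrib_left distrib_right sum.distrib
      mult_delta_right mult_delta_left)

lemma dg_comm_pl:
  assumes "x$i = x$j"
  shows "dg x ** pl i j z = pl i j z ** dg x"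
  unfolding dg_comm_iff
proof (intro allI impI)
  fix a b assume "x$a \<noteq> x$b"
  then have "\<not> (a = i \<and> b = j)" "\<not> (a = j \<and> b = i)" using assms by metis+
  then show "pl i j z $ a $ b = 0" by (auto simp: pl_def)
qed

lemma orthogonal_hyperplane:
  fixes y :: "real^'n"
  assumes y: "y \<in> sum0" and ij: "i \<noteq> j"
    and orth: "\<And>x. x \<in> sum0 \<Longrightarrow> x$i = x$j \<Longrightarrow> inner y x = 0"
  shows "y = y$i *\<^sub>R root_vec i j"
proof -
  define h where "h = (y$i + y$j) / 2"
  have l: "y$l = h" if "l \<noteq> i" "l \<noteq> j" for l
  proof -
    \<comment> \<open>The test vector has entry 2 at \<open>l\<close> and equal entries -1 at
      \<open>i\<close> and \<open>j\<close>.\<close>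
    have "inner (root_vec l i + root_vec l j) y = 0"
      using orth[OF subspace_add[OF subspace_sum0 root_vec_sum0 root_vec_sum0], of l i l j] that ij
      by (simp add: root_vec_nth inner_commute[of _ y])
    then show ?thesis by (simp add: inner_add_left inner_root_vec h_def)
  qed
  have "y$l = h + (if l = i then y$i - h else 0) + (if l = j then y$j - h else 0)" for l
    using l ij by auto
  then have "(\<Sum>l\<in>UNIV. y$l) = (\<Sum>l\<in>UNIV. h + (if l = i then y$i - h else 0) + (if l = j then y$j - h else 0))"
    by (rule sum.cong[OF refl])
  also have "\<dots> = real CARD('n) * h"
    by (simp add: sum.distrib) (simp add: h_def field_simps)
  finally have "h = 0" using y by (simp add: sum0_def)
  then show ?thesis
    using l by (auto simp: vec_eq_iff root_vec_nth h_def)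
qed

text \<open>The hyperplane \<open>x$i = x$j\<close> consists of diagonal matrices commuting with
  \<open>pl i j 1\<close>. A nonzero entry of the image of \<open>pl i j 1\<close> at
  \<open>(a, b)\<close> forces the image of this hyperplane into \<open>z$a = z$b\<close>; comparing
  normals gives the root up to a factor.\<close>

lemma comm_isometry_root:
  fixes g :: "complex^'n^'n \<Rightarrow> complex^'n^'n"
  assumes g: "comm_isometry g" and D: "g ` dg ` sum0 = dg ` sum0" and ij: "i \<noteq> j"
  shows "\<exists>a b. a \<noteq> b \<and> g (dg (root_vec i j)) = dg (root_vec a b)"
proof -
  let ?B = "pl i j 1"
  have B: "?B \<in> herm0" using pl_herm0[OF ij] .
  have gB: "g ?B \<in> herm0" using comm_isometryD(1)[OF g B] .
  obtain a b where ab: "a \<noteq> b" "g ?B $ a $ b \<noteq> 0"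
  proof (rule ccontr)
    assume "\<not> thesis"
    then have "g ?B = dg (dpart (g ?B))" using that herm0_diagonal[OF gB] by blast
    then have "g ?B \<in> g ` dg ` sum0" using dpart_sum0[OF gB] D by blast
    then obtain x where "x \<in> sum0" "g ?B = g (dg x)" by blast
    then have "?B = dg x" using comm_isometryD(6)[OF g B] by (simp add: dg_herm0_iff)
    then have "?B $ i $ j = dg x $ i $ j" by simp
    then show False using ij by (simp add: pl_def dg_nth)
  qed
  have "dg (root_vec a b) \<in> g ` dg ` sum0" using D by simp
  then obtain y where y: "y \<in> sum0" "g (dg y) = dg (root_vec a b)" by force
  have yh: "dg y \<in> herm0" using y by (simp add: dg_herm0_iff)
  have "inner y x = 0" if x: "x \<in> sum0" "x$i = x$j" for x
  proof -
    have xh: "dg x \<in> herm0" using x by (simp add: dg_herm0_iff)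
    obtain z where z: "g (dg x) = dg z" using D x by blast
    have "dg z ** g ?B = g ?B ** dg z"
      using comm_isometry_comm[OF g xh B] dg_comm_pl[of x i j 1] x(2) by (simp add: z)
    then have "z$a = z$b" using ab(2) unfolding dg_comm_iff by blast
    then have "inner (root_vec a b) z = 0" by (simp add: inner_root_vec)
    then show ?thesis using comm_isometry_inner[OF g yh xh] by (simp add: z y(2) inner_dg)
  qed
  then have yr: "y = y$i *\<^sub>R root_vec i j" using orthogonal_hyperplane[OF y(1) ij] by blast
  define t where "t = y$i"
  have yt: "y = t *\<^sub>R root_vec i j" using yr by (simp add: t_def)
  \<comment> \<open>Lengths are preserved, so the factor \<open>t\<close> is a sign, absorbed by
    exchanging \<open>a\<close> and \<open>b\<close>.\<close>
  have "inner y y = 2" using comm_isometry_inner[OF g yh yh] ab(1)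
    by (simp add: y(2) inner_dg inner_root_vec root_vec_nth)
  moreover have "inner y y = t * t * 2" unfolding yt using ij by (simp add: inner_root_vec root_vec_nth)
  ultimately have "t * t = 1" by simp
  then have "t = 1 \<or> t = - 1" by (simp add: square_eq_1_iff)
  moreover have "dg (root_vec i j) \<in> herm0" by (simp add: dg_herm0_iff)
  then have "g (dg y) = t *\<^sub>R g (dg (root_vec i j))"
    unfolding yt linear_scale[OF linear_dg] by (rule comm_isometryD(3)[OF g])
  moreover have "dg (root_vec b a) = - dg (root_vec a b)"
    using linear_neg[OF linear_dg, of "root_vec a b"] by (simp add: root_vec_def)
  ultimately have "g (dg (root_vec i j)) = dg (root_vec a b) \<or> g (dg (root_vec i j)) = dg (root_vec b a)"
    unfolding y(2) by auto
  then show ?thesis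
  proof
    assume "g (dg (root_vec i j)) = dg (root_vec a b)"
    then show ?thesis using ab(1) by (intro exI[of _ a] exI[of _ b]) simp
  next
    assume "g (dg (root_vec i j)) = dg (root_vec b a)"
    then show ?thesis using ab(1) by (intro exI[of _ b] exI[of _ a]) simp
  qed
qed

text \<open>Distinct roots based at \<open>i0\<close> have inner product 1, so any two of their
  images share exactly one of the first and second index. Hence all share the first (sign 1) or all
  share the second (sign -1), and the common index is the image of \<open>i0\<close>.\<close>

lemma comm_isometry_permutation:
  fixes g :: "complex^'n^'n \<Rightarrow> complex^'n^'n"
  assumes g: "comm_isometry g" and D: "g ` dg ` sum0 = dg ` sum0"
  shows "\<exists>\<sigma> s. bij \<sigma> \<and> \<bar>s\<bar> = (1::real) \<and> (\<forall>x\<in>sum0. \<exists>y. g (dg x) = dg y \<and> (\<forall>k. y$\<sigma> k = s * x$k))"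
proof -
  fix i0 :: 'n
  have "\<forall>j. \<exists>a b. j \<noteq> i0 \<longrightarrow> a \<noteq> b \<and> g (dg (root_vec i0 j)) = dg (root_vec a b)"
    using comm_isometry_root[OF g D] by metis
  then obtain a b where ab: "\<And>j. j \<noteq> i0 \<Longrightarrow> a j \<noteq> b j"
    "\<And>j. j \<noteq> i0 \<Longrightarrow> g (dg (root_vec i0 j)) = dg (root_vec (a j) (b j))" by metis
  have dgr: "dg (root_vec i j) \<in> herm0" for i j :: 'n by (simp add: dg_herm0_iff)
  have dich: "a j = a l \<and> b j \<noteq> b l \<or> a j \<noteq> a l \<and> b j = b l" if "j \<noteq> i0" "l \<noteq> i0" "j \<noteq> l" for j l
  proof -
    have "inner (root_vec (a j) (b j)) (root_vec (a l) (b l)) = inner (root_vec i0 j) (root_vec i0 l)"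
      using comm_isometry_inner[OF g dgr dgr, of i0 j i0 l] that by (simp add: ab(2) inner_dg)
    then show ?thesis using that ab(1)[of j] ab(1)[of l]
      by (auto simp: inner_root_vec root_vec_nth split: if_splits)
  qed
  obtain \<sigma> s where \<sigma>: "inj \<sigma>" "\<bar>s\<bar> = (1::real)"
    "\<And>j. j \<noteq> i0 \<Longrightarrow> root_vec (a j) (b j) = s *\<^sub>R root_vec (\<sigma> i0) (\<sigma> j)"
  proof (cases "\<exists>j l. j \<noteq> i0 \<and> l \<noteq> i0 \<and> j \<noteq> l \<and> a j = a l")
    case True
    then obtain j l where jl: "j \<noteq> i0" "l \<noteq> i0" "j \<noteq> l" "a j = a l" by blast
    \<comment> \<open>Otherwise \<open>m\<close> would share its second index with both
      \<open>j\<close> and \<open>l\<close>, which differ there.\<close>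
    have all: "a m = a j" if "m \<noteq> i0" for m
      using dich[of m j] dich[of m l] dich[of j l] jl that by metis
    let ?\<sigma> = "\<lambda>m. if m = i0 then a j else b m"
    show thesis
    proof (rule that[of ?\<sigma> 1])
      show "inj ?\<sigma>"
      proof (rule injI)
        fix m k assume "?\<sigma> m = ?\<sigma> k"
        then show "m = k" using all[of m] all[of k] ab(1)[of m] ab(1)[of k] dich[of m k]
          by (auto split: if_splits)
      qed
    qed (use all in auto)
  next
    case False
    then have diff: "a m \<noteq> a k" "b m = b k" if "m \<noteq> i0" "k \<noteq> i0" "m \<noteq> k" for m k
      using dich[OF that] that by blast+
    show thesis
    proof (cases "\<exists>j. j \<noteq> i0")
      case True
      then obtain j where j: "j \<noteq> i0" by blast
      have all: "b m = b j" if "m \<noteq> i0" for m using diff(2)[OF that j] by blast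
      let ?\<sigma> = "\<lambda>m. if m = i0 then b j else a m"
      show thesis
      proof (rule that[of ?\<sigma> "- 1"])
        show "inj ?\<sigma>"
        proof (rule injI)
          fix m k assume "?\<sigma> m = ?\<sigma> k"
          then show "m = k" using all[of m] all[of k] ab(1)[of m] ab(1)[of k] diff(1)[of m k]
            by (auto split: if_splits)
        qed
      qed (use all in \<open>auto simp: root_vec_def\<close>)
    next
      case False
      then have "inj (\<lambda>m::'n. m)" by simp
      then show thesis using that[of "\<lambda>m. m" 1] False by auto
    qed
  qed
  have "bij \<sigma>" using \<sigma>(1) by (simp add: bij_def finite_UNIV_inj_surj)
  moreover have "\<exists>y. g (dg x) = dg y \<and> (\<forall>k. y$\<sigma> k = s * x$k)" if x: "x \<in> sum0" for x
  proof -
    obtain G where G: "linear G" "\<And>A. A \<in> herm0 \<Longrightarrow> G A = g A"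
      using isometry_linear_extension[OF comm_isometry_isometry[OF g]] by metis
    have lin: "linear (\<lambda>x. G (dg x))" using linear_compose[OF linear_dg G(1)] by (simp add: o_def)
    have Gr: "G (dg (root_vec i0 j)) = dg (s *\<^sub>R root_vec (\<sigma> i0) (\<sigma> j))" for j
      using linear_0[OF lin] linear_0[OF linear_dg] by (cases "j = i0") (simp_all add: G(2) dgr ab(2) \<sigma>(3))
    define y where "y = (\<Sum>j\<in>UNIV. (- x$j) *\<^sub>R s *\<^sub>R root_vec (\<sigma> i0) (\<sigma> j))"
    have "g (dg x) = G (dg (\<Sum>j\<in>UNIV. (- x$j) *\<^sub>R root_vec i0 j))"
      using sum0_root_vec_expansion[OF x, of i0] x by (simp add: G(2) dg_herm0_iff)
    also have "\<dots> = dg y"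
      unfolding y_def linear_sum[OF lin] linear_scale[OF lin] Gr
      by (simp only: linear_sum[OF linear_dg] linear_scale[OF linear_dg])
    finally have 1: "g (dg x) = dg y" .
    have "y$\<sigma> k = s * x$k" for k
    proof -
      have "y$\<sigma> k = s * (\<Sum>j\<in>UNIV. (- x$j) *\<^sub>R root_vec i0 j) $ k"
        using \<sigma>(1) by (simp add: y_def root_vec_nth inj_eq sum_distrib_left mult_ac)
      then show ?thesis by (simp only: sum0_root_vec_expansion[OF x, of i0, symmetric])
    qed
    with 1 show ?thesis by blast
  qed
  ultimately show ?thesis using \<sigma>(2) by blast
qed

lemma comm_isometry_fix_diagonal:
  fixes f :: "complex^'n^'n \<Rightarrow> complex^'n^'n"
  assumes f: "comm_isometry f"
  shows "\<exists>U s h. unitary_matrix U \<and> \<bar>s\<bar> = (1::real) \<and> comm_isometry h \<and> (\<forall>x\<in>sum0. h (dg x) = dg x) \<and>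
     (\<forall>A. f A = s *\<^sub>R Ad U (h A))"
proof -
  obtain U where U: "unitary_matrix U" and D: "(\<lambda>A. Ad U (f A)) ` dg ` sum0 = dg ` sum0"
    using comm_isometry_diagonal[OF f] by blast
  have g: "comm_isometry (\<lambda>A. Ad U (f A))" using comm_isometry_compose[OF comm_isometry_Ad[OF U] f] .
  obtain \<sigma> s where \<sigma>: "bij \<sigma>" "\<bar>s\<bar> = (1::real)"
    "\<And>x. x \<in> sum0 \<Longrightarrow> \<exists>y. Ad U (f (dg x)) = dg y \<and> (\<forall>k. y$\<sigma> k = s * x$k)"
    using comm_isometry_permutation[OF g D] by metis
  have s2: "s * s = 1" using \<sigma>(2) by (metis abs_mult_self_eq mult_1)
  obtain V where V: "unitary_matrix V" "\<And>x. Ad V (dg x) = dg (\<chi> i. x$(\<sigma> i))"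
    using permutation_unitary[OF \<sigma>(1)] by blast
  define h where "h A = s *\<^sub>R Ad V (Ad U (f A))" for A
  have h: "comm_isometry h" unfolding h_def
    by (rule comm_isometry_compose[OF comm_isometry_sign[OF \<sigma>(2)] comm_isometry_compose[OF comm_isometry_Ad[OF V(1)] g]])
  have "h (dg x) = dg x" if x: "x \<in> sum0" for x
  proof -
    obtain y where y: "Ad U (f (dg x)) = dg y" "\<forall>k. y$\<sigma> k = s * x$k" using \<sigma>(3)[OF x] by blast
    have "(\<chi> i. y$(\<sigma> i)) = s *\<^sub>R x" using y(2) by (simp add: vec_eq_iff)
    then show ?thesis by (simp add: h_def y(1) V(2) linear_scale[OF linear_dg] s2)
  qed
  moreover have "f A = s *\<^sub>R Ad (conj_transpose U ** conj_transpose V) (h A)" for A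
    by (simp add: h_def linear_scale[OF linear_Ad] s2 Ad_inverse[OF V(1)] Ad_inverse[OF U] flip: Ad_Ad)
  ultimately show ?thesis
    using h \<sigma>(2) unitary_mult[OF unitary_conj_transpose[OF U] unitary_conj_transpose[OF V(1)]] by blast
qed

section \<open>Isometries that fix the diagonal\<close>

context
  fixes h :: "complex^'n^'n \<Rightarrow> complex^'n^'n"
  assumes h: "comm_isometry h" and h_fix: "\<And>x. x \<in> sum0 \<Longrightarrow> h (dg x) = dg x"
    and card: "CARD('n) \<ge> 3"
begin

private lemma hermitian: "A \<in> herm0 \<Longrightarrow> conj_transpose A = A"
  by (simp add: herm0_iff)

private lemma h_dpart:
  assumes A: "A \<in> herm0"
  shows "dpart (h A) = dpart A"
proof -
  have hA: "h A \<in> herm0" using comm_isometryD(1)[OF h A] .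
  define z where "z = dpart (h A) - dpart A"
  have z: "z \<in> sum0" unfolding z_def
    by (intro subspace_diff[OF subspace_sum0] dpart_sum0 hA A)
  have zh: "dg z \<in> herm0" using z by (simp add: dg_herm0_iff)
  have "inner z (dpart (h A)) = inner (h (dg z)) (h A)" by (simp add: h_fix[OF z] inner_dg)
  also have "\<dots> = inner z (dpart A)" using comm_isometry_inner[OF h zh A] by (simp add: inner_dg)
  finally have "inner z z = 0" by (simp add: z_def inner_diff_right)
  then show ?thesis by (simp add: z_def)
qed

text \<open>The map that \<open>h\<close> induces on the plane of the entry \<open>(i, j)\<close>,
  in the coordinate \<open>z\<close>; \<open>h_pl\<close> shows that \<open>h\<close> preserves this
  plane.\<close>

private definition kap :: "'n \<Rightarrow> 'n \<Rightarrow> complex \<Rightarrow> complex" where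
  "kap i j z = h (pl i j z) $ i $ j"

private lemma h_pl:
  assumes ij: "i \<noteq> j"
  shows "h (pl i j z) = pl i j (kap i j z)"
proof -
  let ?B = "pl i j z"
  let ?W = "h ?B"
  have B: "?B \<in> herm0" using pl_herm0[OF ij] .
  have W: "?W \<in> herm0" using comm_isometryD(1)[OF h B] .
  have diag: "?W$a$a = 0" for a
  proof -
    have "Re (?W$a$a) = 0" using h_dpart[OF B] dpart_pl[OF ij, of z] by (simp add: vec_eq_iff)
    moreover have "Im (?W$a$a) = 0" using arg_cong[OF herm0_nth[OF W, of a a], of Im] by simp
    ultimately show ?thesis by (simp add: complex_eq_iff)
  qed
  have off: "?W$a$b = 0" if ab: "a \<noteq> b" "a \<noteq> i" "a \<noteq> j" for a b
  proof -
    \<comment> \<open>This vector is equal at \<open>i\<close> and \<open>j\<close>, so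
      \<open>dg x\<close> commutes with the plane, and its entry 2 at \<open>a\<close> differs from
      all its other entries, which isolates row \<open>a\<close>.\<close>
    define x where "x = root_vec a i + root_vec a j"
    have x: "x \<in> sum0" unfolding x_def by (intro subspace_add[OF subspace_sum0] root_vec_sum0)
    have xij: "x$i = x$j" "x$a \<noteq> x$b" using ij ab by (auto simp: x_def root_vec_nth)
    have "dg x ** ?B = ?B ** dg x" using xij(1) by (rule dg_comm_pl)
    then have "h (dg x) ** ?W = ?W ** h (dg x)"
      using comm_isometry_comm[OF h _ B, of "dg x"] x by (simp add: dg_herm0_iff)
    then have "dg x ** ?W = ?W ** dg x" by (simp add: h_fix[OF x])
    then show ?thesis using xij(2) unfolding dg_comm_iff by blast
  qed
  have off': "?W$a$b = 0" if "a \<noteq> b" "b \<noteq> i" "b \<noteq> j" for a b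
    using off[of b a] that herm0_nth[OF W, of a b] by simp
  have ji: "?W$j$i = cnj (kap i j z)" using herm0_nth[OF W, of j i] by (simp add: kap_def)
  have "?W$a$b = pl i j (kap i j z) $ a $ b" for a b
  proof (cases "a = b")
    case True
    then show ?thesis using diag ij by (auto simp: pl_def)
  next
    case False
    show ?thesis
    proof (cases "(a = i \<and> b = j) \<or> (a = j \<and> b = i)")
      case True
      then show ?thesis using ij ji by (auto simp: pl_def kap_def)
    next
      case notij: False
      then have "?W$a$b = 0" using off[OF False] off'[OF False] False by blast
      then show ?thesis using notij by (auto simp: pl_def)
    qed
  qed
  then show ?thesis by (simp add: vec_eq_iff)
qed

private lemma kap_add: "i \<noteq> j \<Longrightarrow> kap i j (z + w) = kap i j z + kap i j w"
  by (simp add: kap_def pl_add comm_isometryD(2)[OF h] pl_herm0)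

private lemma kap_scale:
  assumes "i \<noteq> j"
  shows "kap i j (of_real t * z) = of_real t * kap i j z"
  unfolding kap_def pl_scale comm_isometryD(3)[OF h pl_herm0[OF assms]] vector_scaleR_component
  by (rule scaleR_conv_of_real)

private lemma kap_swap: "i \<noteq> j \<Longrightarrow> kap j i (cnj z) = cnj (kap i j z)"
  using herm0_nth[OF comm_isometryD(1)[OF h pl_herm0[of i j z]], of j i] by (simp add: kap_def pl_swap)

text \<open>Orthogonality against the planes determines each off-diagonal entry of
  \<open>h A\<close>, so \<open>A\<close> need not be expanded in a basis.\<close>

private lemma kap_entry:
  assumes A: "A \<in> herm0" and ij: "i \<noteq> j"
  shows "Re (cnj (h A $ i $ j) * kap i j z) = Re (cnj (A$i$j) * z)"
  using comm_isometry_inner[OF h A pl_herm0[OF ij], of z] A comm_isometryD(1)[OF h A]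
  by (simp add: h_pl[OF ij] inner_pl hermitian)

private lemma cmod_kap:
  assumes ij: "i \<noteq> j"
  shows "cmod (kap i j z) = cmod z"
proof -
  have "pl i j z $ i $ j = z" using ij by (simp add: pl_def)
  then have "Re (cnj (kap i j z) * kap i j z) = Re (cnj z * z)"
    using kap_entry[OF pl_herm0[OF ij, of z] ij, of z] by (simp only: kap_def[symmetric])
  then have "(cmod (kap i j z))\<^sup>2 = (cmod z)\<^sup>2"
    unfolding cmod_power2 by (simp add: power2_eq_square)
  then show ?thesis by (simp add: power2_eq_iff_nonneg)
qed

text \<open>If \<open>|r| = 1\<close> and \<open>q = p r\<close>, then with \<open>v = (p r, r, 1)\<close> and \<open>w = (p, -1, 0)\<close> in the coordinates \<open>i, j, l\<close>, the
  matrices \<open>A\<close> and \<open>B\<close> below are \<open>v v\<^sup>*\<close> and \<open>w w\<^sup>*\<close> up to diagonal terms; they commute since \<open>w\<close> and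
  \<open>v\<close> are orthogonal.\<close>

private lemma commuting_triangle:
  fixes x :: "real^'n"
  assumes d: "i \<noteq> j" "j \<noteq> l" "i \<noteq> l" and p: "cmod p = 1"
    and x: "\<And>a. x$a = (if a = i \<or> a = j then 1 + c else c)"
  shows "(pl i j p + pl i l q + pl j l r) ** (dg x - pl i j p)
       = (dg x - pl i j p) ** (pl i j p + pl i l q + pl j l r) \<longleftrightarrow> q = p * r"
    (is "?A ** ?B = ?B ** ?A \<longleftrightarrow> _")
proof -
  define A where "A = pl i j p + pl i l q + pl j l r"
  define B where "B = dg x - pl i j p"
  have pp: "p * cnj p = 1" using p by (metis complex_norm_square of_real_1 one_power2)
  have entry: "(A ** B)$a$b - (B ** A)$a$b = A$a$b * (of_real (x$b) - of_real (x$a))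
      - (if b = j then A$a$i * p else 0) - (if b = i then A$a$j * cnj p else 0)
      + (if a = i then p * A$j$b else 0) + (if a = j then cnj p * A$i$b else 0)" for a b
    unfolding B_def matrix_mult_diff_left matrix_mult_diff_right vector_minus_component
      dg_mult_nth pl_mult_nth by (simp only: algebra_simps)
  have A: "A$i$j = p" "A$j$i = cnj p" "A$i$l = q" "A$l$i = cnj q" "A$j$l = r" "A$l$j = cnj r"
    "\<And>a. A$a$a = 0" "\<And>a b. a \<noteq> i \<Longrightarrow> a \<noteq> j \<Longrightarrow> a \<noteq> l \<Longrightarrow> A$a$b = 0"
    "\<And>a b. b \<noteq> i \<Longrightarrow> b \<noteq> j \<Longrightarrow> b \<noteq> l \<Longrightarrow> A$a$b = 0"
    using d by (auto simp: A_def pl_def)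
  \<comment> \<open>This single entry carries the condition. The shift \<open>c\<close> adds a
    multiple of the identity to \<open>B\<close> and drops out.\<close>
  have "(A ** B)$i$l - (B ** A)$i$l = p * r - q"
    unfolding entry using d by (simp add: A x)
  then have "A ** B = B ** A \<Longrightarrow> q = p * r" by simp
  moreover have "(A ** B)$a$b = (B ** A)$a$b" if q: "q = p * r" for a b
  proof -
    have "(A ** B)$a$b - (B ** A)$a$b = 0"
    proof -
      consider "a = i" | "a = j" | "a = l" | "a \<noteq> i" "a \<noteq> j" "a \<noteq> l" by blast
      note ca = this
      consider "b = i" | "b = j" | "b = l" | "b \<noteq> i" "b \<noteq> j" "b \<noteq> l" by blast
      then show ?thesis
        unfolding entry
        by (cases rule: ca; cases; use d pp in \<open>simp add: A x q mult_ac\<close>)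
    qed
    then show ?thesis by simp
  qed
  then have "q = p * r \<Longrightarrow> A ** B = B ** A" by (simp add: vec_eq_iff)
  ultimately show ?thesis unfolding A_def B_def by blast
qed

text \<open>Since \<open>h\<close> acts by \<open>kap\<close> on each plane and fixes
  \<open>dg x\<close>, it sends one commuting pair of \<open>commuting_triangle\<close> to a pair of
  the same shape; that the images commute is the asserted relation.\<close>

private lemma kap_mult:
  assumes d: "i \<noteq> j" "j \<noteq> l" "i \<noteq> l" and p: "cmod p = 1"
  shows "kap i l (p * r) = kap i j p * kap j l r"
proof -
  \<comment> \<open>The value that makes the trace \<open>2 + n * c\<close> of \<open>dg x\<close>
    vanish.\<close>
  define c :: real where "c = - 2 / CARD('n)"
  define x :: "real^'n" where "x = (\<chi> a. c + (if a = i then 1 else 0) + (if a = j then 1 else 0))"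
  have x0: "x \<in> sum0" by (simp add: x_def sum0_def sum.distrib) (simp add: c_def)
  have xa: "x$a = (if a = i \<or> a = j then 1 + c else c)" for a using d by (auto simp: x_def)
  let ?A = "pl i j p + pl i l (p * r) + pl j l r"
  let ?B = "dg x - pl i j p"
  have pls: "pl i j p \<in> herm0" "pl i l (p * r) \<in> herm0" "pl j l r \<in> herm0" "dg x \<in> herm0"
    using d pl_herm0 x0 by (auto simp: dg_herm0_iff)
  have AB: "?A \<in> herm0" "?B \<in> herm0"
    using pls by (auto intro!: herm0_closed(1) subspace_diff[OF subspace_herm0])
  have hA: "h ?A = pl i j (kap i j p) + pl i l (kap i l (p * r)) + pl j l (kap j l r)"
    using pls d by (simp add: comm_isometryD(2)[OF h] herm0_closed(1) h_pl)
  have "h (dg x + (- 1) *\<^sub>R pl i j p) = dg x + (- 1) *\<^sub>R pl i j (kap i j p)"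
    using pls(1,4) d by (simp only: comm_isometryD(2,3)[OF h] herm0_closed(2) h_pl[OF d(1)] h_fix[OF x0])
  then have hB: "h ?B = dg x - pl i j (kap i j p)" by simp
  have "?A ** ?B = ?B ** ?A" using commuting_triangle[OF d p xa] by blast
  then have comm: "h ?A ** h ?B = h ?B ** h ?A" using comm_isometry_comm[OF h AB] by blast
  have "cmod (kap i j p) = 1" using cmod_kap[OF d(1)] p by simp
  from iffD1[OF commuting_triangle[OF d this xa] comm[unfolded hA hB]] show ?thesis .
qed

private lemma third_index: "\<exists>m. m \<noteq> i \<and> m \<noteq> (k :: 'n)"
proof (rule ccontr)
  assume "\<not> ?thesis"
  then have "UNIV \<subseteq> {i, k}" by auto
  then have "CARD('n) \<le> card {i, k}" by (intro card_mono) auto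
  also have "\<dots> \<le> 2" by (simp add: card_insert_if)
  finally show False using card by simp
qed

text \<open>\<open>kap_mult\<close> makes the values \<open>c i j = kap i j 1\<close> a
  multiplicative cocycle, hence of the form \<open>u i * cnj (u j)\<close>, which is conjugation by
  a diagonal unitary. It also makes the ratio \<open>e i j\<close> of \<open>kap i j \<i>\<close> to
  \<open>c i j\<close> independent of the indices, with square -1: \<open>\<i>\<close> means no
  transposition, \<open>- \<i>\<close> means transposition.\<close>

lemma fix_diagonal_classification:
  "\<exists>U. unitary_matrix U \<and> ((\<forall>A\<in>herm0. h A = Ad U A) \<or> (\<forall>A\<in>herm0. h A = Ad U (transpose A)))"
proof -
  define c where "c i j = kap i j 1" for i j
  define e where "e i j = kap i j \<i> * cnj (c i j)" for i j
  have cc: "c i j * cnj (c i j) = 1" "cnj (c i j) * c i j = 1" if "i \<noteq> j" for i j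
    using cmod_kap[OF that, of 1] by (metis c_def complex_norm_square mult.commute of_real_1 one_power2 norm_one)+
  have ke: "kap i j \<i> = e i j * c i j" if "i \<noteq> j" for i j
    using cc[OF that] by (simp add: e_def mult.assoc)
  have cm: "c i l = c i j * c j l" if "i \<noteq> j" "j \<noteq> l" "i \<noteq> l" for i j l
    using kap_mult[OF that, of 1 1] by (simp add: c_def)
  have cnz: "c i j \<noteq> 0" if "i \<noteq> j" for i j using cc[OF that] by auto
  have row: "e i l = e i j" if d: "i \<noteq> j" "j \<noteq> l" "i \<noteq> l" for i j l
  proof -
    have "e i l * c i l = e i j * c i j * c j l"
      using kap_mult[OF d, of \<i> 1] ke[OF d(3)] ke[OF d(1)] by (simp add: c_def)
    then have "e i l * c i l = e i j * c i l" by (simp add: cm[OF d])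
    then show ?thesis using cnz[OF d(3)] by simp
  qed
  have col: "e i l = e j l" if d: "i \<noteq> j" "j \<noteq> l" "i \<noteq> l" for i j l
  proof -
    have "e i l * c i l = c i j * (e j l * c j l)"
      using kap_mult[OF d, of 1 \<i>] ke[OF d(3)] ke[OF d(2)] by (simp add: c_def)
    then have "e i l * c i l = e j l * c i l" by (simp add: cm[OF d] mult_ac)
    then show ?thesis using cnz[OF d(3)] by simp
  qed
  have const: "e i j = e i' j'" if "i \<noteq> j" "i' \<noteq> j'" for i j i' j'
  proof -
    obtain m where m: "m \<noteq> i" "m \<noteq> i'" using third_index by blast
    have "e i j = e i m" using row[of i m j] that m by (cases "j = m") auto
    moreover have "e i m = e i' m" using col[of i i' m] m by (cases "i = i'") auto
    moreover have "e i' m = e i' j'" using row[of i' m j'] that m by (cases "j' = m") auto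
    ultimately show ?thesis by simp
  qed
  fix i0 :: 'n
  obtain j0 where j0: "j0 \<noteq> i0" using third_index by blast
  obtain l0 where l0: "l0 \<noteq> i0" "l0 \<noteq> j0" using third_index by blast
  define e0 where "e0 = e i0 j0"
  have e0: "e i j = e0" if "i \<noteq> j" for i j using const[OF that, of i0 j0] j0 by (simp add: e0_def)
  \<comment> \<open>Evaluates \<open>kap\<close> at \<open>\<i> * \<i>\<close> through the
    intermediate index \<open>j0\<close>.\<close>
  have "e0 * e0 = - 1"
  proof -
    have "kap i0 l0 (\<i> * \<i>) = kap i0 j0 \<i> * kap j0 l0 \<i>" using j0 l0 by (intro kap_mult) auto
    then have "- c i0 l0 = e0 * c i0 j0 * (e0 * c j0 l0)"
      using kap_scale[of i0 l0 "- 1" 1] j0 l0 ke[of i0 j0] ke[of j0 l0] e0 by (simp add: c_def)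
    also have "\<dots> = e0 * e0 * c i0 l0" using cm[of i0 j0 l0] j0 l0 by simp
    finally have eq: "e0 * e0 * c i0 l0 = - c i0 l0" by simp
    have "(e0 * e0 + 1) * c i0 l0 = e0 * e0 * c i0 l0 + c i0 l0" by (simp add: distrib_right)
    then have "(e0 * e0 + 1) * c i0 l0 = 0" by (simp only: eq add.left_inverse)
    then show ?thesis using cnz[of i0 l0] l0 by (simp add: eq_neg_iff_add_eq_0)
  qed
  then have e_cases: "e0 = \<i> \<or> e0 = - \<i>"
    by (metis i_squared square_eq_iff)
  have kap: "kap i j z = c i j * (of_real (Re z) + e0 * of_real (Im z))" if ij: "i \<noteq> j" for i j z
  proof -
    have "z = of_real (Re z) * 1 + of_real (Im z) * \<i>" by (simp add: complex_eq_iff)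
    then have "kap i j z = kap i j (of_real (Re z) * 1 + of_real (Im z) * \<i>)"
      by (rule arg_cong)
    also have "\<dots> = of_real (Re z) * c i j + of_real (Im z) * (e0 * c i j)"
      unfolding kap_add[OF ij] kap_scale[OF ij] using ke[OF ij] e0[OF ij] by (simp add: c_def)
    finally show ?thesis by (simp add: algebra_simps)
  qed
  \<comment> \<open>The potential of the cocycle \<open>c\<close>, normalized to 1 at
    \<open>i0\<close>.\<close>
  define u where "u i = (if i = i0 then 1 else c i i0)" for i
  have uu: "u i * cnj (u i) = 1" for i using cc[of i i0] by (simp add: u_def)
  have cu: "c i j = u i * cnj (u j)" if ij: "i \<noteq> j" for i j
    using cm[of i i0 j] ij kap_swap[of j i0 1] kap_swap[of i0 j 1] by (auto simp: u_def c_def)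
  define U :: "complex^'n^'n" where "U = (\<chi> i j. if i = j then u i else 0)"
  have Um: "(U ** A)$i$j = u i * A$i$j" "(A ** conj_transpose U)$i$j = A$i$j * cnj (u j)" for A i j
    by (simp_all add: matrix_matrix_mult_def U_def if_distrib[of cnj] mult_delta_left mult_delta_right cong: if_cong)
  have "U ** conj_transpose U = mat 1"
    by (simp add: vec_eq_iff Um mat_def) (auto simp: U_def uu)
  then have U: "unitary_matrix U" by (rule unitary_matrixI)
  have AdU: "Ad U A $ i $ j = u i * A$i$j * cnj (u j)" for A i j by (simp add: Ad_def Um)
  have diag: "h A $ i $ i = A$i$i" "u i * A$i$i * cnj (u i) = A$i$i" if A: "A \<in> herm0" for A i
  proof -
    have "Re (h A $ i $ i) = Re (A$i$i)" using h_dpart[OF A] by (simp add: vec_eq_iff)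
    moreover have "Im (B$i$i) = 0" if "B \<in> herm0" for B
      using arg_cong[OF herm0_nth[OF that, of i i], of Im] by simp
    ultimately show "h A $ i $ i = A$i$i" using A comm_isometryD(1)[OF h A] by (simp add: complex_eq_iff)
    show "u i * A$i$i * cnj (u i) = A$i$i" using uu[of i] by (simp add: mult_ac)
  qed
  have Re_eq: "x * cnj y = a" if "\<And>z. Re (cnj x * (y * z)) = Re (cnj a * z)" for x y a
    using that[of 1] that[of \<i>] by (simp add: complex_eq_iff) 
  have off: "h A $ i $ j * cnj (c i j) = (if e0 = \<i> then A$i$j else cnj (A$i$j))"
    if A: "A \<in> herm0" and ij: "i \<noteq> j" for A i j
  proof (rule Re_eq)
    fix z
    show "Re (cnj (h A $ i $ j) * (c i j * z)) = Re (cnj (if e0 = \<i> then A$i$j else cnj (A$i$j)) * z)"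
    proof (cases "e0 = \<i>")
      case True
      then have "kap i j z = c i j * z" using kap[OF ij, of z] by (simp add: complex_eq[symmetric])
      then show ?thesis using kap_entry[OF A ij, of z] True by simp
    next
      case False
      then have "e0 = - \<i>" using e_cases by blast
      then have "kap i j (cnj z) = c i j * z"
        using kap[OF ij, of "cnj z"] by (simp add: complex_eq[symmetric])
      then show ?thesis using kap_entry[OF A ij, of "cnj z"] False by simp
    qed
  qed
  have off': "h A $ i $ j = (if e0 = \<i> then A$i$j else cnj (A$i$j)) * c i j"
    if A: "A \<in> herm0" and ij: "i \<noteq> j" for A i j
    unfolding off[OF that, symmetric] using cc[OF ij] by (simp add: mult.assoc)
  show ?thesis
  proof (cases "e0 = \<i>")
    case True
    have "h A = Ad U A" if A: "A \<in> herm0" for A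
    proof -
      have "h A $ i $ j = Ad U A $ i $ j" for i j
        using diag[OF A] off'[OF A] cu True by (cases "i = j") (simp_all add: AdU mult_ac)
      then show ?thesis by (simp add: vec_eq_iff)
    qed
    with U show ?thesis by blast
  next
    case False
    have "h A = Ad U (transpose A)" if A: "A \<in> herm0" for A
    proof -
      have "h A $ i $ j = Ad U (transpose A) $ i $ j" for i j
      proof (cases "i = j")
        case False
        have "A$j$i = cnj (A$i$j)" using herm0_nth[OF A] .
        then show ?thesis
          using off'[OF A False] cu[OF False] \<open>e0 \<noteq> \<i>\<close> by (simp add: AdU transpose_def mult_ac)
      qed (use diag[OF A] in \<open>simp add: AdU transpose_def\<close>)
      then show ?thesis by (simp add: vec_eq_iff)
    qed
    with U show ?thesis by blast
  qed
qed

end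

lemma comm_isometry_classification:
  fixes f :: "complex^'n^'n \<Rightarrow> complex^'n^'n"
  assumes "CARD('n) \<ge> 3" and f: "comm_isometry f"
  shows "\<exists>U s. unitary_matrix U \<and> \<bar>s\<bar> = (1::real) \<and>
    ((\<forall>A\<in>herm0. f A = s *\<^sub>R Ad U A) \<or> (\<forall>A\<in>herm0. f A = s *\<^sub>R Ad U (transpose A)))"
proof -
  obtain U s h where U: "unitary_matrix U" "\<bar>s\<bar> = (1::real)" and h: "comm_isometry h" "\<forall>x\<in>sum0. h (dg x) = dg x"
    and fh: "\<forall>A. f A = s *\<^sub>R Ad U (h A)"
    using comm_isometry_fix_diagonal[OF f] by (elim exE conjE) (rule that)
  obtain V where V: "unitary_matrix V"
    "(\<forall>A\<in>herm0. h A = Ad V A) \<or> (\<forall>A\<in>herm0. h A = Ad V (transpose A))"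
    using fix_diagonal_classification[OF h(1) h(2)[rule_format] assms(1)] by blast
  have "(\<forall>A\<in>herm0. f A = s *\<^sub>R Ad (U ** V) A) \<or> (\<forall>A\<in>herm0. f A = s *\<^sub>R Ad (U ** V) (transpose A))"
    using V(2) fh by (auto simp: Ad_Ad)
  then show ?thesis using unitary_mult[OF U(1) V(1)] U(2) by blast
qed

subsection \<open>The two cases\<close>

text \<open>Elements of \<open>orthogonal_herm0\<close> are only assumed to map \<open>herm0\<close>
  into itself; injectivity from the norm and finite dimension give surjectivity.\<close>

lemma real_linear_on_bij:
  fixes f :: "complex^'n^'n \<Rightarrow> complex^'n^'n"
  assumes lin: "real_linear_on herm0 f" and f: "f \<in> herm0 \<rightarrow> herm0"
    and norm: "\<And>A. A \<in> herm0 \<Longrightarrow> norm (f A) = norm A"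
  shows "bij_betw f herm0 herm0"
proof -
  obtain P :: "complex^'n^'n \<Rightarrow> complex^'n^'n"
    where P: "linear P" "\<And>x. P x \<in> herm0" "\<And>x. x \<in> herm0 \<Longrightarrow> P x = x"
    using orthogonal_projection_exists[OF subspace_herm0] by metis
  have add: "f (A + B) = f A + f B" if "A \<in> herm0" "B \<in> herm0" for A B
    using lin that by (auto simp: real_linear_on_def)
  have scale: "f (c *\<^sub>R A) = c *\<^sub>R f A" if "A \<in> herm0" for A c
    using lin that by (auto simp: real_linear_on_def)
  have F: "linear (\<lambda>A. f (P A))"
    by (rule linearI) (simp_all add: linear_add[OF P(1)] linear_scale[OF P(1)] P add scale)
  have inj: "inj_on f herm0"
  proof (rule inj_onI)
    fix A B assume AB: "A \<in> herm0" "B \<in> herm0" "f A = f B"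
    have "f (A + (- 1) *\<^sub>R B) = f A + (- 1) *\<^sub>R f B"
      by (simp only: add[OF AB(1) herm0_closed(2)[OF AB(2)]] scale[OF AB(2)])
    then have "f (A + (- 1) *\<^sub>R B) = 0" using AB(3) by simp
    then have "norm (A + (- 1) *\<^sub>R B) = 0"
      using norm[OF herm0_closed(1)[OF AB(1) herm0_closed(2)[OF AB(2), of "- 1"]]] by simp
    then show "A = B" by simp
  qed
  have img: "(\<lambda>A. f (P A)) ` herm0 = f ` herm0" by (rule image_cong) (simp_all add: P(3))
  have "inj_on (\<lambda>A. f (P A)) herm0" using inj by (simp add: inj_on_def P(3))
  then have "dim (f ` herm0) = dim (herm0 :: (complex^'n^'n) set)"
    using dim_image_eq[OF F, of herm0] by (simp add: img span_eq_iff[THEN iffD2, OF subspace_herm0])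
  moreover have "subspace (f ` herm0)" using linear_subspace_image[OF F subspace_herm0] by (simp add: img)
  moreover have "f ` herm0 \<subseteq> herm0" using f by auto
  ultimately have "f ` herm0 = herm0" using subspace_dim_equal subspace_herm0 by (metis order_refl)
  with inj show ?thesis by (simp add: bij_betw_def)
qed

text \<open>Isometries are orthogonal by \<open>isometry_inner\<close>; constancy of
  \<open>N\<close> on Frobenius spheres enters in the reverse inclusion.\<close>

lemma euclidean_isometry_group:
  fixes N :: "complex^'n^'n \<Rightarrow> real"
  assumes N: "norm_on herm0 N" "unitary_similarity_invariant N"
    and euclid: "\<And>X Y. X \<in> herm0 \<Longrightarrow> Y \<in> herm0 \<Longrightarrow> norm X = norm Y \<Longrightarrow> N X = N Y"
  shows "isometry_group N = orthogonal_herm0"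
proof (intro equalityI subsetI)
  fix f assume "f \<in> isometry_group N"
  then have f: "f \<in> extensional herm0" "isometry N f" by (simp_all add: isometry_group_iff)
  have "trace (f A ** f B) = trace (A ** B)" if "A \<in> herm0" "B \<in> herm0" for A B
    using that isometryD(1)[OF f(2)] isometry_inner[OF N f(2) that] by (simp add: herm0_trace_real)
  then show "f \<in> orthogonal_herm0"
    using f isometryD(1)[OF f(2)] by (simp add: orthogonal_herm0_def isometry_def)
next
  fix f :: "complex^'n^'n \<Rightarrow> complex^'n^'n" assume "f \<in> orthogonal_herm0"
  then have f: "f \<in> extensional herm0" "f \<in> herm0 \<rightarrow> herm0" "real_linear_on herm0 f"
    "\<And>A B. A \<in> herm0 \<Longrightarrow> B \<in> herm0 \<Longrightarrow> trace (f A ** f B) = trace (A ** B)"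
    by (auto simp: orthogonal_herm0_def)
  have fin: "f A \<in> herm0" if "A \<in> herm0" for A using f(2) that by blast
  have nf: "norm (f A) = norm A" if A: "A \<in> herm0" for A
  proof -
    have "complex_of_real (inner (f A) (f A)) = complex_of_real (inner A A)"
      using f(4)[OF A A] by (simp only: herm0_trace_real[OF A A] herm0_trace_real[OF fin[OF A] fin[OF A]])
    then show ?thesis by (simp add: norm_eq_sqrt_inner)
  qed
  have "isometry N f"
    using real_linear_on_bij[OF f(3,2) nf] f(3) euclid[OF fin _ nf] by (simp add: isometry_def)
  then show "f \<in> isometry_group N" using f(1) by (simp add: isometry_group_iff)
qed

text \<open>\<open>noncommuting_imp_euclidean\<close> in contrapositive form, applied to
  \<open>f\<close> and to its inverse for the two directions of the equivalence.\<close>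

lemma isometry_imp_comm_isometry:
  fixes N :: "complex^'n^'n \<Rightarrow> real"
  assumes N: "norm_on herm0 N" "unitary_similarity_invariant N" and f: "isometry N f"
    and ne: "\<not> (\<forall>X\<in>herm0. \<forall>Y\<in>herm0. norm X = norm Y \<longrightarrow> N X = N Y)"
  shows "comm_isometry f"
proof -
  have fwd: "g A ** g B = g B ** g A" if "isometry N g" "A \<in> herm0" "B \<in> herm0" "A ** B = B ** A" for g A B
    using noncommuting_imp_euclidean[OF N that] ne by blast
  obtain g where g: "isometry N g" "\<And>A. A \<in> herm0 \<Longrightarrow> g (f A) = A"
    using isometry_inverse[OF f] by metis
  have "f A ** f B = f B ** f A \<longleftrightarrow> A ** B = B ** A" if "A \<in> herm0" "B \<in> herm0" for A B
    using fwd[OF f that] fwd[OF g(1), of "f A" "f B"] isometryD(1)[OF f] that g(2) by metis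
  moreover have "isometry norm f"
    using f isometry_norm[OF N f] by (simp add: isometry_def)
  ultimately show ?thesis by (simp add: comm_isometry_def)
qed

subsection \<open>The semidirect product\<close>

text \<open>With \<open>conj_transpose_map\<close>, a normal form for the elements of the semidirect
  product: \<open>s = 1\<close> here gives \<open>PSU\<close>, and \<open>U = mat 1\<close> in both
  gives the group of signs and transposition.\<close>

definition conj_map :: "complex^'n^'n \<Rightarrow> real \<Rightarrow> complex^'n^'n \<Rightarrow> complex^'n^'n" where
  "conj_map U s = (\<lambda>A\<in>herm0. s *\<^sub>R Ad U A)"

definition conj_transpose_map :: "complex^'n^'n \<Rightarrow> real \<Rightarrow> complex^'n^'n \<Rightarrow> complex^'n^'n" where
  "conj_transpose_map U s = (\<lambda>A\<in>herm0. s *\<^sub>R Ad U (transpose A))"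

lemma transpose_Ad: "transpose (Ad U A) = Ad (map_matrix cnj U) (transpose A)"
proof -
  have "conj_transpose (map_matrix cnj U) = transpose U" "transpose (conj_transpose U) = map_matrix cnj U"
    by (simp_all add: vec_eq_iff transpose_def map_matrix_def)
  then show ?thesis by (simp add: Ad_def matrix_transpose_mul matrix_mul_assoc)
qed

lemma unitary_cnj:
  assumes "unitary_matrix U"
  shows "unitary_matrix (map_matrix cnj U)"
proof (rule unitary_matrixI)
  have "conj_transpose (map_matrix cnj U) = transpose U" "map_matrix cnj U = transpose (conj_transpose U)"
    by (simp_all add: vec_eq_iff transpose_def map_matrix_def)
  then have "map_matrix cnj U ** conj_transpose (map_matrix cnj U) = transpose (U ** conj_transpose U)"
    by (simp only: matrix_transpose_mul[symmetric])
  then show "map_matrix cnj U ** conj_transpose (map_matrix cnj U) = mat 1"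
    using assms by (simp add: unitary_matrix_def transpose_mat)
qed

lemma transpose_dg [simp]: "transpose (dg x) = dg x"
  by (simp add: vec_eq_iff transpose_def dg_nth)

text \<open>A matrix and its transpose are unitarily similar to the same diagonal matrix, through
  \<open>U\<close> and its entrywise conjugate.\<close>

lemma isometry_transpose:
  fixes N :: "complex^'n^'n \<Rightarrow> real"
  assumes N: "unitary_similarity_invariant N"
  shows "isometry N transpose"
proof -
  have "bij_betw transpose herm0 (herm0 :: (complex^'n^'n) set)"
    by (rule bij_betw_byWitness[where f' = transpose]) (auto simp: herm0_closed)
  moreover have "N (transpose A) = N A" if A: "A \<in> herm0" for A
  proof -
    obtain U x where U: "unitary_matrix U" "x \<in> sum0" "A = Ad U (dg x)" using diagonalize[OF A] .
    then show ?thesis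
      using unitary_norm_Ad[OF N, of _ "dg x"] unitary_cnj[OF U(1)] by (simp add: transpose_Ad dg_herm0_iff)
  qed
  ultimately show ?thesis
    by (simp add: isometry_def real_linear_on_def transpose_add transpose_scaleR_complex)
qed

lemma isometry_sign:
  assumes "norm_on herm0 N" "\<bar>s\<bar> = 1"
  shows "isometry N (\<lambda>A. s *\<^sub>R A)"
  using comm_isometry_isometry[OF comm_isometry_sign[OF assms(2)]] assms
  by (simp add: isometry_def norm_on_def)

lemma isometry_cong: "isometry N f \<Longrightarrow> (\<And>A. A \<in> herm0 \<Longrightarrow> g A = f A) \<Longrightarrow> isometry N g"
  unfolding isometry_def real_linear_on_def
  by (auto simp: herm0_closed cong: bij_betw_cong)

lemma restrict_isometry_group: "isometry N f \<Longrightarrow> restrict f herm0 \<in> isometry_group N"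
  using isometry_cong[of N f "restrict f herm0"] by (simp add: isometry_group_iff)

lemma conj_map_isometry_group:
  assumes "norm_on herm0 N" "unitary_similarity_invariant N" "unitary_matrix U" "\<bar>s\<bar> = 1"
  shows "conj_map U s \<in> isometry_group N" "conj_transpose_map U s \<in> isometry_group N"
  unfolding conj_map_def conj_transpose_map_def
  using isometry_compose[OF isometry_sign[OF assms(1,4)] isometry_Ad[OF assms(2,3)]]
    isometry_compose[OF isometry_sign[OF assms(1,4)]
      isometry_compose[OF isometry_Ad[OF assms(2,3)] isometry_transpose[OF assms(2)]]]
  by (auto intro: restrict_isometry_group)

lemma GL_mult: "f \<in> carrier GL_herm0 \<Longrightarrow> g \<in> carrier GL_herm0 \<Longrightarrow> f \<otimes>\<^bsub>GL_herm0\<^esub> g = compose herm0 f g"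
  by (simp add: GL_herm0_def BijGroup_def)

lemma GL_one: "\<one>\<^bsub>GL_herm0\<^esub> = conj_map (mat 1) 1"
  by (simp add: GL_herm0_def BijGroup_def conj_map_def)

lemma isometry_group_carrier: "f \<in> isometry_group N \<Longrightarrow> f \<in> carrier GL_herm0"
  by (simp add: isometry_group_def)

lemma subgroup_isometry_group: "subgroup (isometry_group N) GL_herm0"
proof (rule group.subgroupI[OF group_GL_herm0])
  have "isometry N (\<lambda>A. A)" by (simp add: isometry_def real_linear_on_def bij_betw_def)
  then show "isometry_group N \<noteq> {}" using restrict_isometry_group by blast
next
  fix f assume f: "f \<in> isometry_group N"
  then obtain g where g: "isometry N g" "\<And>A. A \<in> herm0 \<Longrightarrow> g (f A) = A"
    using isometry_inverse isometry_group_iff by metis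
  have g': "restrict g herm0 \<in> isometry_group N" using g(1) by (rule restrict_isometry_group)
  have "restrict g herm0 \<otimes>\<^bsub>GL_herm0\<^esub> f = compose herm0 (restrict g herm0) f"
    using f g' by (intro GL_mult isometry_group_carrier)
  also have "\<dots> = \<one>\<^bsub>GL_herm0\<^esub>"
    using f g(2) isometryD(1)[of N f] by (auto simp: GL_one conj_map_def compose_def isometry_group_iff)
  finally have "inv\<^bsub>GL_herm0\<^esub> f = restrict g herm0"
    using f g' by (intro group.inv_equality[OF group_GL_herm0] isometry_group_carrier)
  then show "inv\<^bsub>GL_herm0\<^esub> f \<in> isometry_group N" using g' by simp
next
  fix f g assume fg: "f \<in> isometry_group N" "g \<in> isometry_group N"
  then have "isometry N (\<lambda>A. f (g A))" using isometry_compose isometry_group_iff by blast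
  then have "compose herm0 f g \<in> isometry_group N"
    unfolding compose_def by (rule restrict_isometry_group)
  then show "f \<otimes>\<^bsub>GL_herm0\<^esub> g \<in> isometry_group N"
    using fg by (simp add: GL_mult isometry_group_carrier)
qed (auto simp: isometry_group_carrier)

lemma det_smat: "det (smat c A) = c ^ CARD('n) * det (A :: complex^'n^'n)"
proof -
  have "smat c A = (\<chi> i. c *s (A$i))" by (simp add: vec_eq_iff)
  then show ?thesis using det_rows_mul[of "\<lambda>_. c" "\<lambda>i. A$i"] by simp
qed

lemma det_conj_transpose: "det (conj_transpose A) = cnj (det (A :: complex^'n^'n))"
proof -
  have "conj_transpose A = transpose (map_matrix cnj A)"
    by (simp add: vec_eq_iff transpose_def map_matrix_def)
  then have "det (conj_transpose A) = det (map_matrix cnj A)" by (simp add: det_transpose)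
  also have "\<dots> = cnj (det A)" by (simp add: det_def map_matrix_def)
  finally show ?thesis .
qed

lemma special_unitary_representative:
  fixes U :: "complex^'n^'n"
  assumes U: "unitary_matrix U"
  obtains V where "unitary_matrix V" "det V = 1" "\<And>A. Ad V A = Ad U A"
proof -
  have "det U * cnj (det U) = 1"
    using U by (simp add: det_conj_transpose[symmetric] det_mul[symmetric] unitary_matrix_def det_I)
  then have dU: "cmod (det U) = 1"
    by (metis complex_norm_square norm_ge_zero of_real_1 of_real_eq_iff power2_eq_1_iff norm_minus_cancel norm_one abs_norm_cancel abs_minus_cancel)
  \<comment> \<open>Scaling by an n-th root of the inverse determinant normalizes the determinant;
    its modulus is one, so \<open>Ad\<close> does not change.\<close>
  obtain c where c: "inverse (det U) = c ^ CARD('n)"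
    using exists_complex_root[of "CARD('n)" "inverse (det U)"] by (metis zero_less_card_finite less_irrefl)
  have "cmod c ^ CARD('n) = 1" using c dU by (metis norm_power norm_inverse inverse_1)
  then have "cmod c = 1" by (metis norm_ge_zero power_eq_1_iff zero_less_card_finite less_irrefl real_norm_def abs_norm_cancel)
  then have cc: "c * cnj c = 1" by (metis complex_norm_square of_real_1 one_power2)
  have Ad: "Ad (smat c U) A = Ad U A" for A
    by (simp add: Ad_def conj_transpose_smat cc mult.commute[of "cnj c"])
  have "smat c U ** conj_transpose (smat c U) = mat 1"
    using Ad[of "mat 1"] U by (simp add: Ad_def unitary_matrix_def)
  then have "unitary_matrix (smat c U)" by (rule unitary_matrixI)
  moreover have "det (smat c U) = 1"
    using dU by (simp add: det_smat c[symmetric]) (metis left_inverse norm_zero zero_neq_one)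
  ultimately show thesis using that Ad by blast
qed

lemma PSU_eq: "PSU = {conj_map U 1 | U. unitary_matrix U}"
proof (intro equalityI subsetI)
  fix f :: "complex^'n^'n \<Rightarrow> complex^'n^'n" assume "f \<in> PSU"
  then show "f \<in> {conj_map U 1 | U. unitary_matrix U}"
    by (auto simp: PSU_def conj_map_def unitary_Ad)
next
  fix f :: "complex^'n^'n \<Rightarrow> complex^'n^'n" assume "f \<in> {conj_map U 1 | U. unitary_matrix U}"
  then obtain U :: "complex^'n^'n" where U: "unitary_matrix U" "f = conj_map U 1" by blast
  obtain V where V: "unitary_matrix V" "det V = 1" "\<And>A. Ad V A = Ad U A"
    using special_unitary_representative[OF U(1)] by metis
  have "f = (\<lambda>A\<in>herm0. V ** A ** matrix_inv V)"
    using V by (simp add: U(2) conj_map_def unitary_Ad)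
  then show "f \<in> PSU" using V unfolding PSU_def by blast
qed

lemma sign_cases: "\<bar>s\<bar> = (1::real) \<longleftrightarrow> s = 1 \<or> s = - 1"
  by auto

text \<open>Moving a transposition past \<open>Ad V\<close> replaces \<open>V\<close> by its
  entrywise conjugate, by \<open>transpose_Ad\<close>.\<close>

lemma conj_map_compose:
  assumes "unitary_matrix U" "unitary_matrix V"
  shows "compose herm0 (conj_map U s) (conj_map V t) = conj_map (U ** V) (s * t)"
    "compose herm0 (conj_map U s) (conj_transpose_map V t) = conj_transpose_map (U ** V) (s * t)"
    "compose herm0 (conj_transpose_map U s) (conj_map V t) = conj_transpose_map (U ** map_matrix cnj V) (s * t)"
    "compose herm0 (conj_transpose_map U s) (conj_transpose_map V t) = conj_map (U ** map_matrix cnj V) (s * t)"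
  using Ad_herm0[OF assms(2)]
  by (auto simp: compose_def conj_map_def conj_transpose_map_def herm0_closed linear_scale[OF linear_Ad]
      transpose_scaleR_complex transpose_Ad Ad_Ad fun_eq_iff)

lemmas conj_map_carrier = isometry_group_carrier[OF
    conj_map_isometry_group(1)[OF norm_on_norm unitary_similarity_invariant_norm]]
  isometry_group_carrier[OF conj_map_isometry_group(2)[OF norm_on_norm unitary_similarity_invariant_norm]]

lemmas GL_mult_conj = GL_mult[OF conj_map_carrier(1) conj_map_carrier(1)]
  GL_mult[OF conj_map_carrier(1) conj_map_carrier(2)] GL_mult[OF conj_map_carrier(2) conj_map_carrier(1)]
  GL_mult[OF conj_map_carrier(2) conj_map_carrier(2)]

lemma subgroup_PSU: "subgroup PSU (GL_herm0 :: (complex^'n^'n \<Rightarrow> complex^'n^'n) monoid)"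
proof (rule group.subgroupI[OF group_GL_herm0 PSU_subset_GL_herm0])
  show "(PSU :: (complex^'n^'n \<Rightarrow> complex^'n^'n) set) \<noteq> {}" using unitary_mat_1 by (auto simp: PSU_eq)
next
  fix f :: "complex^'n^'n \<Rightarrow> complex^'n^'n" assume "f \<in> PSU"
  then obtain U :: "complex^'n^'n" where U: "unitary_matrix U" "f = conj_map U 1" by (auto simp: PSU_eq)
  have U': "unitary_matrix (conj_transpose U)" using U(1) by (rule unitary_conj_transpose)
  have "conj_map (conj_transpose U) 1 \<otimes>\<^bsub>GL_herm0\<^esub> f = \<one>\<^bsub>GL_herm0\<^esub>"
    using U U' by (simp add: GL_mult_conj conj_map_compose GL_one) (simp add: unitary_matrix_def)
  then have "inv\<^bsub>GL_herm0\<^esub> f = conj_map (conj_transpose U) 1"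
    using U U' by (intro group.inv_equality[OF group_GL_herm0]) (auto intro: conj_map_carrier)
  then show "inv\<^bsub>GL_herm0\<^esub> f \<in> PSU" using U' by (auto simp: PSU_eq)
next
  fix f g :: "complex^'n^'n \<Rightarrow> complex^'n^'n" assume "f \<in> PSU" "g \<in> PSU"
  then obtain U V :: "complex^'n^'n" where "unitary_matrix U" "f = conj_map U 1" "unitary_matrix V" "g = conj_map V 1"
    by (auto simp: PSU_eq)
  then show "f \<otimes>\<^bsub>GL_herm0\<^esub> g \<in> PSU"
    using unitary_mult[of U V] by (auto simp: PSU_eq GL_mult_conj conj_map_compose)
qed

abbreviation sign_transpose_group :: "(complex^'n^'n \<Rightarrow> complex^'n^'n) set" where
  "sign_transpose_group \<equiv> generate GL_herm0 (Z2 \<union> {neg_transpose})"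

lemma Z2_eq: "Z2 = {conj_map (mat 1) 1, conj_map (mat 1) (- 1)}"
  by (simp add: Z2_def conj_map_def)

lemma neg_transpose_eq: "neg_transpose = conj_transpose_map (mat 1) (- 1)"
  by (simp add: neg_transpose_def conj_transpose_map_def)

lemma map_matrix_cnj_mat_1 [simp]: "map_matrix cnj (mat 1) = mat 1"
  by (simp add: vec_eq_iff map_matrix_def mat_def)

text \<open>Minus the identity and the negative transpose are commuting involutions, so signs with
  or without transposition exhaust the generated group.\<close>

lemma sign_transpose_group_eq:
  "sign_transpose_group = {f. \<exists>s. \<bar>s\<bar> = 1 \<and> (f = conj_map (mat 1) s \<or> f = conj_transpose_map (mat 1) s)}"
    (is "_ = ?H")
proof (intro equalityI)
  have neg: "\<bar>- 1 :: real\<bar> = 1" "\<bar>1 :: real\<bar> = 1" by simp_all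
  have "subgroup ?H GL_herm0"
  proof (rule group.subgroupI[OF group_GL_herm0])
    show "?H \<subseteq> carrier GL_herm0" using conj_map_carrier[OF unitary_mat_1] by auto
    show "?H \<noteq> {}" using neg by blast
  next
    fix f assume "f \<in> ?H"
    then obtain s where s: "\<bar>s\<bar> = 1" "f = conj_map (mat 1) s \<or> f = conj_transpose_map (mat 1) s" by blast
    have fc: "f \<in> carrier GL_herm0" using s conj_map_carrier[OF unitary_mat_1] by auto
    have "s * s = 1" using s(1) by (metis abs_mult_self_eq mult_1)
    then have "f \<otimes>\<^bsub>GL_herm0\<^esub> f = \<one>\<^bsub>GL_herm0\<^esub>"
      using s(2) by (auto simp: GL_mult_conj[OF unitary_mat_1 s(1) unitary_mat_1 s(1)]
          conj_map_compose[OF unitary_mat_1 unitary_mat_1] GL_one)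
    then have "inv\<^bsub>GL_herm0\<^esub> f = f" using fc by (intro group.inv_equality[OF group_GL_herm0])
    then show "inv\<^bsub>GL_herm0\<^esub> f \<in> ?H" using \<open>f \<in> ?H\<close> by (simp only:)
  next
    fix f g assume "f \<in> ?H" "g \<in> ?H"
    then obtain s t where s: "\<bar>s\<bar> = 1" "f = conj_map (mat 1) s \<or> f = conj_transpose_map (mat 1) s"
      and t: "\<bar>t\<bar> = 1" "g = conj_map (mat 1) t \<or> g = conj_transpose_map (mat 1) t" by blast
    have "\<bar>s * t\<bar> = 1" using s t by (simp add: abs_mult)
    moreover have "f \<otimes>\<^bsub>GL_herm0\<^esub> g = conj_map (mat 1) (s * t) \<or> f \<otimes>\<^bsub>GL_herm0\<^esub> g = conj_transpose_map (mat 1) (s * t)"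
      using s(2) t(2) by (auto simp: GL_mult_conj[OF unitary_mat_1 s(1) unitary_mat_1 t(1)]
          conj_map_compose[OF unitary_mat_1 unitary_mat_1])
    ultimately show "f \<otimes>\<^bsub>GL_herm0\<^esub> g \<in> ?H" by blast
  qed
  moreover have "Z2 \<union> {neg_transpose} \<subseteq> ?H"
    unfolding Z2_eq neg_transpose_eq using neg by blast
  ultimately show "sign_transpose_group \<subseteq> ?H"
    by (intro group.generate_subgroup_incl[OF group_GL_herm0])
  have gen: "f \<in> sign_transpose_group" if "f \<in> Z2 \<union> {neg_transpose}" for f :: "complex^'n^'n \<Rightarrow> complex^'n^'n"
    using generate.incl[OF that] .
  have "conj_transpose_map (mat 1) 1 = conj_map (mat 1) (- 1) \<otimes>\<^bsub>GL_herm0\<^esub> neg_transpose"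
    unfolding neg_transpose_eq
    by (simp add: GL_mult_conj[OF unitary_mat_1 neg(1) unitary_mat_1 neg(1)] conj_map_compose[OF unitary_mat_1 unitary_mat_1])
  then have "conj_transpose_map (mat 1) 1 \<in> sign_transpose_group"
    using gen by (metis generate.eng Z2_eq UnI1 UnI2 insertI1 insertI2)
  then show "?H \<subseteq> sign_transpose_group"
    using gen unfolding Z2_eq neg_transpose_eq by (auto simp: sign_cases)
qed

text \<open>Minus the identity is detected by the trace of \<open>A\<^sup>3\<close>.\<close>

lemma Ad_neq_minus:
  fixes U :: "complex^'n^'n"
  assumes "CARD('n) \<ge> 3" and U: "unitary_matrix U"
  shows "\<exists>x\<in>sum0. Ad U (dg x) \<noteq> - dg x"
proof -
  obtain S :: "'n set" where "card S = 3" using obtain_subset_with_card_n[OF assms(1)] by metis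
  then obtain a b c :: 'n where abc: "a \<noteq> b" "a \<noteq> c" "b \<noteq> c" by (auto simp: card_3_iff)
  \<comment> \<open>Entries 2, -1, -1 have sum zero but sum of cubes 6; negation would reverse the
    sign of the latter.\<close>
  define x where "x = root_vec a b + root_vec a c"
  have "x \<in> sum0" unfolding x_def by (intro subspace_add[OF subspace_sum0] root_vec_sum0)
  moreover have "Ad U (dg x) \<noteq> - dg x"
  proof
    assume eq: "Ad U (dg x) = - dg x"
    have tr: "trace (dg x ** dg x ** dg x) = (\<Sum>k\<in>UNIV. complex_of_real (x$k * x$k * x$k))"
      by (simp add: trace_def dg_mult_nth dg_nth)
    have "x$k * x$k * x$k = (if k = a then 8 else 0) + (if k = b then - 1 else 0) + (if k = c then - 1 else 0)" for k
      using abc by (auto simp: x_def root_vec_nth)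
    then have "(\<Sum>k\<in>UNIV. complex_of_real (x$k * x$k * x$k)) = 6"
      by (simp only: of_real_sum[symmetric]) (simp add: sum.distrib)
    moreover have "trace (Ad U (dg x ** dg x ** dg x)) = trace (dg x ** dg x ** dg x)" using U by (rule trace_Ad)
    then have "trace (dg x ** dg x ** dg x) = - trace (dg x ** dg x ** dg x)"
      by (simp add: Ad_mult[OF U] eq matrix_mult_minus_left matrix_mult_minus_right trace_def sum_negf)
    ultimately show False by (simp add: tr)
  qed
  ultimately show ?thesis by blast
qed

text \<open>The transposition reverses products, which is detected by the trace of a triple product.\<close>

lemma Ad_neq_transpose:
  fixes U :: "complex^'n^'n"
  assumes "CARD('n) \<ge> 3" and U: "unitary_matrix U"
  shows "\<exists>A\<in>herm0. Ad U A \<noteq> transpose A"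
proof (rule ccontr)
  assume "\<not> ?thesis"
  then have eq: "Ad U A = transpose A" if "A \<in> herm0" for A using that by blast
  obtain S :: "'n set" where "card S = 3" using obtain_subset_with_card_n[OF assms(1)] by metis
  then obtain i j c :: 'n where ij: "i \<noteq> j" by (auto simp: card_3_iff)
  \<comment> \<open>Pauli matrices up to sign in the block of \<open>i\<close> and \<open>j\<close>:
    the products in the two orders have opposite nonzero traces against \<open>?C\<close>.\<close>
  let ?A = "pl i j 1" and ?B = "pl i j \<i>" and ?C = "dg (root_vec i j)"
  have h: "?A \<in> herm0" "?B \<in> herm0" "?C \<in> herm0" using pl_herm0[OF ij] by (auto simp: dg_herm0_iff)
  have "trace (?A ** ?B ** ?C) = trace (Ad U (?A ** ?B ** ?C))" using trace_Ad[OF U] by simp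
  also have "\<dots> = trace (transpose ?A ** transpose ?B ** transpose ?C)" by (simp add: Ad_mult[OF U] eq h)
  also have "\<dots> = trace (transpose (?C ** (?B ** ?A)))" by (simp add: matrix_transpose_mul matrix_mul_assoc)
  also have "\<dots> = trace (?C ** (?B ** ?A))" by (simp add: trace_def transpose_def)
  also have "\<dots> = trace (?B ** ?A ** ?C)" by (rule trace_mul_sym)
  finally have "(\<Sum>k\<in>UNIV. (?A ** ?B) $ k $ k * of_real (root_vec i j $ k)) = (\<Sum>k\<in>UNIV. (?B ** ?A) $ k $ k * of_real (root_vec i j $ k))"
    by (simp add: trace_def dg_mult_nth)
  moreover have "(?A ** ?B) $ k $ k * of_real (root_vec i j $ k) = (if k = i then - \<i> else 0) + (if k = j then - \<i> else 0)" for k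
    unfolding pl_mult_nth using ij by (auto simp: pl_def root_vec_nth)
  moreover have "(?B ** ?A) $ k $ k * of_real (root_vec i j $ k) = (if k = i then \<i> else 0) + (if k = j then \<i> else 0)" for k
    unfolding pl_mult_nth using ij by (auto simp: pl_def root_vec_nth)
  ultimately show False by (simp add: sum.distrib)
qed

lemma PSU_inter_sign_transpose:
  assumes "CARD('n) \<ge> 3"
  shows "PSU \<inter> sign_transpose_group = {\<one>\<^bsub>GL_herm0 :: (complex^'n^'n \<Rightarrow> complex^'n^'n) monoid\<^esub>}"
proof (intro equalityI subsetI)
  fix f :: "complex^'n^'n \<Rightarrow> complex^'n^'n" assume "f \<in> PSU \<inter> sign_transpose_group"
  then obtain U :: "complex^'n^'n" and s where U: "unitary_matrix U" "f = conj_map U 1"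
    and s: "\<bar>s\<bar> = 1" "f = conj_map (mat 1) s \<or> f = conj_transpose_map (mat 1) s"
    unfolding PSU_eq sign_transpose_group_eq by blast
  have fA: "f A = Ad U A" if "A \<in> herm0" for A using that by (simp add: U(2) conj_map_def)
  obtain x where x: "x \<in> sum0" "Ad U (dg x) \<noteq> - dg x" using Ad_neq_minus[OF assms U(1)] by blast
  \<comment> \<open>Transposition fixes diagonal matrices, so both forms of \<open>f\<close> act
    there as the sign \<open>s\<close>.\<close>
  have "f (dg x) = s *\<^sub>R dg x" using s(2) x(1) by (auto simp: conj_map_def conj_transpose_map_def dg_herm0_iff)
  then have "s = 1" using s(1) x fA[of "dg x"] by (auto simp: sign_cases dg_herm0_iff)
  moreover have "f \<noteq> conj_transpose_map (mat 1) 1"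
    using Ad_neq_transpose[OF assms U(1)] fA by (auto simp: conj_transpose_map_def)
  ultimately show "f \<in> {\<one>\<^bsub>GL_herm0\<^esub>}" using s(2) by (simp add: GL_one)
next
  fix f :: "complex^'n^'n \<Rightarrow> complex^'n^'n" assume "f \<in> {\<one>\<^bsub>GL_herm0\<^esub>}"
  then have "f = conj_map (mat 1) 1" by (simp add: GL_one)
  then show "f \<in> PSU \<inter> sign_transpose_group"
    using unitary_mat_1 unfolding PSU_eq sign_transpose_group_eq by (auto intro: exI[of _ "1::real"])
qed

lemma semidirect_product_isometry_group:
  fixes N :: "complex^'n^'n \<Rightarrow> real"
  assumes card: "CARD('n) \<ge> 3" and N: "norm_on herm0 N" "unitary_similarity_invariant N"
    and classification: "\<And>f. f \<in> isometry_group N \<Longrightarrow>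
      \<exists>U s. unitary_matrix U \<and> \<bar>s\<bar> = 1 \<and> (f = conj_map U s \<or> f = conj_transpose_map U s)"
  shows "internal_semidirect_product GL_herm0 (isometry_group N) PSU sign_transpose_group"
proof -
  let ?K = "isometry_group N" and ?G = "GL_herm0 :: (complex^'n^'n \<Rightarrow> complex^'n^'n) monoid"
  note conjK = conj_map_isometry_group[OF N]
  have K: "subgroup ?K ?G" by (rule subgroup_isometry_group)
  have PK: "PSU \<subseteq> ?K" using conjK(1) by (auto simp: PSU_eq)
  have HK: "sign_transpose_group \<subseteq> ?K"
    using conjK[OF unitary_mat_1] unfolding sign_transpose_group_eq by blast
  have gK: "group (?G\<lparr>carrier := ?K\<rparr>)" using group.subgroup_imp_group[OF group_GL_herm0 K] .
  have sP: "subgroup PSU (?G\<lparr>carrier := ?K\<rparr>)"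
    using group.subgroup_incl[OF group_GL_herm0 subgroup_PSU K PK] .
  have sH: "subgroup sign_transpose_group (?G\<lparr>carrier := ?K\<rparr>)"
    using group.subgroup_incl[OF group_GL_herm0 group.generate_is_subgroup[OF group_GL_herm0 generators_subset_GL_herm0] K HK] .
  have one: "\<bar>1::real\<bar> = 1" by simp
  have comm_right: "\<exists>V. unitary_matrix V \<and> conj_map U 1 \<otimes>\<^bsub>?G\<^esub> f = f \<otimes>\<^bsub>?G\<^esub> conj_map V 1"
    if f: "f \<in> ?K" and U: "unitary_matrix U" for f and U :: "complex^'n^'n"
  proof -
    obtain W s where W: "unitary_matrix W" "\<bar>s\<bar> = 1" "f = conj_map W s \<or> f = conj_transpose_map W s"
      using classification[OF f] by blast
    have W': "unitary_matrix (conj_transpose W)" using W(1) by (rule unitary_conj_transpose)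
    \<comment> \<open>Carrying \<open>U\<close> past \<open>W\<close> conjugates it by
      \<open>W\<close>; if \<open>f\<close> contains a transposition, passing it also conjugates the
      entries.\<close>
    define V where "V = conj_transpose W ** (U ** W)"
    have V: "unitary_matrix V" unfolding V_def by (intro unitary_mult W W' U)
    have WV: "W ** V = U ** W"
      using W(1) by (simp add: V_def matrix_mul_assoc unitary_matrix_def)
    have cV: "unitary_matrix (map_matrix cnj V)" "map_matrix cnj (map_matrix cnj V) = V"
      using unitary_cnj[OF V] by (auto simp: vec_eq_iff map_matrix_def)
    show ?thesis
    proof (cases "f = conj_map W s")
      case True
      then have "conj_map U 1 \<otimes>\<^bsub>?G\<^esub> f = f \<otimes>\<^bsub>?G\<^esub> conj_map V 1"
        using U V W by (simp add: GL_mult_conj conj_map_compose WV)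
      with V show ?thesis by blast
    next
      case False
      then have "f = conj_transpose_map W s" using W(3) by blast
      then have "conj_map U 1 \<otimes>\<^bsub>?G\<^esub> f = f \<otimes>\<^bsub>?G\<^esub> conj_map (map_matrix cnj V) 1"
        using U V W cV by (simp add: GL_mult_conj conj_map_compose WV)
      with cV show ?thesis by blast
    qed
  qed
  have comm_left: "\<exists>V. unitary_matrix V \<and> f \<otimes>\<^bsub>?G\<^esub> conj_map U 1 = conj_map V 1 \<otimes>\<^bsub>?G\<^esub> f"
    if f: "f \<in> ?K" and U: "unitary_matrix U" for f and U :: "complex^'n^'n"
  proof -
    obtain W s where W: "unitary_matrix W" "\<bar>s\<bar> = 1" "f = conj_map W s \<or> f = conj_transpose_map W s"
      using classification[OF f] by blast
    have W': "unitary_matrix (conj_transpose W)" using W(1) by (rule unitary_conj_transpose)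
    define V where "V Q = W ** Q ** conj_transpose W" for Q
    have V: "unitary_matrix (V Q)" if "unitary_matrix Q" for Q
      unfolding V_def by (intro unitary_mult W W' that)
    have WV: "V Q ** W = W ** Q" for Q
      using W(1) by (simp add: V_def matrix_mul_assoc[symmetric] unitary_matrix_def)
    show ?thesis
    proof (cases "f = conj_map W s")
      case True
      then have "f \<otimes>\<^bsub>?G\<^esub> conj_map U 1 = conj_map (V U) 1 \<otimes>\<^bsub>?G\<^esub> f"
        using U V[OF U] W by (simp add: GL_mult_conj conj_map_compose WV)
      with V[OF U] show ?thesis by blast
    next
      case False
      then have "f = conj_transpose_map W s" using W(3) by blast
      then have "f \<otimes>\<^bsub>?G\<^esub> conj_map U 1 = conj_map (V (map_matrix cnj U)) 1 \<otimes>\<^bsub>?G\<^esub> f"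
        using U V[OF unitary_cnj[OF U]] W by (simp add: GL_mult_conj conj_map_compose WV)
      with V[OF unitary_cnj[OF U]] show ?thesis by blast
    qed
  qed
  have "PSU \<lhd> (?G\<lparr>carrier := ?K\<rparr>)"
  proof (rule group.normalI[OF gK sP], intro ballI)
    fix f assume "f \<in> carrier (?G\<lparr>carrier := ?K\<rparr>)"
    then have f: "f \<in> ?K" by simp
    show "PSU #>\<^bsub>?G\<lparr>carrier := ?K\<rparr>\<^esub> f = f <#\<^bsub>?G\<lparr>carrier := ?K\<rparr>\<^esub> PSU"
      using comm_right[OF f] comm_left[OF f] by (fastforce simp: r_coset_def l_coset_def PSU_eq)
  qed
  moreover have "PSU <#>\<^bsub>?G\<^esub> sign_transpose_group = ?K"
  proof (intro equalityI subsetI)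
    fix f assume "f \<in> PSU <#>\<^bsub>?G\<^esub> sign_transpose_group"
    then show "f \<in> ?K"
      using PK HK subgroup.m_closed[OF K] by (auto simp: set_mult_def)
  next
    fix f assume "f \<in> ?K"
    then obtain U s where U: "unitary_matrix U" "\<bar>s\<bar> = 1" "f = conj_map U s \<or> f = conj_transpose_map U s"
      using classification by blast
    have "f = conj_map U 1 \<otimes>\<^bsub>?G\<^esub> conj_map (mat 1) s \<or> f = conj_map U 1 \<otimes>\<^bsub>?G\<^esub> conj_transpose_map (mat 1) s"
      using U(3) by (simp add: GL_mult_conj[OF U(1) one unitary_mat_1 U(2)] conj_map_compose[OF U(1) unitary_mat_1])
    moreover have "conj_map U 1 \<in> PSU" using U(1) by (auto simp: PSU_eq)
    moreover have "conj_map (mat 1) s \<in> sign_transpose_group" "conj_transpose_map (mat 1) s \<in> sign_transpose_group"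
      using U(2) unfolding sign_transpose_group_eq by blast+
    ultimately show "f \<in> PSU <#>\<^bsub>?G\<^esub> sign_transpose_group" unfolding set_mult_def by blast
  qed
  ultimately show ?thesis
    unfolding internal_semidirect_product_def
    using K sH PSU_inter_sign_transpose[OF card] by blast
qed

theorem theorem1:
  fixes N :: "complex^'n^'n \<Rightarrow> real"
  assumes "CARD('n) \<ge> 3"
    and "norm_on herm0 N"
    and "unitary_similarity_invariant N"
  shows "internal_semidirect_product GL_herm0 (isometry_group N)
           PSU (generate GL_herm0 (Z2 \<union> {neg_transpose}))
       \<or> isometry_group N = orthogonal_herm0"
\<comment> \<open>The dichotomy is whether \<open>N\<close> is constant on Frobenius
  spheres.\<close>
proof (cases "\<forall>X\<in>herm0. \<forall>Y\<in>herm0. norm X = norm Y \<longrightarrow> N X = N Y")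
  case True
  then show ?thesis using euclidean_isometry_group[OF assms(2,3)] by blast
next
  case False
  have "\<exists>U s. unitary_matrix U \<and> \<bar>s\<bar> = 1 \<and> (f = conj_map U s \<or> f = conj_transpose_map U s)"
    if "f \<in> isometry_group N" for f
  proof -
    have f: "f \<in> extensional herm0" "isometry N f" using that by (simp_all add: isometry_group_iff)
    then have "comm_isometry f" using isometry_imp_comm_isometry[OF assms(2,3) _ False] by blast
    then obtain U s where U: "unitary_matrix U" "\<bar>s\<bar> = (1::real)"
      "(\<forall>A\<in>herm0. f A = s *\<^sub>R Ad U A) \<or> (\<forall>A\<in>herm0. f A = s *\<^sub>R Ad U (transpose A))"
      using comm_isometry_classification[OF assms(1)] by blast
    from U(3) have "restrict f herm0 = conj_map U s \<or> restrict f herm0 = conj_transpose_map U s"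
    proof
      assume "\<forall>A\<in>herm0. f A = s *\<^sub>R Ad U A"
      then show ?thesis unfolding conj_map_def by (intro disjI1 restrict_ext) simp
    next
      assume "\<forall>A\<in>herm0. f A = s *\<^sub>R Ad U (transpose A)"
      then show ?thesis unfolding conj_transpose_map_def by (intro disjI2 restrict_ext) simp
    qed
    then have "f = conj_map U s \<or> f = conj_transpose_map U s"
      by (simp only: extensional_restrict[OF f(1)])
    with U(1,2) show ?thesis by blast
  qed
  then show ?thesis using semidirect_product_isometry_group[OF assms] by blast
qed

end
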